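(* Let $G$ be a nonplanar ribbon graph with no multiple edges and no loops, such that $G$ does not admit a proper witness pair. Then there exists a vertex $q$ of $G$ such that the rotor-routing action $\rho_q$ and the Bernardi action $\beta_q$ of $\mathrm{Pic}^0(G)$ on the set $\mathcal{T}(G)$ of spanning trees are different.
   Context: Graphs are finite and connected. A ribbon graph is a graph with, for each vertex $v$, a cyclic ordering of the edges at $v$. For edges $e_0,e_1$ at $v$ write $e_0\prec e_1$ if $e_1$ immediately succeeds $e_0$; the interval $[e_0,e_1]$ is $\{e_0,f_1,\dots,f_k,e_1\}$ with $e_0\prec f_1\prec\cdots\prec f_k\prec e_1$. A path is the image of a map from a path graph injective on edges; a cycle is the image of a map from a cycle graph injective on vertices and edges. For an oriented cycle $C$ and a vertex $v$ of $C$ with incoming/outgoing edges $e_{\mathrm{in}},e_{\mathrm{out}}$ in $C$, an edge at $v$ is to the left of $C$ if it lies in $[e_{\mathrm{out}},e_{\mathrm{in}}]$ and to the right if it lies in $[e_{\mathrm{in}},e_{\mathrm{out}}]$. A cycle $C$ is nonseparating if for any orientation of $C$ there is a path $P$ meeting $C$ only in its endpoints whose first edge is to the left of $C$ and last edge to the right of $C$; $(C,P)$ is a witness pair, proper if the endpoints of $P$ are distinct. A ribbon graph is nonplanar if it has a nonseparating cycle. Divisors: $\mathrm{Div}(G)$ is the free abelian group on $V(G)$; $\mathrm{Div}^d(G)$ the divisors of degree $d$. The Laplacian of $f:V\to\mathbb{Z}$ is $\Delta f=\sum_v\big(\sum_{e=\{v,w\}}(f(v)-f(w))\big)(v)$;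 its image is $\mathrm{Prin}(G)$, and $\mathrm{Pic}^d(G)=\mathrm{Div}^d(G)/\mathrm{Prin}(G)$. Let $g=|E(G)|-|V(G)|+1$. For a spanning tree $T$ with non-tree edges $f_1,\dots,f_g$, a break divisor for $T$ is $\sum_i(s_i)$ with $s_i$ an endpoint of $f_i$; every class in $\mathrm{Pic}^g(G)$ contains exactly one break divisor. Bernardi action: fix a vertex $q$ and an edge $e$ at $q$. For a spanning tree $T$, perform a tour starting at $q$, considering first the edge $e$: at the current vertex, edges are examined in cyclic order starting with the successor of the edge just used (at the start, starting with $e$); an edge not in $T$ is passed over, and the first edge of $T$ found is traversed. The tour ends upon returning to $q$ after traversing every edge of $T$ twice; each non-tree edge is passed over exactly twice, once from each endpoint. Placing a chip at the current vertex the first time each non-tree edge is passed over gives a break divisor $\beta_{(q,e)}(T)$, and $T\mapsto[\beta_{(q,e)}(T)]$ is a bijection $\mathcal{T}(G)\to\mathrm{Pic}^g(G)$. Define $\beta_q([D],T)=\beta_{(q,e)}^{-1}([D]+[\beta_{(q,e)}(T)])$; this does not depend on $e$. Rotor-routing action: fix a sink $q$. A rotor configuration assigns to each vertex $w\neq q$ an incident edge (its rotor) and has a chip at a vertex. A step with chip at $v\neq q$ advances the rotor at $v$ to its successor in the cyclic order at $v$ and moves the chip along this new rotor to its other endpoint. For a spanning tree $T$, let $\sigma_T(w)$ be the first edge of the $T$-path from $w$ to $q$. Starting from $\sigma_T$ with chip at $v$, iterate until the chip reaches $q$; the final rotors form a spanning tree $T'$, and $\rho_q([(v)-(q)],T)=T'$.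 This extends to a well-defined action $\rho_q$ of $\mathrm{Pic}^0(G)$ on $\mathcal{T}(G)$. *)

theory Defs
  imports
    "Graph_Theory.Graph_Theory"
    "HOL-Combinatorics.Orbits"
    "HOL-Algebra.Group_Action"
    "HOL-Algebra.Free_Abelian_Groups"
    "HOL-Library.While_Combinator"
begin

text \<open>
  A finite connected multigraph (parallel edges and loops allowed) is a connected finite
  bidirected digraph: every edge is a pair of mutually inverse arcs \<open>{a, arev a}\<close>. An arc \<open>a\<close>
  stands for its edge seen as an edge at the vertex \<open>tail G a\<close>, so the edges at \<open>v\<close> are
  \<open>out_arcs G v\<close> (a loop occurs twice there). The ribbon structure \<open>succ\<close> maps an edge at a
  vertex to its immediate successor in the cyclic order at that vertex. Sets of edges are
  represented by the sets of their arcs, closed under \<open>arev\<close>.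
\<close>

locale ribbon_graph = bidirected_digraph G arev + fin_digraph G
  for G :: "('v, 'a) pre_digraph" and arev :: "'a \<Rightarrow> 'a" +
  fixes succ :: "'a \<Rightarrow> 'a"
  assumes connected_G: "Digraph_Component.connected G"
    and succ_cyclic: "\<And>v. v \<in> verts G \<Longrightarrow> out_arcs G v \<noteq> {} \<Longrightarrow> cyclic_on succ (out_arcs G v)"
begin

definition edge :: "'a \<Rightarrow> 'a set" where
  "edge a = {a, arev a}"

definition interval :: "'a \<Rightarrow> 'a \<Rightarrow> 'a set" where
  "interval e0 e1 = {(succ ^^ i) e0 | i. \<forall>j<i. (succ ^^ j) e0 \<noteq> e1}"


subsection \<open>Cycles, witness pairs, nonplanarity\<close>

text \<open>
  The library's \<open>cycle\<close> is a directed one and admits \<open>[a, arev a]\<close>; injectivity on edges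
  excludes this.
\<close>

definition oriented_cycle :: "'a list \<Rightarrow> bool" where
  "oriented_cycle c \<longleftrightarrow> cycle c \<and> distinct (map edge c)"

definition orientation_of :: "'a list \<Rightarrow> 'a set \<Rightarrow> bool" where
  "orientation_of c C \<longleftrightarrow> oriented_cycle c \<and> C = \<Union> (edge ` set c)"

definition is_cycle :: "'a set \<Rightarrow> bool" where
  "is_cycle C \<longleftrightarrow> (\<exists>c. orientation_of c C)"

text \<open>
  For an edge \<open>x\<close> at a vertex of \<open>c\<close>: the outgoing edge there is the arc \<open>e_out\<close> of \<open>c\<close>; the
  incoming arc \<open>b\<close> of \<open>c\<close>, seen as an edge at its head, is \<open>arev b\<close>.
\<close>

definition left_of :: "'a list \<Rightarrow> 'a \<Rightarrow> bool" where
  "left_of c x \<longleftrightarrow> (\<exists>e_out\<in>set c. \<exists>b\<in>set c. tail G e_out = tail G x \<and> head G b = tail G x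
     \<and> x \<in> interval e_out (arev b))"

definition right_of :: "'a list \<Rightarrow> 'a \<Rightarrow> bool" where
  "right_of c x \<longleftrightarrow> (\<exists>e_out\<in>set c. \<exists>b\<in>set c. tail G e_out = tail G x \<and> head G b = tail G x
     \<and> x \<in> interval (arev b) e_out)"

definition is_path :: "'a list \<Rightarrow> bool" where
  "is_path p \<longleftrightarrow> p \<noteq> [] \<and> awalk (tail G (hd p)) p (head G (last p)) \<and> distinct (map edge p)"

text \<open>
  ``Meeting \<open>C\<close> only in its endpoints'': the endpoints lie on \<open>C\<close>, no interior vertex
  of the path does, and no edge of the path belongs to \<open>C\<close>.
\<close>

definition meets_only_in_endpoints :: "'a list \<Rightarrow> 'a set \<Rightarrow> bool" where
  "meets_only_in_endpoints p C \<longleftrightarrow>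
     tail G (hd p) \<in> tail G ` C \<and> head G (last p) \<in> tail G ` C
     \<and> tail G ` set (tl p) \<inter> tail G ` C = {} \<and> set p \<inter> C = {}"

definition left_to_right_path :: "'a list \<Rightarrow> 'a set \<Rightarrow> 'a list \<Rightarrow> bool" where
  "left_to_right_path c C p \<longleftrightarrow> is_path p \<and> meets_only_in_endpoints p C
     \<and> left_of c (hd p) \<and> right_of c (arev (last p))"

definition nonseparating :: "'a set \<Rightarrow> bool" where
  "nonseparating C \<longleftrightarrow>
     is_cycle C \<and> (\<forall>c. orientation_of c C \<longrightarrow> (\<exists>p. left_to_right_path c C p))"

definition witness_pair :: "'a set \<Rightarrow> 'a list \<Rightarrow> bool" where
  "witness_pair C p \<longleftrightarrow>
     nonseparating C \<and> (\<exists>c. orientation_of c C \<and> left_to_right_path c C p)"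

definition proper_witness_pair :: "'a set \<Rightarrow> 'a list \<Rightarrow> bool" where
  "proper_witness_pair C p \<longleftrightarrow> witness_pair C p \<and> tail G (hd p) \<noteq> head G (last p)"

definition nonplanar :: bool where
  "nonplanar \<longleftrightarrow> (\<exists>C. nonseparating C)"


subsection \<open>Divisors and the Picard group\<close>

abbreviation Divs :: "('v \<Rightarrow>\<^sub>0 int) monoid" where
  "Divs \<equiv> free_Abelian_group (verts G)"

definition deg :: "('v \<Rightarrow>\<^sub>0 int) \<Rightarrow> int" where
  "deg D = (\<Sum>v\<in>Poly_Mapping.keys D. Poly_Mapping.lookup D v)"

definition laplacian :: "('v \<Rightarrow> int) \<Rightarrow> ('v \<Rightarrow>\<^sub>0 int)" where
  "laplacian f =
     (\<Sum>v\<in>verts G. Poly_Mapping.single v (\<Sum>a\<in>out_arcs G v. f v - f (head G a)))"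

definition Prin :: "('v \<Rightarrow>\<^sub>0 int) set" where
  "Prin = range laplacian"

definition Pic0 :: "('v \<Rightarrow>\<^sub>0 int) set monoid" where
  "Pic0 = (Divs\<lparr>carrier := {D \<in> carrier Divs. deg D = 0}\<rparr>) Mod Prin"

definition divisor_class :: "('v \<Rightarrow>\<^sub>0 int) \<Rightarrow> ('v \<Rightarrow>\<^sub>0 int) set" where
  "divisor_class D = Prin #>\<^bsub>Divs\<^esub> D"

definition spanning_trees :: "'a set set" where
  "spanning_trees = {T. T \<subseteq> arcs G \<and> arev ` T \<subseteq> T \<and>
     Digraph_Component.connected (G\<lparr>arcs := T\<rparr>) \<and> \<not> (\<exists>C. is_cycle C \<and> C \<subseteq> T)}"


subsection \<open>The Bernardi action\<close>

text \<open>
  Examining an edge \<open>a\<close> at the current vertex: it is traversed if it lies in \<open>T\<close>, and the next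
  edge examined is then the successor of the same edge at its other end; otherwise it is
  passed over.
\<close>

definition tour_step :: "'a set \<Rightarrow> 'a \<Rightarrow> 'a" where
  "tour_step T a = (if a \<in> T then succ (arev a) else succ a)"

text \<open>
  The tour examines \<open>card (arcs G)\<close> edges: each edge of \<open>T\<close> is traversed twice and every other
  edge is passed over twice. The chip for a non-tree edge is placed when it is
  passed over for the first time. The starting vertex is \<open>tail G e\<close>.
\<close>

definition bernardi_divisor :: "'a \<Rightarrow> 'a set \<Rightarrow> ('v \<Rightarrow>\<^sub>0 int)" where
  "bernardi_divisor e T =
     (let d = (\<lambda>i. (tour_step T ^^ i) e) in
      \<Sum>i | i < card (arcs G) \<and> d i \<notin> T \<and> (\<forall>j<i. d j \<notin> edge (d i)). frag_of (tail G (d i)))"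

text \<open>
  \<open>\<beta>\<^sub>q\<close> for \<open>q = tail G e\<close>; mathematically it depends on \<open>e\<close> only through \<open>q\<close>.
\<close>

definition bernardi_action :: "'a \<Rightarrow> ('v \<Rightarrow>\<^sub>0 int) set \<Rightarrow> 'a set \<Rightarrow> 'a set" where
  "bernardi_action e c T =
     inv_into spanning_trees (\<lambda>T'. divisor_class (bernardi_divisor e T'))
       (c <#>\<^bsub>Divs\<^esub> divisor_class (bernardi_divisor e T))"


subsection \<open>The rotor-routing action\<close>

definition rotor_step :: "('v \<Rightarrow> 'a) \<times> 'v \<Rightarrow> ('v \<Rightarrow> 'a) \<times> 'v" where
  "rotor_step = (\<lambda>(\<sigma>, v). let a = succ (\<sigma> v) in (\<sigma>(v := a), head G a))"

definition tree_rotors :: "'v \<Rightarrow> 'a set \<Rightarrow> 'v \<Rightarrow> 'a" where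
  "tree_rotors q T w = (THE a. \<exists>p. apath w (a # p) q \<and> set (a # p) \<subseteq> T)"

definition rotor_route :: "'v \<Rightarrow> 'v \<Rightarrow> 'a set \<Rightarrow> 'a set" where
  "rotor_route q v T =
     (let \<sigma> = fst (while (\<lambda>(\<sigma>, v). v \<noteq> q) rotor_step (tree_rotors q T, v))
      in \<Union>w \<in> verts G - {q}. edge (\<sigma> w))"

text \<open>
  The action of \<open>Pic0\<close> determined by its values on the generators \<open>[(v) - (q)]\<close>. The condition
  \<open>\<phi> \<in> extensional _\<close> only makes \<open>\<phi>\<close> unique as a HOL function, by fixing its values outside
  the carrier.
\<close>

definition rotor_action :: "'v \<Rightarrow> ('v \<Rightarrow>\<^sub>0 int) set \<Rightarrow> 'a set \<Rightarrow> 'a set" where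
  "rotor_action q =
     (THE \<phi>. \<phi> \<in> extensional (carrier Pic0) \<and> group_action Pic0 spanning_trees \<phi> \<and>
        (\<forall>v\<in>verts G. \<forall>T\<in>spanning_trees.
           \<phi> (divisor_class (frag_of v - frag_of q)) T = rotor_route q v T))"

end

end

theory Submission
  imports Defs
begin

text \<open>
  If no witness pair is proper, a witness path \<open>P\<close> for a nonseparating cycle \<open>C\<close> starts and ends
  at the same vertex \<open>v\<close>, and \<open>v\<close> separates \<open>C\<close> from the component \<open>K\<close> of \<open>G - v\<close> that contains
  the interior of \<open>P\<close>; the first and last edge of \<open>P\<close> lie on different sides of \<open>C\<close> at \<open>v\<close>. Let
  \<open>q\<close> be the successor of \<open>v\<close> on \<open>C\<close>. Choose spanning trees \<open>T\<close>, \<open>T'\<close> that differ only in that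
  the rotor of \<open>v\<close> towards \<open>q\<close> is one or the other edge of \<open>C\<close> at \<open>v\<close>, and that meet the edges
  between \<open>v\<close> and \<open>K\<close> only in the last edge of \<open>P\<close>. Let \<open>I\<close> be the set of edges from \<open>v\<close> to \<open>K\<close> between
  these two rotors, and \<open>J b\<close> the number of edges of \<open>I\<close> at \<open>b \<in> K\<close>. Turning the rotor of \<open>v\<close>
  from \<open>T\<close> to \<open>T'\<close> shows that the divisor taking \<open>T\<close> to \<open>T'\<close> under rotor-routing has
  coefficient \<open>- J b\<close> at \<open>b\<close>, whereas the Bernardi divisors of \<open>T'\<close> and \<open>T\<close> differ at \<open>b\<close> by \<open>J b\<close>.
  If the two actions agreed, some \<open>f\<close> with \<open>f v = 0\<close> would have Laplacian \<open>2 J\<close> on \<open>K\<close>; the maximum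
  principle forces \<open>f\<close> to be a positive constant there, which is impossible at the endpoint of the last
  edge of \<open>P\<close>, where \<open>J\<close> vanishes because there are no multiple edges.

  Rotor-routing is treated through pairs of rotor configuration and divisor: advancing each
  rotor \<open>w \<noteq> q\<close> some number of times takes \<open>\<sigma>\<close> to \<open>\<sigma>'\<close> at the expense of a divisor that is
  unique modulo principal divisors. Two configurations directed towards \<open>q\<close> that are related by a
  principal divisor are equal, since the vertices with a positive net number of turns would
  be closed under the final rotors; hence every class acts by a permutation of the spanning trees.
\<close>

subsection \<open>Iterating cyclic maps\<close>

lemma cyclic_on_enum:
  assumes "cyclic_on f S" "s \<in> S"
  shows "bij_betw (\<lambda>i. (f ^^ i) s) {..<card S} S" "(f ^^ card S) s = s"
proof -
  let ?d = "funpow_dist1 f s s"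
  have S: "S = Orbits.orbit f s" using assms orbit_cyclic_eq3 by metis
  have self: "s \<in> Orbits.orbit f s" using S assms by simp
  have inj: "inj_on (\<lambda>n. (f ^^ n) s) {0..<?d}" by (rule inj_on_funpow_dist1[OF self])
  have img: "S = (\<lambda>n. (f ^^ n) s) ` {0..<?d}" using orbit_conv_funpow_dist1[OF self] S by simp
  have d: "card S = ?d" using card_image[OF inj] img by simp
  show "bij_betw (\<lambda>i. (f ^^ i) s) {..<card S} S"
    unfolding d using inj img by (simp add: bij_betw_def atLeast0LessThan)
  show "(f ^^ card S) s = s" unfolding d by (rule funpow_dist1_prop[OF self])
qed

lemma funpow_period:
  assumes "finite S" "inj_on f S" "f ` S \<subseteq> S" "x \<in> S"
  obtains n where "0 < n" "(f ^^ n) x = x"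
proof -
  \<comment> \<open>\<open>funpow_inj_finite\<close> speaks of globally injective maps, so
    \<open>f\<close> is extended by the identity outside \<open>S\<close>.\<close>
  define p where "p y = (if y \<in> S then f y else y)" for y
  have "inj p"
    using assms(2,3) by (auto simp: inj_def p_def inj_on_def image_subset_iff split: if_splits)
  have pn: "(p ^^ n) x = (f ^^ n) x \<and> (f ^^ n) x \<in> S" for n
    by (induction n) (use assms in \<open>auto simp: p_def\<close>)
  then have "{y. \<exists>n. y = (p ^^ n) x} \<subseteq> S" by auto
  then have "finite {y. \<exists>n. y = (p ^^ n) x}" using assms(1) finite_subset by blast
  then show thesis using funpow_inj_finite[OF \<open>inj p\<close>, of x] pn that by metis
qed

lemma funpow_reach_trans: "\<exists>n. (f ^^ n) x = y \<Longrightarrow> \<exists>n. (f ^^ n) y = z \<Longrightarrow> \<exists>n. (f ^^ n) x = z"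
  by (metis comp_apply funpow_add)

lemma funpow_reach_sym:
  assumes "finite S" "inj_on f S" "f ` S \<subseteq> S" "x \<in> S" "\<exists>n. (f ^^ n) x = y"
  shows "\<exists>n. (f ^^ n) y = x"
proof -
  obtain n where n: "(f ^^ n) x = y" using assms(5) by blast
  obtain p where p: "0 < p" "(f ^^ p) x = x" using funpow_period[OF assms(1-4)] by blast
  \<comment> \<open>As \<open>p\<close> is positive, \<open>p * n - n\<close> is a true difference.
    With the \<open>n\<close> steps from \<open>x\<close> to \<open>y\<close> it adds up to a
    multiple of the period.\<close>
  have "(f ^^ (p * n - n)) y = (f ^^ (p * n - n + n)) x" using n by (simp add: funpow_add)
  also have "p * n - n + n = n * p" using p(1) by simp
  also have "(f ^^ (n * p)) x = x" using p(2) by (induction n) (simp_all add: funpow_add)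
  finally show ?thesis by blast
qed

text \<open>With the tour step for \<open>f\<close>, this is the time at which the Bernardi tour
  starting at \<open>e\<close> examines \<open>x\<close>; all later comparisons of tours are
  comparisons of such times.\<close>

definition pos :: "('b \<Rightarrow> 'b) \<Rightarrow> 'b \<Rightarrow> 'b \<Rightarrow> nat" where
  "pos f e x = (LEAST i. (f ^^ i) e = x)"

lemma funpow_pos:
  assumes "cyclic_on f S" "e \<in> S" "x \<in> S"
  shows "pos f e x < card S" "(f ^^ pos f e x) e = x"
proof -
  have "x \<in> (\<lambda>i. (f ^^ i) e) ` {..<card S}"
    using bij_betw_imp_surj_on[OF cyclic_on_enum(1)[OF assms(1,2)]] assms(3) by simp
  then obtain i where i: "i < card S" "(f ^^ i) e = x" by auto
  show "(f ^^ pos f e x) e = x" unfolding pos_def by (rule LeastI[of _ i]) (rule i(2))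
  have "pos f e x \<le> i" unfolding pos_def by (rule Least_le) (rule i(2))
  then show "pos f e x < card S" using i(1) by simp
qed

lemma pos_funpow:
  assumes "cyclic_on f S" "e \<in> S" "i < card S"
  shows "pos f e ((f ^^ i) e) = i"
proof -
  have x: "(f ^^ i) e \<in> S" by (rule cyclic_on_funpow_in[OF assms(1,2)])
  show ?thesis
    by (rule inj_onD[OF bij_betw_imp_inj_on[OF cyclic_on_enum(1)[OF assms(1,2)]]])
      (use funpow_pos[OF assms(1,2) x] assms(3) in auto)
qed

lemma pos_eq_iff:
  assumes "cyclic_on f S" "e \<in> S" "x \<in> S" "y \<in> S"
  shows "pos f e x = pos f e y \<longleftrightarrow> x = y"
  using funpow_pos(2)[OF assms(1,2)] assms(3,4) by metis

lemma pos_Suc: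
  assumes "cyclic_on f S" "e \<in> S" "x \<in> S" "f x \<noteq> e"
  shows "pos f e (f x) = Suc (pos f e x)"
proof -
  note x = funpow_pos[OF assms(1-3)]
  have fx: "(f ^^ Suc (pos f e x)) e = f x" using x(2) by simp
  have "Suc (pos f e x) \<noteq> card S"
    using fx assms(4) cyclic_on_enum(2)[OF assms(1,2)] by metis
  then have "Suc (pos f e x) < card S" using x(1) by simp
  from pos_funpow[OF assms(1,2) this] show ?thesis using fx by simp
qed

context ribbon_graph
begin

subsection \<open>Spanning trees and rotor configurations\<close>

lemma edge_arev [simp]: "edge (arev a) = edge a"
  by (auto simp: edge_def)

lemma mem_edge_iff: "b \<in> edge a \<longleftrightarrow> b = a \<or> b = arev a"
  by (auto simp: edge_def)

declare finite_out_arcs [simp]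

lemma edge_eq_iff: "edge a = edge b \<longleftrightarrow> a = b \<or> a = arev b"
  by (metis edge_arev mem_edge_iff)

section \<open>Reachability along a set of arcs\<close>

definition adj :: "'a set \<Rightarrow> ('v \<times> 'v) set" where
  "adj A = (\<lambda>a. (tail G a, head G a)) ` A"

lemma adjI: "a \<in> A \<Longrightarrow> (tail G a, head G a) \<in> adj A"
  by (auto simp: adj_def)

lemma adj_mono: "A \<subseteq> B \<Longrightarrow> (adj A)\<^sup>* \<subseteq> (adj B)\<^sup>*"
  by (intro rtrancl_mono) (auto simp: adj_def)

lemma adj_rtrancl_sym:
  assumes "A \<subseteq> arcs G" "arev ` A \<subseteq> A" "(u, w) \<in> (adj A)\<^sup>*"
  shows "(w, u) \<in> (adj A)\<^sup>*"
proof -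
  have "sym (adj A)"
  proof (rule symI)
    fix x y assume "(x, y) \<in> adj A"
    then obtain a where "a \<in> A" "x = tail G a" "y = head G a" by (auto simp: adj_def)
    then show "(y, x) \<in> adj A" using assms adjI[of "arev a" A] by (metis head_arev image_subset_iff subsetD tail_arev)
  qed
  then show ?thesis using assms(3) by (meson sym_rtrancl symD)
qed

lemma adj_rtrancl_verts:
  assumes "A \<subseteq> arcs G" "(u, w) \<in> (adj A)\<^sup>*" "u \<in> verts G"
  shows "w \<in> verts G"
  using assms(2,3) by induction (use assms(1) in \<open>auto simp: adj_def\<close>)

lemma apath_of_adj:
  assumes "A \<subseteq> arcs G" "(u, w) \<in> (adj A)\<^sup>*" "u \<in> verts G"
  obtains p where "apath u p w" "set p \<subseteq> A"
proof -
  have "\<exists>p. awalk u p w \<and> set p \<subseteq> A"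
    using assms(2)
  proof induction
    case base
    then show ?case using assms(3) by (intro exI[of _ "[]"]) (auto simp: awalk_Nil_iff)
  next
    case (step y z)
    then obtain p a where p: "awalk u p y" "set p \<subseteq> A" "a \<in> A" "y = tail G a" "z = head G a"
      by (auto simp: adj_def)
    have "awalk y [a] z" using p assms(1) by (auto simp: awalk_Cons_iff awalk_Nil_iff)
    then have "awalk u (p @ [a]) z" using p by auto
    then show ?case using p by (intro exI[of _ "p @ [a]"]) auto
  qed
  then obtain p where p: "awalk u p w" "set p \<subseteq> A" by blast
  show thesis
    using that[OF apath_awalk_to_apath[OF p(1)]] awalk_to_apath_subset[OF p(1)] p(2) by blast
qed

lemma awalk_adj:
  assumes "awalk u p w" "set p \<subseteq> A"
  shows "(u, w) \<in> (adj A)\<^sup>*"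
  using assms
proof (induction p arbitrary: u)
  case Nil
  then show ?case by (auto simp: awalk_Nil_iff)
next
  case (Cons a p)
  then have "(head G a, w) \<in> (adj A)\<^sup>*" "u = tail G a" by (auto simp: awalk_Cons_iff)
  then show ?case using Cons.prems adjI[of a A] by (auto intro: converse_rtrancl_into_rtrancl)
qed

text \<open>A path that never returns to its starting vertex cannot use its first edge again in
  either direction, because both arcs of that edge touch the starting vertex.\<close>

lemma apath_distinct_edges: "apath u p w \<Longrightarrow> distinct (map edge p)"
proof (induction p arbitrary: u)
  case Nil
  then show ?case by simp
next
  case (Cons a p)
  then have a: "a \<in> arcs G" "u = tail G a" "apath (head G a) p w" "u \<notin> set (awalk_verts (head G a) p)"
    by (auto simp: apath_Cons_iff)
  have "edge a \<noteq> edge b" if b: "b \<in> set p" for b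
  proof
    assume "edge a = edge b"
    then have "b = a \<or> b = arev a" by (auto simp: edge_eq_iff)
    then have "tail G b = u \<or> head G b = u" using a by auto
    moreover have "tail G b \<in> set (awalk_verts (head G a) p)" "head G b \<in> set (awalk_verts (head G a) p)"
      using b a(3) awalk_verts_arc1[of b p] awalk_verts_arc2 by (auto simp: apath_def)
    ultimately show False using a by auto
  qed
  then show ?case using Cons.IH[OF a(3)] by auto
qed

section \<open>Acyclicity expressed by bridges\<close>

definition bridges :: "'a set \<Rightarrow> bool" where
  "bridges T \<longleftrightarrow> (\<forall>x\<in>T. (head G x, tail G x) \<notin> (adj (T - edge x))\<^sup>*)"

text \<open>Going around a cycle joins the ends of any of its edges without that edge. Conversely, a
  path joining the ends of \<open>x\<close> that avoids \<open>edge x\<close> closes up with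
  \<open>x\<close> to a cycle; for a loop this path is empty.\<close>

lemma bridges_iff_no_cycle:
  assumes T: "T \<subseteq> arcs G" "arev ` T \<subseteq> T"
  shows "bridges T \<longleftrightarrow> \<not> (\<exists>C. is_cycle C \<and> C \<subseteq> T)"
proof
  assume br: "bridges T"
  show "\<not> (\<exists>C. is_cycle C \<and> C \<subseteq> T)"
  proof
    assume "\<exists>C. is_cycle C \<and> C \<subseteq> T"
    then obtain c where c: "oriented_cycle c" "\<Union> (edge ` set c) \<subseteq> T"
      by (auto simp: is_cycle_def orientation_of_def)
    then obtain u where u: "awalk u c u" "c \<noteq> []" "distinct (map edge c)"
      by (auto simp: oriented_cycle_def cycle_def)
    obtain x p where xp: "c = x # p" using u by (cases c) auto
    have sub: "set c \<subseteq> T" using c(2) by (auto simp: edge_def)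
    have "set p \<subseteq> T - edge x"
    proof
      fix y assume y: "y \<in> set p"
      then have "edge y \<noteq> edge x" using u(3) xp by auto
      then show "y \<in> T - edge x" using y sub xp by (auto simp: edge_def)
    qed
    moreover have "awalk (head G x) p (tail G x)" "x \<in> T"
      using u xp sub by (auto simp: awalk_Cons_iff)
    ultimately show False using awalk_adj br unfolding bridges_def by blast
  qed
next
  assume nc: "\<not> (\<exists>C. is_cycle C \<and> C \<subseteq> T)"
  show "bridges T"
    unfolding bridges_def
  proof (intro ballI notI)
    fix x assume x: "x \<in> T" "(head G x, tail G x) \<in> (adj (T - edge x))\<^sup>*"
    obtain p where p: "apath (head G x) p (tail G x)" "set p \<subseteq> T - edge x"
      using apath_of_adj[OF _ x(2)] T x(1) by (metis Diff_subset head_in_verts order_trans subsetD)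
    have "awalk (tail G x) (x # p) (tail G x)" using p x T by (auto simp: awalk_Cons_iff apath_def)
    moreover have "distinct (tl (awalk_verts (tail G x) (x # p)))" using p by (auto simp: apath_def)
    ultimately have "cycle (x # p)" unfolding cycle_def by blast
    moreover have "edge x \<noteq> edge y" if "y \<in> set p" for y
      using that p(2) by (metis DiffE edge_arev edge_eq_iff mem_edge_iff subsetD)
    then have "distinct (map edge (x # p))"
      using apath_distinct_edges[OF p(1)] by auto
    ultimately have "is_cycle (\<Union> (edge ` set (x # p)))"
      unfolding is_cycle_def orientation_of_def oriented_cycle_def by blast
    moreover have "\<Union> (edge ` set (x # p)) \<subseteq> T" using T x p by (auto simp: edge_def)
    ultimately show False using nc by blast
  qed
qed

text \<open>Connectedness is defined by directed walks in the symmetric closure. A set closed under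
  \<open>arev\<close> already contains both directions of each edge, so the closure adds no
  adjacency.\<close>

lemma connected_arcs_iff:
  assumes T: "T \<subseteq> arcs G" "arev ` T \<subseteq> T"
  shows "Digraph_Component.connected (G\<lparr>arcs := T\<rparr>) \<longleftrightarrow>
    verts G \<noteq> {} \<and> (\<forall>u\<in>verts G. \<forall>w\<in>verts G. (u, w) \<in> (adj T)\<^sup>*)"
proof -
  let ?H = "with_proj (mk_symmetric (G\<lparr>arcs := T\<rparr>))"
  have ends: "arcs_ends ?H = adj T"
  proof -
    have "arcs_ends ?H = (\<Union>e\<in>T. {(tail G e, head G e), (head G e, tail G e)})"
      by (auto simp: arcs_ends_def arc_to_ends_def mk_symmetric_def)
    also have "\<dots> = adj T"
    proof (intro equalityI subsetI)
      fix z assume "z \<in> (\<Union>e\<in>T. {(tail G e, head G e), (head G e, tail G e)})"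
      then obtain e where e: "e \<in> T" "z = (tail G e, head G e) \<or> z = (head G e, tail G e)" by auto
      then show "z \<in> adj T"
        using adjI[of e T] adjI[of "arev e" T] T by (metis head_arev image_subset_iff subsetD tail_arev)
    qed (auto simp: adj_def)
    finally show ?thesis .
  qed
  have "u \<rightarrow>\<^sup>*\<^bsub>?H\<^esub> w \<longleftrightarrow> (u, w) \<in> (adj T)\<^sup>*" if u: "u \<in> verts G" for u w
  proof
    assume "u \<rightarrow>\<^sup>*\<^bsub>?H\<^esub> w"
    then show "(u, w) \<in> (adj T)\<^sup>*" unfolding reachable_def ends by (rule rtrancl_on_rtranclI)
  next
    assume "(u, w) \<in> (adj T)\<^sup>*"
    then show "u \<rightarrow>\<^sup>*\<^bsub>?H\<^esub> w"
      unfolding reachable_def ends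
    proof induction
      case base
      then show ?case using u by (auto simp: mk_symmetric_def)
    next
      case (step y z)
      then have "z \<in> verts G" using T by (auto simp: adj_def)
      then show ?case using step by (auto intro: rtrancl_on_into_rtrancl_on simp: mk_symmetric_def)
    qed
  qed
  then show ?thesis
    by (auto simp: Digraph_Component.connected_def strongly_connected_def mk_symmetric_def)
qed

lemma spanning_trees_iff:
  "T \<in> spanning_trees \<longleftrightarrow> T \<subseteq> arcs G \<and> arev ` T \<subseteq> T \<and> verts G \<noteq> {} \<and>
     (\<forall>u\<in>verts G. \<forall>w\<in>verts G. (u, w) \<in> (adj T)\<^sup>*) \<and> bridges T"
  unfolding spanning_trees_def mem_Collect_eq using connected_arcs_iff[of T] bridges_iff_no_cycle[of T] by meson

lemma adj_arcs_connected: "u \<in> verts G \<Longrightarrow> w \<in> verts G \<Longrightarrow> (u, w) \<in> (adj (arcs G))\<^sup>*"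
  using connected_G connected_arcs_iff[of "arcs G"] arev_in_arcs by (simp add: image_subset_iff)

section \<open>Rotor configurations directed towards a sink\<close>

definition follow :: "'v \<Rightarrow> ('v \<Rightarrow> 'a) \<Rightarrow> ('v \<times> 'v) set" where
  "follow q \<sigma> = (\<lambda>w. (w, head G (\<sigma> w))) ` (verts G - {q})"

text \<open>Spanning trees oriented towards \<open>q\<close>, in the form of rotor configurations.
  The value at \<open>q\<close> is left open, so configurations are compared only away from
  \<open>q\<close>.\<close>

definition rooted :: "'v \<Rightarrow> ('v \<Rightarrow> 'a) \<Rightarrow> bool" where
  "rooted q \<sigma> \<longleftrightarrow> q \<in> verts G \<and>
     (\<forall>w\<in>verts G - {q}. \<sigma> w \<in> out_arcs G w \<and> (w, q) \<in> (follow q \<sigma>)\<^sup>*)"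

definition rotor_tree :: "'v \<Rightarrow> ('v \<Rightarrow> 'a) \<Rightarrow> 'a set" where
  "rotor_tree q \<sigma> = (\<Union>w\<in>verts G - {q}. edge (\<sigma> w))"

lemma rootedD:
  assumes "rooted q \<sigma>" "w \<in> verts G" "w \<noteq> q"
  shows "\<sigma> w \<in> arcs G" "tail G (\<sigma> w) = w" "head G (\<sigma> w) \<in> verts G"
  using assms by (auto simp: rooted_def)

lemma follow_iff: "(w, u) \<in> follow q \<sigma> \<longleftrightarrow> w \<in> verts G \<and> w \<noteq> q \<and> u = head G (\<sigma> w)"
  by (auto simp: follow_def)

text \<open>Following the rotors from a point of \<open>A\<close> would lead to \<open>q\<close>,
  which is outside \<open>A\<close>. This replaces induction along the tree: a property holds at
  every vertex other than \<open>q\<close> once the set of its exceptions is closed under the rotors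
  of some rooted configuration.\<close>

lemma rooted_closed_empty:
  assumes "rooted q \<sigma>" "A \<subseteq> verts G - {q}" "\<And>w. w \<in> A \<Longrightarrow> head G (\<sigma> w) \<in> A"
  shows "A = {}"
proof (rule ccontr)
  assume "A \<noteq> {}"
  then obtain w where w: "w \<in> A" by blast
  have "(w, q) \<in> (follow q \<sigma>)\<^sup>*" using assms w by (auto simp: rooted_def)
  then have "q \<in> A" by induction (use w assms(3) in \<open>auto simp: follow_iff\<close>)
  then show False using assms by auto
qed

lemma rotor_tree_cong:
  "(\<And>w. w \<in> verts G \<Longrightarrow> w \<noteq> q \<Longrightarrow> \<sigma> w = \<sigma>' w) \<Longrightarrow> rotor_tree q \<sigma> = rotor_tree q \<sigma>'"
  unfolding rotor_tree_def by (rule SUP_cong) auto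

lemma rotor_tree_mem:
  "x \<in> rotor_tree q \<sigma> \<longleftrightarrow> (\<exists>w\<in>verts G - {q}. x = \<sigma> w \<or> x = arev (\<sigma> w))"
  by (auto simp: rotor_tree_def edge_def)

lemma rotor_tree_sym: "arev ` rotor_tree q \<sigma> \<subseteq> rotor_tree q \<sigma>"
  by (auto simp: rotor_tree_def edge_def)

lemma rotor_tree_arcs: "rooted q \<sigma> \<Longrightarrow> rotor_tree q \<sigma> \<subseteq> arcs G"
  using rootedD(1) by (fastforce simp: rotor_tree_def edge_def)

lemma follow_adj:
  assumes "rooted q \<sigma>" "(u, w) \<in> (follow q \<sigma>)\<^sup>*" shows "(u, w) \<in> (adj (rotor_tree q \<sigma>))\<^sup>*"
proof -
  have "follow q \<sigma> \<subseteq> adj (rotor_tree q \<sigma>)"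
  proof
    fix z assume "z \<in> follow q \<sigma>"
    then obtain w where "w \<in> verts G" "w \<noteq> q" "z = (w, head G (\<sigma> w))" by (auto simp: follow_def)
    then show "z \<in> adj (rotor_tree q \<sigma>)"
      using adjI[of "\<sigma> w" "rotor_tree q \<sigma>"] rootedD(2)[OF assms(1)] by (auto simp: rotor_tree_mem)
  qed
  then show ?thesis using assms(2) rtrancl_mono by blast
qed

text \<open>For a rooted \<open>\<sigma>\<close> and \<open>w\<close> different from
  \<open>q\<close> this is the vertex set of the subtree hanging at \<open>w\<close>, with
  \<open>w\<close> included.\<close>

definition desc :: "'v \<Rightarrow> ('v \<Rightarrow> 'a) \<Rightarrow> 'v \<Rightarrow> 'v set" where
  "desc q \<sigma> w = {u. (u, w) \<in> (follow q \<sigma>)\<^sup>*}"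

lemma desc_self: "w \<in> desc q \<sigma> w"
  by (simp add: desc_def)

lemma desc_step: "u \<in> desc q \<sigma> w \<Longrightarrow> u \<noteq> w \<Longrightarrow> u \<in> verts G \<and> u \<noteq> q \<and> head G (\<sigma> u) \<in> desc q \<sigma> w"
  unfolding desc_def mem_Collect_eq by (metis converse_rtranclE follow_iff)

lemma desc_subset: "w \<in> verts G \<Longrightarrow> desc q \<sigma> w \<subseteq> verts G"
  using desc_step by blast

lemma root_notin_desc: "w \<noteq> q \<Longrightarrow> q \<notin> desc q \<sigma> w"
  using desc_step by blast

lemma desc_parent:
  assumes "u \<in> verts G" "u \<noteq> q" "u \<noteq> w"
  shows "head G (\<sigma> u) \<in> desc q \<sigma> w \<longleftrightarrow> u \<in> desc q \<sigma> w"
proof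
  assume "head G (\<sigma> u) \<in> desc q \<sigma> w"
  then show "u \<in> desc q \<sigma> w"
    using assms unfolding desc_def mem_Collect_eq by (metis converse_rtrancl_into_rtrancl follow_iff)
qed (use desc_step assms in blast)

text \<open>Otherwise the whole subtree would be closed under the rotors and could never reach
  \<open>q\<close>.\<close>

lemma parent_notin_desc:
  assumes "rooted q \<sigma>" "w \<in> verts G" "w \<noteq> q"
  shows "head G (\<sigma> w) \<notin> desc q \<sigma> w"
proof
  assume h: "head G (\<sigma> w) \<in> desc q \<sigma> w"
  have "desc q \<sigma> w = {}"
  proof (rule rooted_closed_empty[OF assms(1)])
    show "desc q \<sigma> w \<subseteq> verts G - {q}" using desc_subset root_notin_desc assms by blast
    show "head G (\<sigma> u) \<in> desc q \<sigma> w" if "u \<in> desc q \<sigma> w" for u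
    proof (cases "u = w")
      case False
      then show ?thesis using that desc_parent desc_subset root_notin_desc assms by (metis in_mono)
    qed (use h in simp)
  qed
  then show False using desc_self by fast
qed

text \<open>A tree edge is the rotor of some \<open>u\<close>. By \<open>desc_parent\<close> both
  its ends lie on the same side of the subtree at \<open>w\<close> unless \<open>u = w\<close>. So
  the tour can enter and leave that subtree only along the rotor of \<open>w\<close>.\<close>

lemma desc_crossing:
  assumes "rooted q \<sigma>" "w \<in> verts G" "w \<noteq> q" "x \<in> rotor_tree q \<sigma>"
  shows "tail G x \<in> desc q \<sigma> w \<and> head G x \<notin> desc q \<sigma> w \<longleftrightarrow> x = \<sigma> w"
    and "tail G x \<notin> desc q \<sigma> w \<and> head G x \<in> desc q \<sigma> w \<longleftrightarrow> x = arev (\<sigma> w)"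
proof -
  obtain u where u: "u \<in> verts G" "u \<noteq> q" "x = \<sigma> u \<or> x = arev (\<sigma> u)"
    using assms(4) by (auto simp: rotor_tree_mem)
  note ru = rootedD[OF assms(1) u(1,2)] and rw = rootedD[OF assms(1-3)]
  have par: "head G (\<sigma> w) \<notin> desc q \<sigma> w" by (rule parent_notin_desc[OF assms(1-3)])
  have self: "tail G (\<sigma> w) \<in> desc q \<sigma> w" using rw desc_self by simp
  have same: "tail G x \<in> desc q \<sigma> w \<longleftrightarrow> head G x \<in> desc q \<sigma> w" if "u \<noteq> w"
    using u(3) desc_parent[OF u(1,2) that, of \<sigma>] ru by auto
  have ends: "tail G (arev (\<sigma> w)) = head G (\<sigma> w)" "head G (arev (\<sigma> w)) = tail G (\<sigma> w)"
    using rw by auto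
  have "(tail G x \<in> desc q \<sigma> w \<and> head G x \<notin> desc q \<sigma> w \<longleftrightarrow> x = \<sigma> w) \<and>
    (tail G x \<notin> desc q \<sigma> w \<and> head G x \<in> desc q \<sigma> w \<longleftrightarrow> x = arev (\<sigma> w))"
  proof (cases "u = w")
    case True
    from u(3) show ?thesis
    proof
      assume "x = \<sigma> u"
      then show ?thesis using True par self ends by auto
    next
      assume "x = arev (\<sigma> u)"
      then show ?thesis using True par self ends by auto
    qed
  next
    case False
    have "x \<noteq> \<sigma> w" "x \<noteq> arev (\<sigma> w)" using same[OF False] par self ends by auto
    then show ?thesis using same[OF False] by blast
  qed
  then show "tail G x \<in> desc q \<sigma> w \<and> head G x \<notin> desc q \<sigma> w \<longleftrightarrow> x = \<sigma> w"
    "tail G x \<notin> desc q \<sigma> w \<and> head G x \<in> desc q \<sigma> w \<longleftrightarrow> x = arev (\<sigma> w)"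
    by simp_all
qed

text \<open>All vertices are connected through \<open>q\<close>. Deleting the edge of the rotor of
  \<open>w\<close> separates the subtree at \<open>w\<close> from the rest, so every edge is a
  bridge.\<close>

lemma rotor_tree_spanning:
  assumes "rooted q \<sigma>"
  shows "rotor_tree q \<sigma> \<in> spanning_trees"
  unfolding spanning_trees_iff
proof (intro conjI ballI)
  let ?T = "rotor_tree q \<sigma>"
  show sub: "?T \<subseteq> arcs G" and sy: "arev ` ?T \<subseteq> ?T"
    using assms rotor_tree_arcs rotor_tree_sym by auto
  show "verts G \<noteq> {}" using assms by (auto simp: rooted_def)
  have "(u, q) \<in> (adj ?T)\<^sup>*" if "u \<in> verts G" for u
    using follow_adj[OF assms] assms that by (cases "u = q") (auto simp: rooted_def)
  then show "(u, w) \<in> (adj ?T)\<^sup>*" if "u \<in> verts G" "w \<in> verts G" for u w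
    using adj_rtrancl_sym[OF sub sy] that by (meson rtrancl_trans)
  show "bridges ?T"
    unfolding bridges_def
  proof (intro ballI notI)
    fix x assume x: "x \<in> ?T" "(head G x, tail G x) \<in> (adj (?T - edge x))\<^sup>*"
    then obtain w where w: "w \<in> verts G" "w \<noteq> q" "x = \<sigma> w \<or> x = arev (\<sigma> w)"
      by (auto simp: rotor_tree_mem)
    have e: "edge x = edge (\<sigma> w)" using w(3) by auto
    have inv: "b \<in> desc q \<sigma> w \<longleftrightarrow> a \<in> desc q \<sigma> w" if "(a, b) \<in> (adj (?T - edge x))\<^sup>*" for a b
      using that
    proof induction
      case (step y z)
      then obtain y' where "y' \<in> ?T" "y' \<noteq> \<sigma> w" "y' \<noteq> arev (\<sigma> w)" "y = tail G y'" "z = head G y'"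
        unfolding e by (auto simp: adj_def edge_def)
      then show ?case using desc_crossing[OF assms w(1,2)] step by blast
    qed simp
    have "tail G x \<in> desc q \<sigma> w \<longleftrightarrow> head G x \<notin> desc q \<sigma> w"
      using desc_crossing[OF assms w(1,2) x(1)] w(3) by blast
    then show False using inv[OF x(2)] by blast
  qed
qed

section \<open>The rotor configuration of a spanning tree\<close>

lemma apath_avoids_start:
  assumes "apath u (a # p) w" "b \<in> set p"
  shows "tail G b \<noteq> u" "head G b \<noteq> u"
proof -
  have "awalk (head G a) p w" "u \<notin> set (awalk_verts (head G a) p)"
    using assms(1) by (auto simp: apath_Cons_iff) (simp add: apath_def)
  then show "tail G b \<noteq> u" "head G b \<noteq> u"
    using assms(2) awalk_verts_arc1 awalk_verts_arc2 by metis+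
qed

lemma arev_closed_diff: "arev ` T \<subseteq> T \<Longrightarrow> arev ` (T - edge a) \<subseteq> T - edge a"
  by (auto simp: mem_edge_iff) (metis arev_arev)+

text \<open>Only the first arcs are compared, as \<open>tree_rotors\<close> records nothing else. If
  they differed, both ends of \<open>a\<close> would reach \<open>q\<close> without the edge of
  \<open>a\<close>: the head by the rest of the first path, the tail by the second path. But
  \<open>a\<close> is a bridge.\<close>

lemma tree_path_unique:
  assumes T: "T \<in> spanning_trees"
    and p: "apath w (a # p) q" "set (a # p) \<subseteq> T" and p': "apath w (a' # p') q" "set (a' # p') \<subseteq> T"
  shows "a = a'"
proof (rule ccontr)
  assume ne: "a \<noteq> a'"
  note T' = T[unfolded spanning_trees_iff]
  have a: "a \<in> arcs G" "tail G a = w" "a' \<in> arcs G" "tail G a' = w" "a \<in> T"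
    using p p' by (auto simp: apath_Cons_iff)
  have sub: "T - edge a \<subseteq> arcs G" "arev ` (T - edge a) \<subseteq> T - edge a"
    using T' arev_closed_diff by auto
  \<comment> \<open>The second path never returns to \<open>w\<close>, whereas \<open>arev a\<close>
    has head \<open>w\<close>; so \<open>a'\<close> cannot be \<open>a\<close> reversed.\<close>
  have "head G a' \<in> set (awalk_verts (head G a') p')"
    using p'(1) hd_in_awalk_verts(1) by (auto simp: apath_def awalk_Cons_iff)
  then have "head G a' \<noteq> w"
    using p'(1) by (auto simp: apath_Cons_iff)
  then have "a' \<noteq> arev a" using a by auto
  moreover have "b \<notin> edge a" if "b \<in> set p \<union> set p'" for b
    using apath_avoids_start[OF p(1)] apath_avoids_start[OF p'(1)] that a
    by (metis UnE head_arev mem_edge_iff)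
  ultimately have "set p \<subseteq> T - edge a" "set (a' # p') \<subseteq> T - edge a"
    using p(2) p'(2) ne by (auto simp: mem_edge_iff)
  moreover have "awalk (head G a) p q" "awalk w (a' # p') q"
    using p(1) p'(1) by (auto simp: apath_def awalk_Cons_iff)
  ultimately have "(head G a, q) \<in> (adj (T - edge a))\<^sup>*" "(w, q) \<in> (adj (T - edge a))\<^sup>*"
    using awalk_adj by blast+
  then have "(head G a, tail G a) \<in> (adj (T - edge a))\<^sup>*"
    using adj_rtrancl_sym[OF sub] a(2) by (metis rtrancl_trans)
  then show False using T' a(5) unfolding bridges_def by blast
qed

lemma tree_rotors_eq:
  assumes "T \<in> spanning_trees" "apath w (a # p) q" "set (a # p) \<subseteq> T"
  shows "tree_rotors q T w = a"
  unfolding tree_rotors_def using assms tree_path_unique[OF assms(1)] by (intro the_equality) blast+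

lemma tree_path:
  assumes T: "T \<in> spanning_trees" and "w \<in> verts G" "q \<in> verts G"
  obtains p where "apath w p q" "set p \<subseteq> T"
  using assms apath_of_adj[of T w q] unfolding spanning_trees_iff by blast

lemma tree_rotors_follow:
  assumes T: "T \<in> spanning_trees" and "apath w p q" "set p \<subseteq> T"
  shows "(w, q) \<in> (follow q (tree_rotors q T))\<^sup>*"
  using assms(2,3)
proof (induction p arbitrary: w)
  case Nil
  then show ?case by (simp add: apath_Nil_iff)
next
  case (Cons a p)
  then have a: "apath (head G a) p q" "a \<in> arcs G" "tail G a = w" "w \<notin> set (awalk_verts (head G a) p)"
    by (auto simp: apath_Cons_iff)
  have "q \<in> set (awalk_verts (head G a) p)" using a(1) unfolding apath_def
    by (metis awalkE' awalk_verts_non_Nil last_in_set)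
  then have "w \<noteq> q" using a(4) by blast
  then have "(w, head G a) \<in> follow q (tree_rotors q T)"
    using tree_rotors_eq[OF T Cons.prems] a by (metis follow_iff tail_in_verts)
  then show ?case using Cons.IH[OF a(1)] Cons.prems(2) by (simp add: converse_rtrancl_into_rtrancl)
qed

text \<open>The rotors lie in \<open>T\<close> and already connect every vertex to \<open>q\<close>.
  An edge of \<open>T\<close> outside the rotor tree would therefore not be a bridge of
  \<open>T\<close>.\<close>

lemma tree_rotors_rooted:
  assumes T: "T \<in> spanning_trees" and q: "q \<in> verts G"
  shows "rooted q (tree_rotors q T)" and "rotor_tree q (tree_rotors q T) = T"
proof -
  let ?\<sigma> = "tree_rotors q T"
  note T' = T[unfolded spanning_trees_iff]
  have mem: "?\<sigma> w \<in> T \<and> ?\<sigma> w \<in> out_arcs G w" and reach: "(w, q) \<in> (follow q ?\<sigma>)\<^sup>*"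
    if w: "w \<in> verts G" "w \<noteq> q" for w
  proof -
    obtain p where p: "apath w p q" "set p \<subseteq> T" using tree_path[OF T w(1) q] by blast
    then obtain a p' where "p = a # p'" using w(2) by (cases p) (auto simp: apath_Nil_iff)
    then show "?\<sigma> w \<in> T \<and> ?\<sigma> w \<in> out_arcs G w"
      using tree_rotors_eq[OF T] p by (auto simp: apath_Cons_iff)
    show "(w, q) \<in> (follow q ?\<sigma>)\<^sup>*" by (rule tree_rotors_follow[OF T p])
  qed
  show r: "rooted q ?\<sigma>" using mem reach q by (auto simp: rooted_def)
  have sub: "rotor_tree q ?\<sigma> \<subseteq> T"
  proof
    fix x assume "x \<in> rotor_tree q ?\<sigma>"
    then obtain w where "w \<in> verts G" "w \<noteq> q" "x = ?\<sigma> w \<or> x = arev (?\<sigma> w)"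
      by (auto simp: rotor_tree_mem)
    then show "x \<in> T" using mem[of w] T' by (auto simp: image_subset_iff)
  qed
  moreover have "a \<in> rotor_tree q ?\<sigma>" if a: "a \<in> T" for a
  proof (rule ccontr)
    assume na: "a \<notin> rotor_tree q ?\<sigma>"
    then have "arev a \<notin> rotor_tree q ?\<sigma>" using rotor_tree_sym by (metis arev_arev image_subset_iff)
    then have "rotor_tree q ?\<sigma> \<subseteq> T - edge a" using sub na by (auto simp: mem_edge_iff)
    then have "(u, q) \<in> (adj (T - edge a))\<^sup>*" if "u \<in> verts G" for u
      using follow_adj[OF r] reach adj_mono that by (metis rtrancl.rtrancl_refl subsetD)
    then have "(head G a, q) \<in> (adj (T - edge a))\<^sup>*" "(tail G a, q) \<in> (adj (T - edge a))\<^sup>*"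
      using a T' by auto
    moreover have "T - edge a \<subseteq> arcs G" "arev ` (T - edge a) \<subseteq> T - edge a"
      using T' arev_closed_diff by auto
    ultimately have "(head G a, tail G a) \<in> (adj (T - edge a))\<^sup>*"
      using adj_rtrancl_sym by (metis rtrancl_trans)
    then show False using T' a unfolding bridges_def by blast
  qed
  ultimately show "rotor_tree q ?\<sigma> = T" by blast
qed

text \<open>Where the configurations disagree at \<open>w\<close>, the arc
  \<open>\<sigma>' w\<close> must be the reversed rotor \<open>\<sigma> u\<close> of its head
  \<open>u\<close>. They also disagree at \<open>u\<close>, since otherwise \<open>\<sigma>'\<close>
  would go back and forth between \<open>u\<close> and \<open>w\<close> forever. So the
  disagreements are closed under \<open>\<sigma>'\<close>.\<close>

lemma rooted_unique:
  assumes r: "rooted q \<sigma>" and r': "rooted q \<sigma>'" and eq: "rotor_tree q \<sigma> = rotor_tree q \<sigma>'"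
    and w: "w \<in> verts G" "w \<noteq> q"
  shows "\<sigma> w = \<sigma>' w"
proof -
  let ?A = "{w \<in> verts G - {q}. \<sigma>' w \<noteq> \<sigma> w}"
  have "?A = {}"
  proof (rule rooted_closed_empty[OF r'])
    fix w assume "w \<in> ?A"
    then have w: "w \<in> verts G" "w \<noteq> q" "\<sigma>' w \<noteq> \<sigma> w" by auto
    note rw = rootedD[OF r w(1,2)] rootedD[OF r' w(1,2)]
    have "\<sigma>' w \<in> rotor_tree q \<sigma>" using w eq by (auto simp: rotor_tree_mem)
    then obtain u where u: "u \<in> verts G" "u \<noteq> q" "\<sigma>' w = \<sigma> u \<or> \<sigma>' w = arev (\<sigma> u)"
      by (auto simp: rotor_tree_mem)
    note ru = rootedD[OF r u(1,2)] rootedD[OF r' u(1,2)]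
    have "\<sigma>' w \<noteq> \<sigma> u" using w(3) ru(2) rw(5) by auto
    then have su: "\<sigma>' w = arev (\<sigma> u)" using u(3) by simp
    then have h: "head G (\<sigma>' w) = u" "head G (\<sigma> u) = w" using ru rw by auto
    have "\<sigma>' u \<noteq> \<sigma> u"
    proof
      assume e: "\<sigma>' u = \<sigma> u"
      have "{u, w} = {}"
        by (rule rooted_closed_empty[OF r']) (use u w h e in auto)
      then show False by simp
    qed
    then show "head G (\<sigma>' w) \<in> ?A" using h u by auto
  qed auto
  then show ?thesis using w by auto
qed

lemma tree_rotors_rotor_tree:
  assumes "rooted q \<sigma>" "w \<in> verts G" "w \<noteq> q"
  shows "tree_rotors q (rotor_tree q \<sigma>) w = \<sigma> w"
  using rooted_unique[OF tree_rotors_rooted(1) assms(1) tree_rotors_rooted(2) assms(2,3)]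
    rotor_tree_spanning assms(1) by (auto simp: rooted_def)

subsection \<open>Principal divisors and turning rotors\<close>

lemma succ_funpow_out: "s \<in> out_arcs G w \<Longrightarrow> (succ ^^ k) s \<in> out_arcs G w"
  using cyclic_on_funpow_in[OF succ_cyclic] by (metis empty_iff in_out_arcs_conv tail_in_verts)

lemma succ_out: "s \<in> out_arcs G w \<Longrightarrow> succ s \<in> out_arcs G w"
  using succ_funpow_out[of s w 1] by simp

lemma succ_enum:
  assumes "s \<in> out_arcs G w"
  shows "bij_betw (\<lambda>i. (succ ^^ i) s) {..<card (out_arcs G w)} (out_arcs G w)"
    "(succ ^^ card (out_arcs G w)) s = s"
  using cyclic_on_enum[OF succ_cyclic, of w s] assms by (metis empty_iff in_out_arcs_conv tail_in_verts)+

lemma succ_enum_Suc: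
  assumes "s \<in> out_arcs G w"
  shows "bij_betw (\<lambda>i. (succ ^^ Suc i) s) {..<card (out_arcs G w)} (out_arcs G w)"
proof -
  have "bij_betw (\<lambda>i. (succ ^^ i) (succ s)) {..<card (out_arcs G w)} (out_arcs G w)"
    by (rule succ_enum(1)[OF succ_out[OF assms]])
  then show ?thesis by (simp only: funpow_Suc_right o_apply)
qed

lemma succ_reach:
  assumes "s \<in> out_arcs G w" "x \<in> out_arcs G w"
  obtains k where "k < card (out_arcs G w)" "(succ ^^ k) s = x"
proof -
  have "x \<in> (\<lambda>i. (succ ^^ i) s) ` {..<card (out_arcs G w)}"
    using bij_betw_imp_surj_on[OF succ_enum(1)[OF assms(1)]] assms(2) by simp
  then show thesis using that by auto
qed

lemma lookup_laplacian:
  "Poly_Mapping.lookup (laplacian f) u = (if u \<in> verts G then \<Sum>a\<in>out_arcs G u. f u - f (head G a) else 0)"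
  unfolding laplacian_def Poly_Mapping.lookup_sum Poly_Mapping.lookup_single when_def
  by (simp add: sum.delta)

lemma sum_arcs_rev: "(\<Sum>x\<in>arcs G. g x) = (\<Sum>x\<in>arcs G. g (arev x))"
  by (rule sum.reindex_bij_witness[of _ arev arev]) auto

lemma sum_out_arcs: "(\<Sum>x\<in>out_arcs G u. g x) = (\<Sum>x\<in>arcs G. if tail G x = u then g x else 0)"
  by (rule sum.mono_neutral_cong_left) auto

text \<open>The Laplacian as chip-firing: each vertex sends as many chips along every edge as it is
  fired. Turning rotors costs a sum of the same shape, so firings and turns can be compared arc by
  arc.\<close>

lemma laplacian_arcs:
  "laplacian h = (\<Sum>x\<in>arcs G. frag_cmul (h (tail G x)) (frag_of (tail G x) - frag_of (head G x)))"
proof (rule poly_mapping_eqI)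
  fix u
  let ?r = "\<Sum>x\<in>arcs G. h (tail G x) * ((if u = tail G x then 1 else 0) - (if u = head G x then 1 else 0))"
  have r: "Poly_Mapping.lookup (\<Sum>x\<in>arcs G. frag_cmul (h (tail G x)) (frag_of (tail G x) - frag_of (head G x))) u = ?r"
    by (simp add: Poly_Mapping.lookup_sum Poly_Mapping.lookup_minus)
  have "?r = (\<Sum>x\<in>arcs G. if tail G x = u then h u else 0) - (\<Sum>x\<in>arcs G. if head G x = u then h (tail G x) else 0)"
    by (simp add: sum_subtractf[symmetric] right_diff_distrib) (rule sum.cong, auto)
  also have "(\<Sum>x\<in>arcs G. if head G x = u then h (tail G x) else 0) = (\<Sum>x\<in>arcs G. if tail G x = u then h (head G x) else 0)"
    by (subst sum_arcs_rev) (rule sum.cong, auto)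
  also have "(\<Sum>x\<in>arcs G. if tail G x = u then h u else 0) - \<dots> = (\<Sum>a\<in>out_arcs G u. h u - h (head G a))"
    by (simp only: sum_out_arcs sum_subtractf)
  also have "\<dots> = Poly_Mapping.lookup (laplacian h) u"
  proof (cases "u \<in> verts G")
    case False
    then have "out_arcs G u = {}" using tail_in_verts by (auto simp: in_out_arcs_conv)
    then show ?thesis using False by (simp add: lookup_laplacian)
  qed (simp add: lookup_laplacian)
  finally show "Poly_Mapping.lookup (laplacian h) u = Poly_Mapping.lookup (\<Sum>x\<in>arcs G. frag_cmul (h (tail G x)) (frag_of (tail G x) - frag_of (head G x))) u"
    using r by simp
qed

lemma laplacian_add: "laplacian (\<lambda>u. f u + g u) = laplacian f + laplacian g"
  by (simp add: laplacian_arcs frag_cmul_distrib sum.distrib)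

lemma laplacian_diff: "laplacian (\<lambda>u. f u - g u) = laplacian f - laplacian g"
  by (simp add: laplacian_arcs frag_cmul_diff_distrib sum_subtractf)

lemma laplacian_const: "laplacian (\<lambda>u. c) = 0"
  by (rule poly_mapping_eqI) (simp add: lookup_laplacian)

lemma Prin_zero: "0 \<in> Prin"
  using laplacian_const[of 0] unfolding Prin_def by (metis rangeI)

lemma Prin_add: "D \<in> Prin \<Longrightarrow> E \<in> Prin \<Longrightarrow> D + E \<in> Prin"
  unfolding Prin_def using laplacian_add by (metis (no_types, lifting) rangeE rangeI)

lemma Prin_diff: "D \<in> Prin \<Longrightarrow> E \<in> Prin \<Longrightarrow> D - E \<in> Prin"
  unfolding Prin_def using laplacian_diff by (metis (no_types, lifting) rangeE rangeI)

lemma Prin_uminus: "D \<in> Prin \<Longrightarrow> - D \<in> Prin"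
  using Prin_diff[OF Prin_zero] by simp

lemma Prin_sum: "(\<And>i. i \<in> I \<Longrightarrow> D i \<in> Prin) \<Longrightarrow> (\<Sum>i\<in>I. D i) \<in> Prin"
  by (induction I rule: infinite_finite_induct) (auto simp: Prin_zero Prin_add)

text \<open>The rotor \<open>s\<close> is advanced \<open>k\<close> times, each time sending a chip along the new rotor.\<close>

definition rot :: "'a \<Rightarrow> nat \<Rightarrow> ('v \<Rightarrow>\<^sub>0 int)" where
  "rot s k = (\<Sum>i<k. frag_of (tail G s) - frag_of (head G ((succ ^^ Suc i) s)))"

lemma rot_0 [simp]: "rot s 0 = 0" by (simp add: rot_def)

lemma rot_add:
  assumes "s \<in> out_arcs G w"
  shows "rot s (k + l) = rot s k + rot ((succ ^^ k) s) l"
proof -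
  have t: "tail G ((succ ^^ k) s) = tail G s" using succ_funpow_out[OF assms, of k] assms by auto
  have "rot s (k + l) = rot s k + (\<Sum>i<l. frag_of (tail G s) - frag_of (head G ((succ ^^ Suc (k + i)) s)))"
    unfolding rot_def by (induction l) auto
  moreover have "(succ ^^ Suc (k + i)) s = (succ ^^ Suc i) ((succ ^^ k) s)" for i
    by (metis add.commute add_Suc comp_apply funpow_add)
  ultimately show ?thesis by (simp add: rot_def t)
qed

text \<open>A full turn of the rotor sends one chip along each edge at \<open>w\<close>, that is, it
  fires \<open>w\<close> once.\<close>

lemma rot_full:
  assumes "s \<in> out_arcs G w"
  shows "rot s (card (out_arcs G w)) = laplacian (\<lambda>u. if u = w then 1 else 0)"
proof -
  have "rot s (card (out_arcs G w)) = (\<Sum>x\<in>out_arcs G w. frag_of (tail G s) - frag_of (head G x))"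
    unfolding rot_def by (rule sum.reindex_bij_betw[OF succ_enum_Suc[OF assms]])
  also have "\<dots> = (\<Sum>x\<in>out_arcs G w. frag_of (tail G x) - frag_of (head G x))"
    using assms by (intro sum.cong) auto
  also have "\<dots> = laplacian (\<lambda>u. if u = w then 1 else 0)"
    unfolding laplacian_arcs sum_out_arcs by (rule sum.cong) auto
  finally show ?thesis .
qed

lemma succ_funpow_mult:
  assumes "s \<in> out_arcs G w" shows "(succ ^^ (card (out_arcs G w) * m)) s = s"
proof (induction m)
  case (Suc m)
  then show ?case using succ_enum(2)[OF assms] by (simp add: funpow_add)
qed simp

lemma rot_mult_Prin:
  assumes "s \<in> out_arcs G w"
  shows "rot s (card (out_arcs G w) * m) \<in> Prin"
proof (induction m)
  case (Suc m)
  have "rot s (card (out_arcs G w)) \<in> Prin" using rot_full[OF assms] by (auto simp: Prin_def)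
  then show ?case
    using Suc rot_add[OF assms, of "card (out_arcs G w)" "card (out_arcs G w) * m"] succ_enum(2)[OF assms]
    by (simp add: Prin_add)
qed (simp add: Prin_zero)

section \<open>Configurations related by turning rotors, modulo principal divisors\<close>

definition rotors :: "'v \<Rightarrow> ('v \<Rightarrow> 'a) \<Rightarrow> bool" where
  "rotors q \<sigma> \<longleftrightarrow> (\<forall>w\<in>verts G - {q}. \<sigma> w \<in> out_arcs G w)"

lemma rooted_rotors: "rooted q \<sigma> \<Longrightarrow> rotors q \<sigma>"
  by (auto simp: rooted_def rotors_def)

text \<open>The order of the turns and the availability of chips are left out of account; only the
  total cost matters, and only up to a principal divisor. This makes the relation symmetric although
  rotors turn in one direction.\<close>

definition routes :: "'v \<Rightarrow> ('v \<Rightarrow> 'a) \<Rightarrow> ('v \<Rightarrow>\<^sub>0 int) \<Rightarrow> ('v \<Rightarrow> 'a) \<Rightarrow> bool" where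
  "routes q \<sigma> D \<sigma>' \<longleftrightarrow> (\<exists>n. (\<forall>w\<in>verts G - {q}. \<sigma>' w = (succ ^^ n w) (\<sigma> w)) \<and>
     D - (\<Sum>w\<in>verts G - {q}. rot (\<sigma> w) (n w)) \<in> Prin)"

lemma routesI:
  assumes "\<And>w. w \<in> verts G \<Longrightarrow> w \<noteq> q \<Longrightarrow> \<sigma>' w = (succ ^^ n w) (\<sigma> w)"
    and "D - (\<Sum>w\<in>verts G - {q}. rot (\<sigma> w) (n w)) \<in> Prin"
  shows "routes q \<sigma> D \<sigma>'"
  using assms unfolding routes_def by blast

lemma routes_cong:
  assumes "routes q \<sigma> D \<sigma>'" "D - D' \<in> Prin"
    and "\<And>w. w \<in> verts G \<Longrightarrow> w \<noteq> q \<Longrightarrow> \<sigma> w = \<tau> w" "\<And>w. w \<in> verts G \<Longrightarrow> w \<noteq> q \<Longrightarrow> \<sigma>' w = \<tau>' w"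
  shows "routes q \<tau> D' \<tau>'"
proof -
  obtain n where n: "\<forall>w\<in>verts G - {q}. \<sigma>' w = (succ ^^ n w) (\<sigma> w)"
    "D - (\<Sum>w\<in>verts G - {q}. rot (\<sigma> w) (n w)) \<in> Prin"
    using assms(1) unfolding routes_def by blast
  have "(\<Sum>w\<in>verts G - {q}. rot (\<sigma> w) (n w)) = (\<Sum>w\<in>verts G - {q}. rot (\<tau> w) (n w))"
    by (rule sum.cong) (use assms(3) in auto)
  moreover have "D - (\<Sum>w\<in>verts G - {q}. rot (\<sigma> w) (n w)) - (D - D') \<in> Prin"
    by (rule Prin_diff[OF n(2) assms(2)])
  ultimately show ?thesis
    by (intro routesI[of _ _ n]) (use n(1) assms(3,4) in \<open>auto simp: algebra_simps\<close>)
qed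

lemma routes_refl: "routes q \<sigma> 0 \<sigma>"
  by (rule routesI[of _ _ "\<lambda>_. 0"]) (auto simp: Prin_zero)

lemma routes_trans:
  assumes "rotors q \<sigma>" "routes q \<sigma> D \<sigma>'" "routes q \<sigma>' E \<sigma>''"
  shows "routes q \<sigma> (D + E) \<sigma>''"
proof -
  obtain n where n: "\<And>w. w \<in> verts G - {q} \<Longrightarrow> \<sigma>' w = (succ ^^ n w) (\<sigma> w)"
    "D - (\<Sum>w\<in>verts G - {q}. rot (\<sigma> w) (n w)) \<in> Prin"
    using assms(2) unfolding routes_def by blast
  obtain m where m: "\<And>w. w \<in> verts G - {q} \<Longrightarrow> \<sigma>'' w = (succ ^^ m w) (\<sigma>' w)"
    "E - (\<Sum>w\<in>verts G - {q}. rot (\<sigma>' w) (m w)) \<in> Prin"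
    using assms(3) unfolding routes_def by blast
  show ?thesis
  proof (rule routesI[of _ _ "\<lambda>w. m w + n w"])
    fix w assume "w \<in> verts G" "w \<noteq> q"
    then show "\<sigma>'' w = (succ ^^ (m w + n w)) (\<sigma> w)" using n(1) m(1) by (simp add: funpow_add)
  next
    have "(\<Sum>w\<in>verts G - {q}. rot (\<sigma> w) (m w + n w)) =
      (\<Sum>w\<in>verts G - {q}. rot (\<sigma> w) (n w) + rot (\<sigma>' w) (m w))"
    proof (rule sum.cong[OF refl])
      fix w assume w: "w \<in> verts G - {q}"
      then have "\<sigma> w \<in> out_arcs G w" using assms(1) by (simp add: rotors_def)
      then show "rot (\<sigma> w) (m w + n w) = rot (\<sigma> w) (n w) + rot (\<sigma>' w) (m w)"
        using rot_add[of "\<sigma> w" w "n w" "m w"] n(1)[OF w] by (simp add: add.commute)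
    qed
    then show "D + E - (\<Sum>w\<in>verts G - {q}. rot (\<sigma> w) (m w + n w)) \<in> Prin"
      using Prin_add[OF n(2) m(2)] by (simp add: sum.distrib algebra_simps)
  qed
qed

lemma routes_sym:
  assumes "rotors q \<sigma>" "routes q \<sigma> D \<sigma>'"
  shows "routes q \<sigma>' (- D) \<sigma>"
proof -
  obtain n where n: "\<And>w. w \<in> verts G - {q} \<Longrightarrow> \<sigma>' w = (succ ^^ n w) (\<sigma> w)"
    "D - (\<Sum>w\<in>verts G - {q}. rot (\<sigma> w) (n w)) \<in> Prin"
    using assms(2) unfolding routes_def by blast
  let ?d = "\<lambda>w. card (out_arcs G w)"
  \<comment> \<open>The turns that complete \<open>n w\<close> to a multiple of the degree. If the
    degree divides \<open>n w\<close>, this is one full turn and not zero.\<close>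
  define m where "m w = ?d w - n w mod ?d w" for w
  have mn: "\<exists>k. n w + m w = ?d w * k" "\<sigma> w \<in> out_arcs G w" if w: "w \<in> verts G - {q}" for w
  proof -
    show o: "\<sigma> w \<in> out_arcs G w" using assms(1) w by (simp add: rotors_def)
    then have "0 < ?d w" by (auto simp: card_gt_0_iff)
    then have "n w + m w = ?d w * (n w div ?d w) + ?d w"
      using mult_div_mod_eq[of "?d w" "n w"] mod_less_divisor[of "?d w" "n w"] unfolding m_def by linarith
    also have "\<dots> = ?d w * (n w div ?d w + 1)" by simp
    finally show "\<exists>k. n w + m w = ?d w * k" by blast
  qed
  show ?thesis
  proof (rule routesI[of _ _ m])
    fix w assume "w \<in> verts G" "w \<noteq> q"
    then have w: "w \<in> verts G - {q}" by simp
    show "\<sigma> w = (succ ^^ m w) (\<sigma>' w)"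
      using n(1)[OF w] mn[OF w] succ_funpow_mult[of "\<sigma> w" w]
      by (metis add.commute comp_apply funpow_add)
  next
    have "(\<Sum>w\<in>verts G - {q}. rot (\<sigma> w) (n w)) + (\<Sum>w\<in>verts G - {q}. rot (\<sigma>' w) (m w)) \<in> Prin"
      unfolding sum.distrib[symmetric]
    proof (rule Prin_sum)
      fix w assume w: "w \<in> verts G - {q}"
      then have "rot (\<sigma> w) (n w) + rot (\<sigma>' w) (m w) = rot (\<sigma> w) (n w + m w)"
        using rot_add[OF mn(2)[OF w]] n(1)[OF w] by simp
      then show "rot (\<sigma> w) (n w) + rot (\<sigma>' w) (m w) \<in> Prin"
        using mn[OF w] rot_mult_Prin by metis
    qed
    from Prin_uminus[OF Prin_add[OF this n(2)]]
    show "- D - (\<Sum>w\<in>verts G - {q}. rot (\<sigma>' w) (m w)) \<in> Prin"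
      by (simp add: algebra_simps)
  qed
qed

text \<open>Full turns cost a principal divisor, so each count may be replaced by its remainder
  modulo the degree. Afterwards no arc is passed more than once.\<close>

lemma routes_reduced:
  assumes "rotors q \<sigma>" "routes q \<sigma> D \<sigma>'"
  obtains n where "\<And>w. w \<in> verts G - {q} \<Longrightarrow> \<sigma>' w = (succ ^^ n w) (\<sigma> w)"
    "\<And>w. w \<in> verts G - {q} \<Longrightarrow> n w < card (out_arcs G w)"
    "D - (\<Sum>w\<in>verts G - {q}. rot (\<sigma> w) (n w)) \<in> Prin"
proof -
  obtain n where n: "\<And>w. w \<in> verts G - {q} \<Longrightarrow> \<sigma>' w = (succ ^^ n w) (\<sigma> w)"
    "D - (\<Sum>w\<in>verts G - {q}. rot (\<sigma> w) (n w)) \<in> Prin"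
    using assms(2) unfolding routes_def by blast
  let ?d = "\<lambda>w. card (out_arcs G w)"
  have o: "\<sigma> w \<in> out_arcs G w" "0 < ?d w" if w: "w \<in> verts G - {q}" for w
  proof -
    show o: "\<sigma> w \<in> out_arcs G w" using assms(1) w by (simp add: rotors_def)
    then show "0 < ?d w" by (auto simp: card_gt_0_iff)
  qed
  have "(\<Sum>w\<in>verts G - {q}. rot (\<sigma> w) (n w)) - (\<Sum>w\<in>verts G - {q}. rot (\<sigma> w) (n w mod ?d w)) \<in> Prin"
    unfolding sum_subtractf[symmetric]
  proof (rule Prin_sum)
    fix w assume w: "w \<in> verts G - {q}"
    have "rot (\<sigma> w) (?d w * (n w div ?d w) + n w mod ?d w) =
      rot (\<sigma> w) (?d w * (n w div ?d w)) + rot (\<sigma> w) (n w mod ?d w)"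
      by (simp only: rot_add[OF o(1)[OF w]] succ_funpow_mult[OF o(1)[OF w]])
    then have "rot (\<sigma> w) (n w) - rot (\<sigma> w) (n w mod ?d w) = rot (\<sigma> w) (?d w * (n w div ?d w))"
      by simp
    then show "rot (\<sigma> w) (n w) - rot (\<sigma> w) (n w mod ?d w) \<in> Prin"
      using rot_mult_Prin[OF o(1)[OF w]] by simp
  qed
  from Prin_add[OF n(2) this]
  have "D - (\<Sum>w\<in>verts G - {q}. rot (\<sigma> w) (n w mod ?d w)) \<in> Prin" by simp
  moreover have "\<sigma>' w = (succ ^^ (n w mod ?d w)) (\<sigma> w)" if "w \<in> verts G - {q}" for w
    using n(1)[OF that] funpow_mod_eq[OF succ_enum(2)[OF o(1)[OF that]]] by simp
  ultimately show thesis using that[of "\<lambda>w. n w mod ?d w"] o by simp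
qed

section \<open>A divisor determines the rooted configuration it leads to\<close>

lemma balanced_flow_no_crossing:
  fixes N :: "'a \<Rightarrow> int"
  assumes bal: "\<And>u. u \<in> verts G \<Longrightarrow>
      (\<Sum>x\<in>arcs G. N x * ((if tail G x = u then 1 else 0) - (if head G x = u then 1 else 0))) = 0"
    and A: "A \<subseteq> verts G"
    and pos: "\<And>x. x \<in> arcs G \<Longrightarrow> tail G x \<in> A \<Longrightarrow> 0 \<le> N x"
    and neg: "\<And>x. x \<in> arcs G \<Longrightarrow> tail G x \<notin> A \<Longrightarrow> N x \<le> 0"
    and x: "x \<in> arcs G" "tail G x \<in> A" "head G x \<notin> A"
  shows "N x = 0"
proof -
  let ?s = "\<lambda>x. N x * ((if tail G x \<in> A then 1 else 0) - (if head G x \<in> A then 1 else 0))"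
  have fin: "finite A" using A finite_subset finite_verts by blast
  \<comment> \<open>Summing the balance over \<open>A\<close> leaves only the flow across the border
    of \<open>A\<close>. By the sign conditions every term is nonnegative, so each one
    vanishes.\<close>
  have "0 = (\<Sum>u\<in>A. \<Sum>x\<in>arcs G. N x * ((if tail G x = u then 1 else 0) - (if head G x = u then 1 else 0)))"
    using bal A by (simp add: subset_iff)
  also have "\<dots> = (\<Sum>x\<in>arcs G. \<Sum>u\<in>A. N x * ((if tail G x = u then 1 else 0) - (if head G x = u then 1 else 0)))"
    by (rule sum.swap)
  also have "\<dots> = (\<Sum>x\<in>arcs G. ?s x)"
    using fin by (simp add: sum_distrib_left[symmetric] sum_subtractf)
  finally have "(\<Sum>x\<in>arcs G. ?s x) = 0" by simp
  moreover have "0 \<le> ?s y" if "y \<in> arcs G" for y using pos[OF that] neg[OF that] by auto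
  ultimately have "?s x = 0" using x(1) by (simp add: sum_nonneg_eq_0_iff)
  then show ?thesis using x by simp
qed

lemma rot_count:
  assumes s: "s \<in> out_arcs G w" and k: "k < card (out_arcs G w)"
  shows "rot s k = (\<Sum>x\<in>out_arcs G w. frag_cmul (if \<exists>i<k. x = (succ ^^ Suc i) s then 1 else 0)
    (frag_of (tail G x) - frag_of (head G x)))"
proof -
  let ?I = "(\<lambda>i. (succ ^^ Suc i) s) ` {..<k}"
  have inj: "inj_on (\<lambda>i. (succ ^^ Suc i) s) {..<k}"
    using bij_betw_imp_inj_on[OF succ_enum_Suc[OF s]] by (rule inj_on_subset) (use k in auto)
  have sub: "?I \<subseteq> out_arcs G w" using succ_funpow_out[OF s] by blast
  have "rot s k = (\<Sum>x\<in>?I. frag_of (tail G s) - frag_of (head G x))"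
    unfolding rot_def by (simp only: sum.reindex[OF inj] o_def)
  also have "\<dots> = (\<Sum>x\<in>out_arcs G w. frag_cmul (if x \<in> ?I then 1 else 0)
    (frag_of (tail G x) - frag_of (head G x)))"
  proof (rule sum.mono_neutral_cong_left[OF _ sub])
    show "frag_of (tail G s) - frag_of (head G x) =
      frag_cmul (if x \<in> ?I then 1 else 0) (frag_of (tail G x) - frag_of (head G x))" if "x \<in> ?I" for x
    proof -
      have "tail G x = tail G s" using that sub s by auto
      then show ?thesis using that by simp
    qed
  qed auto
  also have "(\<lambda>x. x \<in> ?I) = (\<lambda>x. \<exists>i<k. x = (succ ^^ Suc i) s)" by auto
  finally show ?thesis by simp
qed

lemma sum_arcs_by_tail: "(\<Sum>x\<in>arcs G. g x) = (\<Sum>w\<in>verts G. \<Sum>x\<in>out_arcs G w. g x)"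
proof -
  have "(\<Sum>w\<in>verts G. \<Sum>x\<in>{x \<in> arcs G. tail G x = w}. g x) = (\<Sum>x\<in>arcs G. g x)"
    by (rule sum.group) auto
  then show ?thesis by (simp add: out_arcs_def)
qed

text \<open>The turns from \<open>\<sigma>\<close> to \<open>\<sigma>'\<close> cost the Laplacian of
  some \<open>h\<close>. Let \<open>N x\<close> be the number of turns across the arc
  \<open>x\<close> minus the number \<open>h\<close> of firings of its tail; this is a flow without
  sources. At each vertex other than \<open>q\<close>, \<open>N\<close> is smallest on the old
  rotor, largest on the new one, and varies by at most one. The vertices with positive
  \<open>N\<close> on the new rotor are closed under \<open>\<sigma>'\<close>, and those with
  negative \<open>N\<close> on the old rotor under \<open>\<sigma>\<close>. Both sets are empty, so
  no rotor turns.\<close>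

lemma routes_zero_eq:
  assumes r: "rooted q \<sigma>" and r': "rooted q \<sigma>'" and ro: "routes q \<sigma> 0 \<sigma>'"
    and w: "w \<in> verts G" "w \<noteq> q"
  shows "\<sigma>' w = \<sigma> w"
proof -
  have q: "q \<in> verts G" using r by (simp add: rooted_def)
  obtain n where n: "\<And>w. w \<in> verts G - {q} \<Longrightarrow> \<sigma>' w = (succ ^^ n w) (\<sigma> w)"
    "\<And>w. w \<in> verts G - {q} \<Longrightarrow> n w < card (out_arcs G w)"
    "0 - (\<Sum>w\<in>verts G - {q}. rot (\<sigma> w) (n w)) \<in> Prin"
    using routes_reduced[OF rooted_rotors[OF r] ro] by blast
  have \<sigma>: "\<sigma> w \<in> out_arcs G w" "\<sigma>' w \<in> out_arcs G w" if "w \<in> verts G - {q}" for w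
    using r r' that by (auto simp: rooted_def)
  obtain h0 where h0: "- (\<Sum>w\<in>verts G - {q}. rot (\<sigma> w) (n w)) = laplacian h0"
    using n(3) by (auto simp: Prin_def)
  \<comment> \<open>Constants have Laplacian zero, so the potential is normalised to vanish at the
    sink; the change of sign absorbs the minus in the equation for \<open>h0\<close>.\<close>
  define h where "h u = h0 q - h0 u" for u
  have h: "(\<Sum>w\<in>verts G - {q}. rot (\<sigma> w) (n w)) = laplacian h" "h q = 0"
  proof -
    have "laplacian h = laplacian (\<lambda>u. h0 q) - laplacian h0" unfolding h_def by (rule laplacian_diff)
    then show "(\<Sum>w\<in>verts G - {q}. rot (\<sigma> w) (n w)) = laplacian h"
      by (simp add: h0[symmetric] laplacian_const)
  qed (simp add: h_def)
  \<comment> \<open>Whether the turn at the tail of \<open>x\<close> passes over \<open>x\<close>.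
    The new rotor counts as passed and the old one does not.\<close>
  define c :: "'a \<Rightarrow> int" where
    "c x = (if tail G x \<noteq> q \<and> (\<exists>i<n (tail G x). x = (succ ^^ Suc i) (\<sigma> (tail G x))) then 1 else 0)" for x
  define N where "N x = c x - h (tail G x)" for x
  let ?F = "\<lambda>x. frag_cmul (c x) (frag_of (tail G x) - frag_of (head G x))"
  have S: "(\<Sum>w\<in>verts G - {q}. rot (\<sigma> w) (n w)) = (\<Sum>x\<in>arcs G. ?F x)"
  proof -
    have "rot (\<sigma> w) (n w) = (\<Sum>x\<in>out_arcs G w. ?F x)" if w: "w \<in> verts G - {q}" for w
      unfolding rot_count[OF \<sigma>(1)[OF w] n(2)[OF w]]
      by (rule sum.cong) (use w in \<open>auto simp: c_def\<close>)
    then have "(\<Sum>w\<in>verts G - {q}. rot (\<sigma> w) (n w)) = (\<Sum>w\<in>verts G - {q}. \<Sum>x\<in>out_arcs G w. ?F x)"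
      by simp
    also have "\<dots> = (\<Sum>w\<in>verts G. \<Sum>x\<in>out_arcs G w. ?F x)"
      by (rule sum.mono_neutral_left) (auto simp: c_def intro!: sum.neutral)
    finally show ?thesis by (simp add: sum_arcs_by_tail)
  qed
  have bal: "(\<Sum>x\<in>arcs G. N x * ((if tail G x = u then 1 else 0) - (if head G x = u then 1 else 0))) = 0" for u
  proof -
    have "(\<Sum>x\<in>arcs G. frag_cmul (N x) (frag_of (tail G x) - frag_of (head G x))) = 0"
      using S h(1) unfolding laplacian_arcs N_def frag_cmul_diff_distrib sum_subtractf by simp
    then have "Poly_Mapping.lookup (\<Sum>x\<in>arcs G. frag_cmul (N x) (frag_of (tail G x) - frag_of (head G x))) u = 0"
      by simp
    then show ?thesis by (simp add: Poly_Mapping.lookup_sum Poly_Mapping.lookup_minus eq_commute[of u])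
  qed
  have c: "c (\<sigma> w) = 0" "c (\<sigma>' w) = (if n w = 0 then 0 else 1)"
      "\<And>x. x \<in> out_arcs G w \<Longrightarrow> 0 \<le> c x \<and> c x \<le> c (\<sigma>' w)" if w: "w \<in> verts G - {q}" for w
  proof -
    have t: "tail G (\<sigma> w) = w" "tail G (\<sigma>' w) = w" "w \<noteq> q" using \<sigma>[OF w] w by auto
    have "\<sigma> w \<noteq> (succ ^^ Suc i) (\<sigma> w)" if i: "i < n w" for i
    proof
      assume "\<sigma> w = (succ ^^ Suc i) (\<sigma> w)"
      then have "(\<lambda>i. (succ ^^ i) (\<sigma> w)) 0 = (\<lambda>i. (succ ^^ i) (\<sigma> w)) (Suc i)" by simp
      then have "0 = Suc i"
        by (rule inj_onD[OF bij_betw_imp_inj_on[OF succ_enum(1)[OF \<sigma>(1)[OF w]]]])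
          (use n(2)[OF w] i in auto)
      then show False by simp
    qed
    then show "c (\<sigma> w) = 0" unfolding c_def t by auto
    have "\<exists>i<n w. \<sigma>' w = (succ ^^ Suc i) (\<sigma> w)" if "n w \<noteq> 0"
      using n(1)[OF w] that by (intro exI[of _ "n w - 1"]) auto
    then show cs: "c (\<sigma>' w) = (if n w = 0 then 0 else 1)" unfolding c_def t using t(3) by auto
    show "0 \<le> c x \<and> c x \<le> c (\<sigma>' w)" if x: "x \<in> out_arcs G w" for x
    proof -
      have "tail G x = w" using x by simp
      then show ?thesis unfolding cs unfolding c_def by auto
    qed
  qed
  have Nq: "N x = 0" if "tail G x = q" for x using that h(2) by (simp add: N_def c_def)
  have Nx: "N (\<sigma> w) \<le> N x" "N x \<le> N (\<sigma>' w)" "N (\<sigma>' w) \<le> N x + 1"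
    if w: "w \<in> verts G - {q}" and x: "x \<in> out_arcs G w" for x w
    using c[OF w] c(3)[OF w x] \<sigma>[OF w] x unfolding N_def by (auto split: if_splits)
  have out: "x \<in> out_arcs G (tail G x)" "tail G x \<in> verts G" if "x \<in> arcs G" for x using that by auto
  \<comment> \<open>At a vertex of \<open>?A\<close> the largest value of \<open>N\<close> is at
    least 1, so no arc there has negative \<open>N\<close>; elsewhere no arc has positive
    \<open>N\<close>. Hence a new rotor cannot leave \<open>?A\<close>.\<close>
  let ?A = "{w \<in> verts G - {q}. 0 < N (\<sigma>' w)}"
  have "?A = {}"
  proof (rule rooted_closed_empty[OF r'])
    fix w assume w: "w \<in> ?A"
    show "head G (\<sigma>' w) \<in> ?A"
    proof (rule ccontr)
      assume nh: "head G (\<sigma>' w) \<notin> ?A"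
      have w': "w \<in> verts G - {q}" using w by simp
      have t: "tail G (\<sigma>' w) = w" "\<sigma>' w \<in> arcs G" using \<sigma>[OF w'] by auto
      have "N (\<sigma>' w) = 0"
      proof (rule balanced_flow_no_crossing[OF bal])
        fix x assume x: "x \<in> arcs G"
        show "0 \<le> N x" if "tail G x \<in> ?A"
          using that Nx(3)[of "tail G x" x] out[OF x] by auto
        show "N x \<le> 0" if "tail G x \<notin> ?A"
          using that Nx(2)[of "tail G x" x] out[OF x] Nq[of x] by (cases "tail G x = q") auto
      next
        show "tail G (\<sigma>' w) \<in> ?A" unfolding t(1) by (rule w)
      qed (use t nh in auto)
      then show False using w by simp
    qed
  qed auto
  then have A: "N (\<sigma>' w) \<le> 0" if "w \<in> verts G - {q}" for w using that by force
  have N0: "N x \<le> 0" if x: "x \<in> arcs G" for x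
    using A[of "tail G x"] Nx(2)[of "tail G x" x] out[OF x] Nq[of x] by (cases "tail G x = q") auto
  \<comment> \<open>The same argument for \<open>- N\<close> and the old rotors, where
    \<open>N0\<close> already gives the sign on all arcs.\<close>
  let ?B = "{w \<in> verts G - {q}. N (\<sigma> w) < 0}"
  have "?B = {}"
  proof (rule rooted_closed_empty[OF r])
    fix w assume w: "w \<in> ?B"
    show "head G (\<sigma> w) \<in> ?B"
    proof (rule ccontr)
      assume nh: "head G (\<sigma> w) \<notin> ?B"
      have w': "w \<in> verts G - {q}" using w by simp
      have t: "tail G (\<sigma> w) = w" "\<sigma> w \<in> arcs G" using \<sigma>[OF w'] by auto
      have "- N (\<sigma> w) = 0"
      proof (rule balanced_flow_no_crossing[of "\<lambda>x. - N x"])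
        show "(\<Sum>x\<in>arcs G. - N x * ((if tail G x = u then 1 else 0) - (if head G x = u then 1 else 0))) = 0" for u
          using bal[of u] by (simp only: mult_minus_left sum_negf neg_equal_0_iff_equal)
      next
        fix x assume x: "x \<in> arcs G"
        show "0 \<le> - N x" using N0[OF x] by simp
        show "- N x \<le> 0" if "tail G x \<notin> ?B"
          using that Nx(1)[of "tail G x" x] out[OF x] Nq[of x] by (cases "tail G x = q") auto
      next
        show "tail G (\<sigma> w) \<in> ?B" unfolding t(1) by (rule w)
      qed (use t nh in auto)
      then show False using w by simp
    qed
  qed auto
  then have B: "0 \<le> N (\<sigma> w)" if "w \<in> verts G - {q}" for w using that by force
  have w': "w \<in> verts G - {q}" using w by simp
  \<comment> \<open>The emptiness of the two sets gives \<open>c (\<sigma>' w) \<le> h w\<close> and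
    \<open>h w \<le> c (\<sigma> w)\<close>.\<close>
  have "c (\<sigma>' w) \<le> c (\<sigma> w)"
    using A[OF w'] B[OF w'] \<sigma>[OF w'] by (simp add: N_def)
  then have "n w = 0" using c(1,2)[OF w'] by (simp split: if_splits)
  then show ?thesis using n(1)[OF w'] by simp
qed

lemma routes_unique:
  assumes "rooted q \<sigma>" "rooted q \<sigma>1" "rooted q \<sigma>2" "routes q \<sigma> D \<sigma>1" "routes q \<sigma> D \<sigma>2"
    and "w \<in> verts G" "w \<noteq> q"
  shows "\<sigma>1 w = \<sigma>2 w"
proof -
  have "routes q \<sigma>1 (- D + D) \<sigma>2"
    using routes_trans[OF rooted_rotors[OF assms(2)] routes_sym[OF rooted_rotors[OF assms(1)] assms(4)] assms(5)] .
  then show ?thesis using routes_zero_eq[OF assms(2,3)] assms(6,7) by simp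
qed

subsection \<open>Rotor-routing reaches the sink\<close>

text \<open>The invariant of rotor-routing with the chip at \<open>v\<close>: following the rotors
  from any vertex leads to the sink or to the chip. With the chip at the sink it says that the
  configuration is rooted.\<close>

definition drains :: "'v \<Rightarrow> ('v \<Rightarrow> 'a) \<Rightarrow> 'v \<Rightarrow> bool" where
  "drains q \<sigma> v \<longleftrightarrow> (\<forall>w\<in>verts G. (w, q) \<in> (follow q \<sigma>)\<^sup>* \<or> (w, v) \<in> (follow q \<sigma>)\<^sup>*)"

lemma rooted_iff_drains: "q \<in> verts G \<Longrightarrow> rooted q \<sigma> \<longleftrightarrow> rotors q \<sigma> \<and> drains q \<sigma> q"
  by (auto simp: rooted_def rotors_def drains_def)

text \<open>A walk along the rotors that passes \<open>v\<close> is now led on to the new position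
  of the chip; a walk that avoids \<open>v\<close> is unchanged.\<close>

lemma drains_step:
  assumes d: "drains q \<sigma> v" and v: "v \<in> verts G" "v \<noteq> q"
  shows "drains q (\<sigma>(v := a)) (head G a)"
  unfolding drains_def
proof
  let ?F = "follow q \<sigma>" and ?F' = "follow q (\<sigma>(v := a))"
  let ?R = "\<lambda>z. (z, q) \<in> ?F'\<^sup>* \<or> (z, head G a) \<in> ?F'\<^sup>*"
  have "(v, head G a) \<in> ?F'" using v by (simp add: follow_iff)
  then have rv: "?R v" by blast
  have ind: "?R y \<longrightarrow> ?R z" if "(z, y) \<in> ?F\<^sup>*" for y z
    using that
  proof (induction rule: converse_rtrancl_induct)
    case (step z z')
    show ?case
    proof (cases "z = v")
      case False
      then have "(z, z') \<in> ?F'" using step(1) by (simp add: follow_iff)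
      then show ?thesis using step(3) by (meson converse_rtrancl_into_rtrancl)
    qed (use rv in blast)
  qed blast
  fix w assume "w \<in> verts G"
  then show "?R w" using d ind[of w q] ind[of w v] rv unfolding drains_def by blast
qed

definition routing_state :: "'v \<Rightarrow> ('v \<Rightarrow> 'a) \<Rightarrow> 'v \<Rightarrow> ('v \<Rightarrow> 'a) \<times> 'v \<Rightarrow> bool" where
  "routing_state q \<sigma>0 v0 s \<longleftrightarrow> snd s \<in> verts G \<and> rotors q (fst s) \<and> drains q (fst s) (snd s) \<and>
     routes q \<sigma>0 (frag_of v0 - frag_of (snd s)) (fst s)"

lemma rotor_step_simps:
  "snd (rotor_step s) = head G (succ (fst s (snd s)))"
  "fst (rotor_step s) = (fst s)(snd s := succ (fst s (snd s)))"
  by (simp_all add: rotor_step_def case_prod_beta Let_def)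

lemma routes_single:
  assumes "v \<in> verts G" "v \<noteq> q" "\<sigma> v \<in> out_arcs G v"
  shows "routes q \<sigma> (frag_of v - frag_of (head G (succ (\<sigma> v)))) (\<sigma>(v := succ (\<sigma> v)))"
proof (rule routesI[of _ _ "\<lambda>w. if w = v then 1 else 0"])
  have "(\<Sum>w\<in>verts G - {q}. rot (\<sigma> w) (if w = v then 1 else 0)) = (\<Sum>w\<in>verts G - {q}. if w = v then rot (\<sigma> v) 1 else 0)"
    by (rule sum.cong) auto
  also have "\<dots> = rot (\<sigma> v) 1" using assms by simp
  also have "\<dots> = frag_of v - frag_of (head G (succ (\<sigma> v)))" using assms by (simp add: rot_def)
  finally show "frag_of v - frag_of (head G (succ (\<sigma> v))) -
    (\<Sum>w\<in>verts G - {q}. rot (\<sigma> w) (if w = v then 1 else 0)) \<in> Prin" by (simp add: Prin_zero)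
qed auto

lemma routing_state_step:
  assumes s: "routing_state q \<sigma>0 v0 s" "snd s \<noteq> q" and r0: "rotors q \<sigma>0"
  shows "routing_state q \<sigma>0 v0 (rotor_step s)"
proof -
  obtain \<sigma> v where sv: "s = (\<sigma>, v)" by (cases s)
  note s' = s(1)[unfolded routing_state_def sv fst_conv snd_conv]
  have v: "v \<in> verts G" "v \<noteq> q" using s s' sv by auto
  have o: "\<sigma> v \<in> out_arcs G v" using s' v by (auto simp: rotors_def)
  let ?a = "succ (\<sigma> v)"
  have oa: "?a \<in> out_arcs G v" using succ_out[OF o] .
  then have "head G ?a \<in> verts G" by auto
  moreover have "rotors q (\<sigma>(v := ?a))" using s' oa by (auto simp: rotors_def)
  moreover have "drains q (\<sigma>(v := ?a)) (head G ?a)" using drains_step s' v by blast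
  moreover have "routes q \<sigma>0 (frag_of v0 - frag_of (head G ?a)) (\<sigma>(v := ?a))"
    using routes_trans[OF r0 _ routes_single[where \<sigma> = \<sigma>, OF v o], of "frag_of v0 - frag_of v"] s' by simp
  ultimately show ?thesis by (simp add: routing_state_def rotor_step_simps sv)
qed

text \<open>Between consecutive visits to \<open>v\<close> its rotor rests. So whenever a visit
  leaves the rotor at \<open>x\<close>, the next visit turns it to \<open>succ x\<close>.\<close>

lemma frequent_rotor_succ:
  fixes st :: "nat \<Rightarrow> ('v \<Rightarrow> 'a) \<times> 'v"
  assumes st: "\<And>k. st (Suc k) = rotor_step (st k)"
    and x: "\<exists>\<^sub>\<infinity>k. snd (st k) = v \<and> fst (st (Suc k)) v = x"
  shows "\<exists>\<^sub>\<infinity>k. snd (st k) = v \<and> fst (st (Suc k)) v = succ x"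
  unfolding INFM_nat
proof
  fix m
  obtain k where k: "k > m" "snd (st k) = v" "fst (st (Suc k)) v = x" using x by (auto simp: INFM_nat)
  define l where "l = (LEAST l. l > k \<and> snd (st l) = v)"
  have "\<exists>l. l > k \<and> snd (st l) = v" using x by (auto simp: INFM_nat)
  then have l: "l > k" "snd (st l) = v" using LeastI_ex[of "\<lambda>l. l > k \<and> snd (st l) = v"] by (auto simp: l_def)
  have nl: "snd (st j) \<noteq> v" if "k < j" "j < l" for j using not_less_Least[of j] that by (auto simp: l_def)
  have "fst (st j) v = x" if "Suc k \<le> j" "j \<le> l" for j
    using that
  proof (induction j rule: dec_induct)
    case (step j)
    then show ?case using nl[of j] by (simp add: st rotor_step_simps)
  qed (rule k(3))
  then have "fst (st (Suc l)) v = succ x" using l by (simp add: st rotor_step_simps)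
  then show "\<exists>k>m. snd (st k) = v \<and> fst (st (Suc k)) v = succ x" using k l by (intro exI[of _ l]) auto
qed

text \<open>Otherwise some vertex is visited infinitely often; its rotor keeps turning and sends the
  chip along every edge there infinitely often. So the vertices visited infinitely often are closed
  under adjacency, and by connectedness \<open>q\<close> is one of them.\<close>

lemma rotor_routing_reaches_sink:
  assumes s0: "routing_state q \<sigma>0 v0 s0" and r0: "rotors q \<sigma>0" and q: "q \<in> verts G"
  shows "\<exists>k. snd ((rotor_step ^^ k) s0) = q"
proof (rule ccontr)
  define st where "st k = (rotor_step ^^ k) s0" for k
  assume "\<not> ?thesis"
  then have nq: "snd (st k) \<noteq> q" for k by (auto simp: st_def)
  have step: "st (Suc k) = rotor_step (st k)" for k by (simp add: st_def)
  have inv: "routing_state q \<sigma>0 v0 (st k)" for k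
  proof (induction k)
    case 0
    then show ?case using s0 by (simp add: st_def)
  next
    case (Suc k)
    then show ?case unfolding step using routing_state_step nq r0 by blast
  qed
  define V where "V = {v. \<exists>\<^sub>\<infinity>k. snd (st k) = v}"
  have "\<exists>\<^sub>\<infinity>k. \<exists>v\<in>verts G. snd (st k) = v" using inv by (simp add: routing_state_def)
  then obtain v where v: "v \<in> V"
    unfolding V_def INFM_finite_Bex_distrib[OF finite_verts] by blast
  have step_V: "head G x \<in> V" if u: "u \<in> V" and x: "x \<in> out_arcs G u" for u x
  proof -
    have Vq: "u \<in> verts G" using x by auto
    have new: "fst (st (Suc k)) u \<in> out_arcs G u \<and> snd (st (Suc k)) = head G (fst (st (Suc k)) u)"
      if "snd (st k) = u" for k
    proof -
      have "u \<noteq> q" using nq[of k] that by simp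
      then have "fst (st (Suc k)) u \<in> out_arcs G u"
        using inv[of "Suc k"] Vq by (simp add: routing_state_def rotors_def)
      then show ?thesis using that by (simp add: step rotor_step_simps)
    qed
    have "\<exists>\<^sub>\<infinity>k. \<exists>y\<in>out_arcs G u. snd (st k) = u \<and> fst (st (Suc k)) u = y"
      using u new unfolding V_def mem_Collect_eq by (elim INFM_mono) blast
    then have "\<exists>y\<in>out_arcs G u. \<exists>\<^sub>\<infinity>k. snd (st k) = u \<and> fst (st (Suc k)) u = y"
      by (rule frequently_bex_finite[rotated]) simp
    then obtain y where y: "y \<in> out_arcs G u" "\<exists>\<^sub>\<infinity>k. snd (st k) = u \<and> fst (st (Suc k)) u = y"
      by blast
    have "\<exists>\<^sub>\<infinity>k. snd (st k) = u \<and> fst (st (Suc k)) u = (succ ^^ i) y" for i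
      by (induction i) (use y(2) frequent_rotor_succ[of st, OF step] in simp_all)
    moreover obtain i where "(succ ^^ i) y = x" using succ_reach[OF y(1) x] by blast
    ultimately have "\<exists>\<^sub>\<infinity>k. snd (st k) = u \<and> fst (st (Suc k)) u = x" by blast
    then have "\<exists>\<^sub>\<infinity>k. snd (st (Suc k)) = head G x" using new by (elim INFM_mono) auto
    then show ?thesis unfolding V_def using INFM_inj[of "\<lambda>k. snd (st k) = head G x" Suc] by simp
  qed
  have vV: "v \<in> verts G" using v inv unfolding V_def by (auto simp: routing_state_def dest!: INFM_EX)
  have "(v, q) \<in> (adj (arcs G))\<^sup>*" by (rule adj_arcs_connected[OF vV q])
  then have "q \<in> V"
  proof induction
    case (step y z)
    then show ?case using step_V by (auto simp: adj_def)
  qed (rule v)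
  then show False using nq unfolding V_def by simp
qed

lemma rotor_route_routes:
  assumes T: "T \<in> spanning_trees" and q: "q \<in> verts G" and v: "v \<in> verts G"
  shows "rotor_route q v T \<in> spanning_trees"
    and "routes q (tree_rotors q T) (frag_of v - frag_of q) (tree_rotors q (rotor_route q v T))"
proof -
  define \<sigma>0 where "\<sigma>0 = tree_rotors q T"
  have r: "rooted q \<sigma>0" unfolding \<sigma>0_def by (rule tree_rotors_rooted(1)[OF T q])
  then have r0: "rotors q \<sigma>0" by (rule rooted_rotors)
  define s0 where "s0 = (\<sigma>0, v)"
  have s0: "routing_state q \<sigma>0 v s0"
    using r r0 v routes_refl by (auto simp: routing_state_def s0_def drains_def rooted_def)
  define P where "P k \<longleftrightarrow> snd ((rotor_step ^^ k) s0) = q" for k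
  have ex: "\<exists>k. P k" unfolding P_def by (rule rotor_routing_reaches_sink[OF s0 r0 q])
  \<comment> \<open>The loop stops at the first arrival at \<open>q\<close>, and
    \<open>routing_state_step\<close> applies only before it.\<close>
  define k where "k = (LEAST k. P k)"
  have k: "P k" using LeastI_ex[OF ex] by (simp add: k_def)
  have "routing_state q \<sigma>0 v ((rotor_step ^^ j) s0)" if "j \<le> k" for j
    using that
  proof (induction j)
    case (Suc j)
    then have "\<not> P j" using not_less_Least[of j P] by (simp add: k_def)
    then show ?case using Suc routing_state_step[OF _ _ r0] by (simp add: P_def)
  qed (use s0 in simp)
  then have inv: "routing_state q \<sigma>0 v ((rotor_step ^^ k) s0)" by simp
  let ?\<sigma> = "fst ((rotor_step ^^ k) s0)"
  have r': "rooted q ?\<sigma>" using inv k q by (simp add: rooted_iff_drains routing_state_def P_def)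
  have ro: "routes q \<sigma>0 (frag_of v - frag_of q) ?\<sigma>" using inv k by (simp add: routing_state_def P_def)
  have "while (\<lambda>(\<sigma>, v). v \<noteq> q) rotor_step s0 = (rotor_step ^^ k) s0"
    using ex unfolding while_def while_option_def k_def P_def by (simp add: case_prod_beta)
  then have eq: "rotor_route q v T = rotor_tree q ?\<sigma>"
    by (simp add: rotor_route_def rotor_tree_def s0_def \<sigma>0_def)
  show "rotor_route q v T \<in> spanning_trees" unfolding eq by (rule rotor_tree_spanning[OF r'])
  show "routes q (tree_rotors q T) (frag_of v - frag_of q) (tree_rotors q (rotor_route q v T))"
    unfolding eq using routes_cong[OF ro, of "frag_of v - frag_of q" \<sigma>0] tree_rotors_rotor_tree[OF r']
    by (simp add: \<sigma>0_def Prin_zero)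
qed

subsection \<open>The rotor-routing action\<close>

text \<open>The action as a relation, so that existence and uniqueness of the result can be shown
  separately, in \<open>acts_ex\<close> and \<open>acts_unique\<close>.\<close>

definition acts :: "'v \<Rightarrow> ('v \<Rightarrow>\<^sub>0 int) \<Rightarrow> 'a set \<Rightarrow> 'a set \<Rightarrow> bool" where
  "acts q D T T' \<longleftrightarrow> T \<in> spanning_trees \<and> T' \<in> spanning_trees \<and>
     routes q (tree_rotors q T) D (tree_rotors q T')"

lemma acts_route:
  "T \<in> spanning_trees \<Longrightarrow> q \<in> verts G \<Longrightarrow> v \<in> verts G \<Longrightarrow> acts q (frag_of v - frag_of q) T (rotor_route q v T)"
  using rotor_route_routes by (simp add: acts_def)

lemma acts_rooted:
  assumes "rooted q \<sigma>" "rooted q \<sigma>'" "routes q \<sigma> D \<sigma>'"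
  shows "acts q D (rotor_tree q \<sigma>) (rotor_tree q \<sigma>')"
  unfolding acts_def using assms(1,2) rotor_tree_spanning
    routes_cong[OF assms(3), of D "tree_rotors q (rotor_tree q \<sigma>)" "tree_rotors q (rotor_tree q \<sigma>')"]
    tree_rotors_rotor_tree by (simp add: Prin_zero)

lemma acts_zero: "T \<in> spanning_trees \<Longrightarrow> acts q 0 T T"
  by (simp add: acts_def routes_refl)

lemma acts_trans: "q \<in> verts G \<Longrightarrow> acts q D T T' \<Longrightarrow> acts q E T' T'' \<Longrightarrow> acts q (D + E) T T''"
  unfolding acts_def using routes_trans rooted_rotors tree_rotors_rooted(1) by blast

lemma acts_sym: "q \<in> verts G \<Longrightarrow> acts q D T T' \<Longrightarrow> acts q (- D) T' T"
  unfolding acts_def using routes_sym rooted_rotors tree_rotors_rooted(1) by blast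

lemma acts_Prin: "acts q D T T' \<Longrightarrow> D - D' \<in> Prin \<Longrightarrow> acts q D' T T'"
  unfolding acts_def using routes_cong[of q "tree_rotors q T" D "tree_rotors q T'" D'] by simp

lemma acts_unique:
  assumes q: "q \<in> verts G" and a: "acts q D T T1" "acts q D T T2"
  shows "T1 = T2"
proof -
  have "tree_rotors q T1 w = tree_rotors q T2 w" if "w \<in> verts G" "w \<noteq> q" for w
    using routes_unique[of q "tree_rotors q T"] a q that tree_rotors_rooted(1) unfolding acts_def by metis
  then have "rotor_tree q (tree_rotors q T1) = rotor_tree q (tree_rotors q T2)" by (rule rotor_tree_cong)
  then show ?thesis using a q tree_rotors_rooted(2) unfolding acts_def by metis
qed

section \<open>Every divisor of degree zero acts\<close>

lemma finite_spanning_trees: "finite spanning_trees"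
  by (rule finite_subset[of _ "Pow (arcs G)"]) (auto simp: spanning_trees_def)

lemma deg_eq: "Poly_Mapping.keys D \<subseteq> verts G \<Longrightarrow> deg D = (\<Sum>v\<in>verts G. Poly_Mapping.lookup D v)"
  unfolding deg_def by (rule sum.mono_neutral_left) (auto simp: in_keys_iff)

text \<open>Subtracting \<open>(q)\<close> once for every chip subtracts the degree times
  \<open>(q)\<close> in total, which is zero; so \<open>D\<close> is the sum of \<open>D v\<close>
  times \<open>(v) - (q)\<close>. Closure under differences gives sums and negatives as
  well.\<close>

lemma deg0_induct [consumes 2, case_names zero gen diff]:
  assumes D: "Poly_Mapping.keys D \<subseteq> verts G" "deg D = 0"
    and zero: "P 0" and gen: "\<And>v. v \<in> verts G \<Longrightarrow> P (frag_of v - frag_of q)"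
    and diff: "\<And>x y. P x \<Longrightarrow> P y \<Longrightarrow> P (x - y)"
  shows "P D"
proof -
  have add: "P (x + y)" if "P x" "P y" for x y
    using diff[OF that(1) diff[OF zero that(2)]] by simp
  have "P (\<Sum>v\<in>I. frag_cmul (Poly_Mapping.lookup D v) (frag_of v - frag_of q))"
    if "finite I" "I \<subseteq> verts G" for I
    using that
  proof (induction I)
    case (insert v I)
    then show ?case using add frag_closure_minus_cmul[of P, OF zero diff gen] by simp
  qed (simp add: zero)
  then have "P (\<Sum>v\<in>verts G. frag_cmul (Poly_Mapping.lookup D v) (frag_of v - frag_of q))" by simp
  also have "(\<Sum>v\<in>verts G. frag_cmul (Poly_Mapping.lookup D v) (frag_of v - frag_of q)) = D"
  proof (rule poly_mapping_eqI)
    fix u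
    let ?l = "Poly_Mapping.lookup D"
    have "Poly_Mapping.lookup (\<Sum>v\<in>verts G. frag_cmul (?l v) (frag_of v - frag_of q)) u
      = (\<Sum>v\<in>verts G. ?l v * ((if u = v then 1 else 0) - (if u = q then 1 else 0)))"
      by (simp add: Poly_Mapping.lookup_sum Poly_Mapping.lookup_minus)
    also have "\<dots> = (\<Sum>v\<in>verts G. if u = v then ?l v else 0) - (\<Sum>v\<in>verts G. ?l v) * (if u = q then 1 else 0)"
      by (simp add: right_diff_distrib sum_subtractf sum_distrib_right if_distrib[of "(*) _"] cong: if_cong)
    also have "\<dots> = ?l u" using D deg_eq[OF D(1)] by (auto simp: in_keys_iff)
    finally show "Poly_Mapping.lookup (\<Sum>v\<in>verts G. frag_cmul (?l v) (frag_of v - frag_of q)) u = ?l u" .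
  qed
  finally show ?thesis .
qed

text \<open>Rotor-routing yields the generators but not their inverses. Acting by \<open>D\<close>
  is injective, because going back by \<open>- D\<close> has a unique result; so it is surjective on
  the finite set of spanning trees, and a preimage of \<open>T\<close> is the tree sought.\<close>

lemma acts_ex_uminus:
  assumes q: "q \<in> verts G" and ex: "\<And>T. T \<in> spanning_trees \<Longrightarrow> \<exists>T'. acts q D T T'"
    and T: "T \<in> spanning_trees"
  shows "\<exists>T'. acts q (- D) T T'"
proof -
  define f where "f T = (SOME T'. acts q D T T')" for T
  have f: "acts q D T (f T)" if "T \<in> spanning_trees" for T
    unfolding f_def using someI_ex[OF ex[OF that]] .
  have "f ` spanning_trees \<subseteq> spanning_trees" using f by (auto simp: acts_def)
  moreover have "inj_on f spanning_trees"
  proof (rule inj_onI)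
    fix T1 T2 assume "T1 \<in> spanning_trees" "T2 \<in> spanning_trees" "f T1 = f T2"
    then have "acts q (- D) (f T1) T1" "acts q (- D) (f T1) T2" using f acts_sym[OF q] by metis+
    then show "T1 = T2" using acts_unique[OF q] by blast
  qed
  ultimately have "f ` spanning_trees = spanning_trees" using finite_spanning_trees by (simp add: endo_inj_surj)
  then obtain T0 where "T0 \<in> spanning_trees" "f T0 = T" using T by (metis imageE)
  then show ?thesis using f acts_sym[OF q] by metis
qed

lemma acts_ex:
  assumes q: "q \<in> verts G" and D: "Poly_Mapping.keys D \<subseteq> verts G" "deg D = 0" and T: "T \<in> spanning_trees"
  shows "\<exists>T'. acts q D T T'"
proof -
  have "\<forall>T\<in>spanning_trees. \<exists>T'. acts q D T T'"
    using D
  proof (induction D rule: deg0_induct[where q = q])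
    case zero
    then show ?case using acts_zero by blast
  next
    case (gen v)
    then show ?case using acts_route q by blast
  next
    case (diff x y)
    show ?case
    proof
      fix T assume "T \<in> spanning_trees"
      then obtain T' where T': "acts q x T T'" using diff(1) by blast
      then have "T' \<in> spanning_trees" by (simp add: acts_def)
      then obtain T'' where "acts q (- y) T' T''" using acts_ex_uminus[OF q] diff(2) by blast
      then have "acts q (x + - y) T T''" using acts_trans[OF q T'] by blast
      then show "\<exists>T'. acts q (x - y) T T'" by auto
    qed
  qed
  then show ?thesis using T by blast
qed

section \<open>Divisors of degree zero and their class group\<close>

definition Div0 :: "('v \<Rightarrow>\<^sub>0 int) set" where
  "Div0 = {D. Poly_Mapping.keys D \<subseteq> verts G \<and> deg D = 0}"

lemma Div0_iff: "D \<in> Div0 \<longleftrightarrow> Poly_Mapping.keys D \<subseteq> verts G \<and> deg D = 0"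
  by (simp add: Div0_def)

lemma deg_add:
  assumes "Poly_Mapping.keys D \<subseteq> verts G" "Poly_Mapping.keys E \<subseteq> verts G"
  shows "deg (D + E) = deg D + deg E"
proof -
  have "Poly_Mapping.keys (D + E) \<subseteq> verts G" using assms Poly_Mapping.keys_add[of D E] by auto
  then show ?thesis using assms by (simp add: deg_eq Poly_Mapping.lookup_add sum.distrib)
qed

lemma Div0_zero: "0 \<in> Div0"
  by (simp add: deg_def Div0_iff)

lemma Div0_add: "D \<in> Div0 \<Longrightarrow> E \<in> Div0 \<Longrightarrow> D + E \<in> Div0"
  using deg_add[of D E] Poly_Mapping.keys_add[of D E] by (auto simp: Div0_iff)

lemma Div0_uminus: "D \<in> Div0 \<Longrightarrow> - D \<in> Div0"
  using deg_eq[of D] deg_eq[of "- D"] by (simp add: Div0_iff sum_negf)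

lemma Div0_diff: "D \<in> Div0 \<Longrightarrow> E \<in> Div0 \<Longrightarrow> D - E \<in> Div0"
  using Div0_add[OF _ Div0_uminus, of D E] by (simp only: diff_conv_add_uminus)

lemma Div0_gen: "v \<in> verts G \<Longrightarrow> q \<in> verts G \<Longrightarrow> frag_of v - frag_of q \<in> Div0"
proof -
  assume vq: "v \<in> verts G" "q \<in> verts G"
  have "Poly_Mapping.keys (frag_of v - frag_of q) \<subseteq> verts G"
    using vq keys_diff[of "frag_of v" "frag_of q"] by (auto simp: keys_frag_of)
  then show ?thesis using vq by (simp add: Div0_iff deg_eq Poly_Mapping.lookup_minus sum_subtractf)
qed

lemma divisor_class_eq_image: "divisor_class D = (\<lambda>h. h + D) ` Prin"
  by (auto simp: divisor_class_def r_coset_def)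

lemma divisor_class_mem: "E \<in> divisor_class D \<longleftrightarrow> E - D \<in> Prin"
  by (auto simp: divisor_class_eq_image image_iff) (metis diff_add_cancel)

lemma divisor_class_eq: "divisor_class D = divisor_class E \<longleftrightarrow> D - E \<in> Prin"
proof
  assume "divisor_class D = divisor_class E"
  then show "D - E \<in> Prin" using divisor_class_mem[of D D] divisor_class_mem[of D E] Prin_zero by simp
next
  assume DE: "D - E \<in> Prin"
  have "F - D \<in> Prin \<longleftrightarrow> F - E \<in> Prin" for F
    using Prin_add[OF _ DE, of "F - D"] Prin_diff[OF _ DE, of "F - E"] by auto
  then show "divisor_class D = divisor_class E" using divisor_class_mem by blast
qed

lemma divisor_class_set_mult: "divisor_class D <#>\<^bsub>Divs\<^esub> divisor_class E = divisor_class (D + E)"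
proof (intro equalityI subsetI)
  fix F assume "F \<in> divisor_class D <#>\<^bsub>Divs\<^esub> divisor_class E"
  then obtain x y where "x - D \<in> Prin" "y - E \<in> Prin" "F = x + y"
    by (auto simp: set_mult_def divisor_class_mem)
  then show "F \<in> divisor_class (D + E)"
    using Prin_add[of "x - D" "y - E"] by (simp add: divisor_class_mem algebra_simps)
next
  fix F assume "F \<in> divisor_class (D + E)"
  then have "F - E \<in> divisor_class D" "E \<in> divisor_class E"
    using Prin_zero by (auto simp: divisor_class_mem algebra_simps)
  then show "F \<in> divisor_class D <#>\<^bsub>Divs\<^esub> divisor_class E"
    unfolding set_mult_def by force
qed

lemma carrier_Pic0: "carrier Pic0 = divisor_class ` Div0"
  by (auto simp: Pic0_def FactGroup_def RCOSETS_def divisor_class_def r_coset_def Div0_def)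

lemma mult_Pic0: "divisor_class D \<otimes>\<^bsub>Pic0\<^esub> divisor_class E = divisor_class (D + E)"
  using divisor_class_set_mult[of D E] by (simp add: Pic0_def FactGroup_def set_mult_def)

lemma one_Pic0: "\<one>\<^bsub>Pic0\<^esub> = divisor_class 0"
  by (simp add: Pic0_def FactGroup_def divisor_class_eq_image)

lemma group_Pic0: "group Pic0"
proof (rule groupI)
  show "\<one>\<^bsub>Pic0\<^esub> \<in> carrier Pic0" unfolding one_Pic0 carrier_Pic0 using Div0_zero by blast
  show "x \<otimes>\<^bsub>Pic0\<^esub> y \<in> carrier Pic0" if "x \<in> carrier Pic0" "y \<in> carrier Pic0" for x y
    using that Div0_add unfolding carrier_Pic0 by (auto simp: mult_Pic0)
  show "x \<otimes>\<^bsub>Pic0\<^esub> y \<otimes>\<^bsub>Pic0\<^esub> z = x \<otimes>\<^bsub>Pic0\<^esub> (y \<otimes>\<^bsub>Pic0\<^esub> z)"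
    if "x \<in> carrier Pic0" "y \<in> carrier Pic0" "z \<in> carrier Pic0" for x y z
    using that unfolding carrier_Pic0 by (auto simp: mult_Pic0 add.assoc)
  show "\<one>\<^bsub>Pic0\<^esub> \<otimes>\<^bsub>Pic0\<^esub> x = x" if "x \<in> carrier Pic0" for x
    using that unfolding carrier_Pic0 by (auto simp: mult_Pic0 one_Pic0)
  show "\<exists>y\<in>carrier Pic0. y \<otimes>\<^bsub>Pic0\<^esub> x = \<one>\<^bsub>Pic0\<^esub>" if x: "x \<in> carrier Pic0" for x
  proof -
    obtain D where D: "D \<in> Div0" "x = divisor_class D" using x unfolding carrier_Pic0 by blast
    then show ?thesis
      unfolding carrier_Pic0 using Div0_uminus[OF D(1)]
      by (intro bexI[of _ "divisor_class (- D)"]) (auto simp: mult_Pic0 one_Pic0)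
  qed
qed

section \<open>Permutation of the spanning trees by divisor classes\<close>

definition tree_action :: "'v \<Rightarrow> ('v \<Rightarrow>\<^sub>0 int) set \<Rightarrow> 'a set \<Rightarrow> 'a set" where
  "tree_action q = (\<lambda>c\<in>carrier Pic0. \<lambda>T\<in>spanning_trees. THE T'. \<exists>D\<in>c. acts q D T T')"

text \<open>By \<open>acts_Prin\<close> the result does not depend on the representative of the
  class, and by \<open>acts_unique\<close> it is determined; so the description in
  \<open>tree_action\<close> is unambiguous.\<close>

lemma tree_action_eq_iff:
  assumes q: "q \<in> verts G" and D: "D \<in> Div0" and T: "T \<in> spanning_trees"
  shows "tree_action q (divisor_class D) T = T' \<longleftrightarrow> acts q D T T'"
proof -
  obtain T1 where T1: "acts q D T T1" using acts_ex[OF q _ _ T] D by (auto simp: Div0_iff)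
  have "(\<exists>E\<in>divisor_class D. acts q E T T') \<longleftrightarrow> T' = T1" for T'
  proof
    assume "\<exists>E\<in>divisor_class D. acts q E T T'"
    then obtain E where "E - D \<in> Prin" "acts q E T T'" by (auto simp: divisor_class_mem)
    then have "acts q D T T'" using acts_Prin by blast
    then show "T' = T1" using acts_unique[OF q] T1 by blast
  next
    assume "T' = T1"
    then show "\<exists>E\<in>divisor_class D. acts q E T T'"
      using T1 Prin_zero by (intro bexI[of _ D]) (auto simp: divisor_class_mem)
  qed
  then have "tree_action q (divisor_class D) T = T1"
    using D T by (simp add: tree_action_def carrier_Pic0)
  then show ?thesis using T1 acts_unique[OF q] by blast
qed

lemma tree_action_group_action:
  assumes q: "q \<in> verts G"
  shows "group_action Pic0 spanning_trees (tree_action q)"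
proof -
  have act: "acts q D T (tree_action q (divisor_class D) T)" if "D \<in> Div0" "T \<in> spanning_trees" for D T
    using tree_action_eq_iff[OF q that] by blast
  then have mem: "tree_action q (divisor_class D) T \<in> spanning_trees" if "D \<in> Div0" "T \<in> spanning_trees" for D T
    using that unfolding acts_def by blast
  have add: "tree_action q (divisor_class (D + E)) T = tree_action q (divisor_class D) (tree_action q (divisor_class E) T)"
    if "D \<in> Div0" "E \<in> Div0" "T \<in> spanning_trees" for D E T
    using acts_trans[OF q act[OF that(2,3)] act[OF that(1) mem[OF that(2,3)]]]
      tree_action_eq_iff[OF q Div0_add[OF that(1,2)] that(3)] by (simp add: add.commute)
  have zero: "tree_action q (divisor_class 0) T = T" if "T \<in> spanning_trees" for T
    using tree_action_eq_iff[OF q Div0_zero that] acts_zero[OF that] by blast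
  have bij: "tree_action q (divisor_class D) \<in> Bij spanning_trees" if D: "D \<in> Div0" for D
  proof -
    have "bij_betw (tree_action q (divisor_class D)) spanning_trees spanning_trees"
      by (rule bij_betw_byWitness[where f' = "tree_action q (divisor_class (- D))"])
        (use mem[OF D] mem[OF Div0_uminus[OF D]] add[OF D Div0_uminus[OF D]] add[OF Div0_uminus[OF D] D] zero
          in auto)
    moreover have "tree_action q (divisor_class D) \<in> extensional spanning_trees"
      using D by (auto simp: tree_action_def carrier_Pic0)
    ultimately show ?thesis by (simp add: Bij_def)
  qed
  have "tree_action q \<in> hom Pic0 (BijGroup spanning_trees)"
  proof (rule homI)
    fix x assume "x \<in> carrier Pic0"
    then show "tree_action q x \<in> carrier (BijGroup spanning_trees)"
      unfolding carrier_Pic0 BijGroup_def using bij by auto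
  next
    fix x y assume "x \<in> carrier Pic0" "y \<in> carrier Pic0"
    then obtain D E where DE: "D \<in> Div0" "x = divisor_class D" "E \<in> Div0" "y = divisor_class E"
      unfolding carrier_Pic0 by blast
    have "tree_action q (x \<otimes>\<^bsub>Pic0\<^esub> y) = compose spanning_trees (tree_action q x) (tree_action q y)"
    proof
      fix T
      show "tree_action q (x \<otimes>\<^bsub>Pic0\<^esub> y) T = compose spanning_trees (tree_action q x) (tree_action q y) T"
      proof (cases "T \<in> spanning_trees")
        case True
        then show ?thesis using DE(2,4) add[OF DE(1,3)] by (simp add: mult_Pic0 compose_def)
      next
        case False
        have "tree_action q (divisor_class (D + E)) \<in> extensional spanning_trees"
          using bij[OF Div0_add[OF DE(1,3)]] by (simp add: Bij_def)
        then show ?thesis using False DE(2,4) by (simp add: mult_Pic0 compose_def extensional_def)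
      qed
    qed
    then show "tree_action q (x \<otimes>\<^bsub>Pic0\<^esub> y) =
      tree_action q x \<otimes>\<^bsub>BijGroup spanning_trees\<^esub> tree_action q y"
      unfolding BijGroup_def using DE bij by simp
  qed
  then show ?thesis
    by (intro group_action.intro group_hom.intro group_hom_axioms.intro group_Pic0 group_BijGroup)
qed

lemma group_action_eqI:
  assumes \<phi>: "group_action Pic0 spanning_trees \<phi>" and \<psi>: "group_action Pic0 spanning_trees \<psi>"
    and q: "q \<in> verts G"
    and gen: "\<And>v T. v \<in> verts G \<Longrightarrow> T \<in> spanning_trees \<Longrightarrow>
      \<phi> (divisor_class (frag_of v - frag_of q)) T = \<psi> (divisor_class (frag_of v - frag_of q)) T"
    and c: "c \<in> carrier Pic0"
  shows "\<phi> c = \<psi> c"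
proof -
  interpret \<phi>: group_hom Pic0 "BijGroup spanning_trees" \<phi> using \<phi> by (rule group_action.group_hom)
  interpret \<psi>: group_hom Pic0 "BijGroup spanning_trees" \<psi> using \<psi> by (rule group_action.group_hom)
  obtain D where D: "Poly_Mapping.keys D \<subseteq> verts G" "deg D = 0" "c = divisor_class D"
    using c unfolding carrier_Pic0 by (auto simp: Div0_iff)
  have "D \<in> Div0 \<and> \<phi> (divisor_class D) = \<psi> (divisor_class D)"
    using D(1,2)
  proof (induction D rule: deg0_induct[where q = q])
    case zero
    have "\<phi> (divisor_class 0) = \<psi> (divisor_class 0)"
      using \<phi>.hom_one \<psi>.hom_one by (simp add: one_Pic0)
    then show ?case using Div0_zero by blast
  next
    case (gen v)
    let ?c = "divisor_class (frag_of v - frag_of q)"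
    have D: "frag_of v - frag_of q \<in> Div0" by (rule Div0_gen[OF gen q])
    then have "?c \<in> carrier Pic0" unfolding carrier_Pic0 by blast
    then have "\<phi> ?c \<in> extensional spanning_trees" "\<psi> ?c \<in> extensional spanning_trees"
      using \<phi>.hom_closed \<psi>.hom_closed by (auto simp: BijGroup_def Bij_def)
    then have "\<phi> ?c = \<psi> ?c" by (rule extensionalityI) (rule assms(4)[OF gen])
    then show ?case using D by blast
  next
    case (diff x y)
    have xy: "x - y \<in> Div0" using diff Div0_diff by blast
    have car: "divisor_class y \<in> carrier Pic0" "divisor_class (x - y) \<in> carrier Pic0"
      using xy diff unfolding carrier_Pic0 by blast+
    \<comment> \<open>The actions agree on the classes of \<open>x\<close> and \<open>y\<close>;
      cancelling the factor of \<open>y\<close> in the group of permutations leaves agreement on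
      that of \<open>x - y\<close>.\<close>
    have e: "divisor_class x = divisor_class (x - y) \<otimes>\<^bsub>Pic0\<^esub> divisor_class y" by (simp add: mult_Pic0)
    have "\<phi> (divisor_class (x - y)) \<otimes>\<^bsub>BijGroup spanning_trees\<^esub> \<phi> (divisor_class y) =
      \<psi> (divisor_class (x - y)) \<otimes>\<^bsub>BijGroup spanning_trees\<^esub> \<phi> (divisor_class y)"
      using diff e \<phi>.hom_mult[OF car(2,1)] \<psi>.hom_mult[OF car(2,1)] by metis
    then have "\<phi> (divisor_class (x - y)) = \<psi> (divisor_class (x - y))"
      using group.right_cancel[OF group_BijGroup] \<phi>.hom_closed[OF car(1)] \<phi>.hom_closed[OF car(2)]
        \<psi>.hom_closed[OF car(2)] by blast
    then show ?case using xy by blast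
  qed
  then show ?thesis using D(3) by blast
qed

text \<open>The description in \<open>rotor_action\<close> has a solution, and
  \<open>group_action_eqI\<close> shows that it has only one, because the classes of
  \<open>(v) - (q)\<close> generate the group.\<close>

lemma rotor_action_eq:
  assumes q: "q \<in> verts G"
  shows "rotor_action q = tree_action q"
  unfolding rotor_action_def
proof (rule the_equality)
  have gen: "tree_action q (divisor_class (frag_of v - frag_of q)) T = rotor_route q v T"
    if "v \<in> verts G" "T \<in> spanning_trees" for v T
    using tree_action_eq_iff[OF q Div0_gen[OF that(1) q] that(2)] acts_route[OF that(2) q that(1)] by blast
  show "tree_action q \<in> extensional (carrier Pic0) \<and> group_action Pic0 spanning_trees (tree_action q) \<and>
    (\<forall>v\<in>verts G. \<forall>T\<in>spanning_trees. tree_action q (divisor_class (frag_of v - frag_of q)) T = rotor_route q v T)"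
    using tree_action_group_action[OF q] gen by (auto simp: tree_action_def)
  fix \<phi>
  assume \<phi>: "\<phi> \<in> extensional (carrier Pic0) \<and> group_action Pic0 spanning_trees \<phi> \<and>
    (\<forall>v\<in>verts G. \<forall>T\<in>spanning_trees. \<phi> (divisor_class (frag_of v - frag_of q)) T = rotor_route q v T)"
  show "\<phi> = tree_action q"
  proof (rule extensionalityI)
    show "\<phi> \<in> extensional (carrier Pic0)" "tree_action q \<in> extensional (carrier Pic0)"
      using \<phi> by (auto simp: tree_action_def)
    show "\<phi> c = tree_action q c" if "c \<in> carrier Pic0" for c
      by (rule group_action_eqI[OF _ tree_action_group_action[OF q] q _ that]) (use \<phi> gen in auto)
  qed
qed

subsection \<open>The Bernardi tour\<close>

text \<open>This needs no bijectivity of \<open>T \<mapsto> [\<beta>(T)]\<close>: \<open>inv_into\<close> maps all classes outside the range to the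
  same tree, and only one of \<open>T\<close>, \<open>T'\<close> can be that tree. If \<open>T'\<close> is, the inverse divisor takes \<open>T'\<close>
  back to \<open>T\<close> and yields the same equation.\<close>

lemma bernardi_eq_rotor_imp:
  assumes q: "q \<in> verts G" and D: "D \<in> Div0" and act: "acts q D T T'" and ne: "T \<noteq> T'"
    and eq: "\<And>c T. c \<in> carrier Pic0 \<Longrightarrow> T \<in> spanning_trees \<Longrightarrow> rotor_action q c T = bernardi_action e c T"
  shows "bernardi_divisor e T' - bernardi_divisor e T - D \<in> Prin"
proof -
  let ?F = "\<lambda>T. divisor_class (bernardi_divisor e T)"
  have key: "T2 = (SOME x. False) \<or> ?F T2 = divisor_class (E + bernardi_divisor e T1)"
    if E: "E \<in> Div0" and a: "acts q E T1 T2" for E T1 T2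
  proof -
    have T: "T1 \<in> spanning_trees" "T2 \<in> spanning_trees" using a by (auto simp: acts_def)
    have "rotor_action q (divisor_class E) T1 = T2"
      using rotor_action_eq[OF q] tree_action_eq_iff[OF q E T(1)] a by simp
    then have "T2 = inv_into spanning_trees ?F (divisor_class (E + bernardi_divisor e T1))"
      using eq[of "divisor_class E" T1] E T by (simp add: carrier_Pic0 bernardi_action_def divisor_class_set_mult)
    moreover have "inv_into spanning_trees ?F y = (SOME x. False)" if "y \<notin> ?F ` spanning_trees" for y
    proof -
      have "(\<lambda>x. x \<in> spanning_trees \<and> ?F x = y) = (\<lambda>x. False)" using that by blast
      then show ?thesis unfolding inv_into_def by simp
    qed
    ultimately show ?thesis using f_inv_into_f by metis
  qed
  have "acts q (- D) T' T" by (rule acts_sym[OF q act])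
  then consider "?F T' = divisor_class (D + bernardi_divisor e T)"
    | "?F T = divisor_class (- D + bernardi_divisor e T')"
    using key[OF D act] key[OF Div0_uminus[OF D]] ne by metis
  then show ?thesis
  proof cases
    case 1
    then show ?thesis by (simp add: divisor_class_eq algebra_simps)
  next
    case 2
    then have "bernardi_divisor e T - (- D + bernardi_divisor e T') \<in> Prin" by (simp add: divisor_class_eq)
    from Prin_uminus[OF this] show ?thesis by (simp add: algebra_simps)
  qed
qed

section \<open>The tour runs through all arcs in one cycle\<close>

lemma succ_inj: "inj_on succ (arcs G)"
proof (rule inj_onI)
  fix x y assume xy: "x \<in> arcs G" "y \<in> arcs G" "succ x = succ y"
  have "tail G (succ z) = tail G z" if "z \<in> arcs G" for z using succ_out[of z "tail G z"] that by simp
  then have t: "tail G x = tail G y" using xy by metis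
  let ?d = "card (out_arcs G (tail G x))"
  have x: "x \<in> out_arcs G (tail G x)" and y: "y \<in> out_arcs G (tail G x)" using xy t by auto
  then have "?d \<noteq> 0" by auto
  then obtain k where k: "?d = Suc k" using not0_implies_Suc by blast
  have "x = (succ ^^ k) (succ x)" "y = (succ ^^ k) (succ y)"
    using succ_enum(2)[OF x] succ_enum(2)[OF y] unfolding k by (simp_all add: funpow_swap1)
  then show "x = y" using xy(3) by simp
qed

lemma tour_step_arcs:
  assumes "T \<subseteq> arcs G" "x \<in> arcs G" shows "tour_step T x \<in> arcs G"
    and "tail G (tour_step T x) = (if x \<in> T then head G x else tail G x)"
proof -
  have "succ x \<in> out_arcs G (tail G x)" "succ (arev x) \<in> out_arcs G (head G x)"
    using assms succ_out[of x "tail G x"] succ_out[of "arev x" "head G x"] by auto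
  then show "tour_step T x \<in> arcs G" "tail G (tour_step T x) = (if x \<in> T then head G x else tail G x)"
    by (auto simp: tour_step_def)
qed

lemma tour_step_inj:
  assumes "T \<subseteq> arcs G" "arev ` T \<subseteq> T" shows "inj_on (tour_step T) (arcs G)"
proof (rule inj_onI)
  fix x y assume xy: "x \<in> arcs G" "y \<in> arcs G" "tour_step T x = tour_step T y"
  let ?s = "\<lambda>x. if x \<in> T then arev x else x"
  have "succ (?s x) = succ (?s y)" using xy(3) by (auto simp: tour_step_def split: if_splits)
  moreover have "?s x \<in> arcs G" "?s y \<in> arcs G" using xy by auto
  ultimately have "?s x = ?s y" by (rule inj_onD[OF succ_inj])
  moreover have "arev z \<in> T" if "z \<in> T" for z using that assms(2) by blast
  ultimately show "x = y" by (metis arev_arev)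
qed

lemma rotor_tree_out:
  assumes r: "rooted q \<sigma>" and w: "w \<in> verts G" "w \<noteq> q"
    and y: "y \<in> out_arcs G w" "y \<in> rotor_tree q \<sigma>" "y \<noteq> \<sigma> w"
  obtains u where "u \<in> verts G" "u \<noteq> q" "y = arev (\<sigma> u)" "head G (\<sigma> u) = w" "u \<noteq> w"
proof -
  obtain u where u: "u \<in> verts G" "u \<noteq> q" "y = \<sigma> u \<or> y = arev (\<sigma> u)"
    using y(2) by (auto simp: rotor_tree_mem)
  note ru = rootedD[OF r u(1,2)]
  have ne: "y \<noteq> \<sigma> u" using ru(2) y(1,3) by auto
  then have e: "y = arev (\<sigma> u)" using u(3) by simp
  then have h: "head G (\<sigma> u) = w" using y(1) ru by auto
  have "u \<noteq> w" using parent_notin_desc[OF r u(1,2)] h desc_self[of w q \<sigma>] by auto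
  then show thesis using that u e h by blast
qed

text \<open>Having crossed into the subtree at \<open>w\<close>, the tour walks round it and comes
  back to the rotor of \<open>w\<close>. The induction is on the size of the subtree: each child
  edge met at \<open>w\<close> starts an excursion that returns to that edge, and the tour then goes
  on to the next edge at \<open>w\<close>.\<close>

lemma tour_excursion:
  assumes r: "rooted q \<sigma>" and w: "w \<in> verts G" "w \<noteq> q"
  shows "\<exists>n. (tour_step (rotor_tree q \<sigma>) ^^ n) (arev (\<sigma> w)) = \<sigma> w"
  using w
proof (induction "card (desc q \<sigma> w)" arbitrary: w rule: less_induct)
  case less
  let ?T = "rotor_tree q \<sigma>" and ?s = "\<sigma> w" and ?d = "card (out_arcs G w)"
  let ?t = "tour_step ?T"
  have s: "?s \<in> out_arcs G w" using rootedD[OF r less.prems] by simp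
  have sT: "arev ?s \<in> ?T" using less.prems by (auto simp: rotor_tree_mem)
  \<comment> \<open>Edges at \<open>w\<close> are counted from the successor of the rotor, so
    \<open>k = ?d - 1\<close> is the rotor itself.\<close>
  have "\<exists>n. (?t ^^ n) (arev ?s) = (succ ^^ Suc k) ?s" if "k < ?d" for k
    using that
  proof (induction k)
    case 0
    then show ?case using sT by (intro exI[of _ 1]) (simp add: tour_step_def)
  next
    case (Suc k)
    let ?y = "(succ ^^ Suc k) ?s"
    have y: "?y \<in> out_arcs G w" by (rule succ_funpow_out[OF s])
    have ys: "?y \<noteq> ?s"
    proof
      assume "?y = ?s"
      then have "(\<lambda>i. (succ ^^ i) ?s) (Suc k) = (\<lambda>i. (succ ^^ i) ?s) 0" by simp
      then have "Suc k = 0"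
        by (rule inj_onD[OF bij_betw_imp_inj_on[OF succ_enum(1)[OF s]]]) (use Suc.prems in auto)
      then show False by simp
    qed
    have "\<exists>n. (?t ^^ n) ?y = succ ?y"
    proof (cases "?y \<in> ?T")
      case False
      then show ?thesis by (intro exI[of _ 1]) (simp add: tour_step_def)
    next
      case True
      obtain u where u: "u \<in> verts G" "u \<noteq> q" "?y = arev (\<sigma> u)" "head G (\<sigma> u) = w" "u \<noteq> w"
        by (rule rotor_tree_out[OF r less.prems y True ys])
      have "u \<in> desc q \<sigma> w" using desc_parent[OF u(1,2,5)] u(4) desc_self by metis
      then have "desc q \<sigma> u \<subseteq> desc q \<sigma> w" by (auto simp: desc_def intro: rtrancl_trans)
      moreover have "w \<notin> desc q \<sigma> u" using parent_notin_desc[OF r u(1,2)] u(4) by simp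
      ultimately have "desc q \<sigma> u \<subset> desc q \<sigma> w" using desc_self by blast
      moreover have "finite (desc q \<sigma> w)"
        using desc_subset[OF less.prems(1)] finite_verts finite_subset by blast
      ultimately have "card (desc q \<sigma> u) < card (desc q \<sigma> w)" by (rule psubset_card_mono[rotated])
      then have "\<exists>n. (?t ^^ n) ?y = \<sigma> u" using less.hyps u(1,2,3) by metis
      moreover have "?t (\<sigma> u) = succ ?y" using u by (auto simp: tour_step_def rotor_tree_mem)
      then have "\<exists>n. (?t ^^ n) (\<sigma> u) = succ ?y" by (intro exI[of _ 1]) simp
      ultimately show ?thesis by (rule funpow_reach_trans)
    qed
    moreover have "\<exists>n. (?t ^^ n) (arev ?s) = ?y" using Suc by simp
    ultimately have "\<exists>n. (?t ^^ n) (arev ?s) = succ ?y" using funpow_reach_trans by metis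
    then show ?case by simp
  qed
  moreover have "0 < ?d" using s by (auto simp: card_gt_0_iff)
  ultimately have "\<exists>n. (?t ^^ n) (arev ?s) = (succ ^^ ?d) ?s" by (metis Suc_pred' lessI)
  then show ?case using succ_enum(2)[OF s] by simp
qed

text \<open>From any arc \<open>x\<close> the tour eventually examines \<open>succ x\<close>, either
  at once or after reaching the other end of a tree edge. So all arcs at one vertex share an orbit,
  and the tree edges link the vertices to each other.\<close>

lemma tour_cyclic:
  assumes r: "rooted q \<sigma>" and e: "e \<in> out_arcs G q"
  shows "cyclic_on (tour_step (rotor_tree q \<sigma>)) (arcs G)"
proof -
  let ?T = "rotor_tree q \<sigma>"
  let ?t = "tour_step ?T"
  have T: "?T \<subseteq> arcs G" "arev ` ?T \<subseteq> ?T" using rotor_tree_arcs[OF r] rotor_tree_sym by auto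
  have fin: "finite (arcs G)" by simp
  have inj: "inj_on ?t (arcs G)" by (rule tour_step_inj[OF T])
  have img: "?t ` arcs G \<subseteq> arcs G" using tour_step_arcs(1)[OF T(1)] by blast
  have exc: "\<exists>n. (?t ^^ n) x = succ x" if x: "x \<in> arcs G" for x
  proof (cases "x \<in> ?T")
    case False
    then show ?thesis by (intro exI[of _ 1]) (simp add: tour_step_def)
  next
    case True
    then obtain u where u: "u \<in> verts G" "u \<noteq> q" "x = \<sigma> u \<or> x = arev (\<sigma> u)" by (auto simp: rotor_tree_mem)
    have ex: "\<exists>n. (?t ^^ n) (arev (\<sigma> u)) = \<sigma> u" by (rule tour_excursion[OF r u(1,2)])
    \<comment> \<open>If \<open>x\<close> is \<open>\<sigma> u\<close>, the excursion has to be read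
      backwards. An injective map of a finite set into itself has cyclic orbits, so reachability is
      symmetric.\<close>
    have "\<exists>n. (?t ^^ n) x = arev x"
      using u(3) ex funpow_reach_sym[OF fin inj img _ ex] rootedD(1)[OF r u(1,2)] by auto
    moreover have "?t (arev x) = succ x" using True T by (auto simp: tour_step_def)
    then have "\<exists>n. (?t ^^ n) (arev x) = succ x" by (intro exI[of _ 1]) simp
    ultimately show ?thesis by (rule funpow_reach_trans)
  qed
  have exk: "\<exists>n. (?t ^^ n) x = (succ ^^ k) x" if x: "x \<in> out_arcs G w" for x w k
  proof (induction k)
    case 0
    then show ?case by (intro exI[of _ 0]) simp
  next
    case (Suc k)
    have "(succ ^^ k) x \<in> arcs G" using succ_funpow_out[OF x, of k] by simp
    then show ?case using funpow_reach_trans[OF Suc exc] by simp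
  qed
  have same: "\<exists>n. (?t ^^ n) x = y" if "x \<in> out_arcs G w" "y \<in> out_arcs G w" for x y w
    using succ_reach[OF that] exk[OF that(1)] by metis
  have reach: "\<forall>x\<in>out_arcs G w. \<exists>n. (?t ^^ n) e = x" if "(w, q) \<in> (follow q \<sigma>)\<^sup>*" for w
    using that
  proof (induction rule: converse_rtrancl_induct)
    case base
    then show ?case using same[OF e] by blast
  next
    case (step w u)
    then have w: "w \<in> verts G" "w \<noteq> q" "u = head G (\<sigma> w)" by (auto simp: follow_iff)
    note rw = rootedD[OF r w(1,2)]
    have "arev (\<sigma> w) \<in> out_arcs G u" using rw w(3) by simp
    then have 1: "\<exists>n. (?t ^^ n) e = arev (\<sigma> w)" using step.IH by blast
    have 2: "\<exists>n. (?t ^^ n) e = \<sigma> w" by (rule funpow_reach_trans[OF 1 tour_excursion[OF r w(1,2)]])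
    have "\<sigma> w \<in> out_arcs G w" using rw by simp
    then show ?case using funpow_reach_trans[OF 2 same] by blast
  qed
  have e': "e \<in> arcs G" using e by simp
  have "arcs G = Orbits.orbit ?t e"
  proof (intro equalityI subsetI)
    fix x assume x: "x \<in> arcs G"
    have "(tail G x, q) \<in> (follow q \<sigma>)\<^sup>*"
      using r x by (cases "tail G x = q") (auto simp: rooted_def)
    then have "\<forall>y\<in>out_arcs G (tail G x). \<exists>n. (?t ^^ n) e = y" by (rule reach)
    then obtain n where "(?t ^^ n) e = x" using x by force
    moreover obtain p where "0 < p" "(?t ^^ p) e = e" using funpow_period[OF fin inj img e'] by blast
    ultimately have "(?t ^^ (n + p)) e = x" "0 < n + p" by (auto simp: funpow_add)
    then show "x \<in> Orbits.orbit ?t e" by (auto simp: orbit_altdef)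
  next
    fix x assume "x \<in> Orbits.orbit ?t e"
    then show "x \<in> arcs G" by induction (use img e' in auto)
  qed
  then show ?thesis using e' unfolding cyclic_on_def by blast
qed

section \<open>The times at which the tour examines the arcs\<close>

context
  fixes q \<sigma> e
  assumes r: "rooted q \<sigma>" and e: "e \<in> out_arcs G q"
begin

abbreviation (input) "tT \<equiv> rotor_tree q \<sigma>"
abbreviation (input) "tp \<equiv> pos (tour_step (rotor_tree q \<sigma>)) e"

lemma tour_pos:
  assumes "x \<in> arcs G"
  shows "tp x < card (arcs G)" "(tour_step tT ^^ tp x) e = x"
  using funpow_pos[OF tour_cyclic[OF r e]] assms e by auto

lemma tour_pos_Suc:
  assumes "x \<in> arcs G" "tour_step tT x \<noteq> e"
  shows "tp (tour_step tT x) = Suc (tp x)"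
  using pos_Suc[OF tour_cyclic[OF r e]] assms e by auto

lemma tour_pos_inj:
  assumes "x \<in> arcs G" "y \<in> arcs G"
  shows "tp x = tp y \<longleftrightarrow> x = y"
  using pos_eq_iff[OF tour_cyclic[OF r e]] assms e by auto

lemma tour_funpow_arcs: "(tour_step tT ^^ i) e \<in> arcs G"
  using cyclic_on_funpow_in[OF tour_cyclic[OF r e]] e by auto

text \<open>By \<open>desc_crossing\<close> the tour enters the subtree only at
  \<open>arev (\<sigma> w)\<close> and leaves it only at \<open>\<sigma> w\<close>, so it visits the
  subtree during one stretch of time. An arc belongs to the vertex from which it is examined, which
  is why \<open>arev (\<sigma> w)\<close> is excluded and \<open>\<sigma> w\<close> is
  included.\<close>

lemma tour_inside_desc:
  assumes w: "w \<in> verts G" "w \<noteq> q" and x: "x \<in> arcs G"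
  shows "tail G x \<in> desc q \<sigma> w \<longleftrightarrow> tp (arev (\<sigma> w)) < tp x \<and> tp x \<le> tp (\<sigma> w)"
  using x
proof (induction "tp x" arbitrary: x rule: less_induct)
  case less
  let ?t = "tour_step tT" and ?U = "desc q \<sigma> w"
  note rw = rootedD[OF r w]
  have T: "tT \<subseteq> arcs G" by (rule rotor_tree_arcs[OF r])
  have sT: "\<sigma> w \<in> tT" "arev (\<sigma> w) \<in> tT" using w by (auto simp: rotor_tree_mem)
  have par: "head G (\<sigma> w) \<notin> ?U" by (rule parent_notin_desc[OF r w])
  show ?case
  proof (cases "tp x")
    case 0
    then have "x = e" using tour_pos(2)[OF less.prems] by simp
    then show ?thesis using 0 e root_notin_desc[OF w(2)] by simp
  next
    case (Suc i)
    let ?y = "(?t ^^ i) e"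
    have y: "?y \<in> arcs G" by (rule tour_funpow_arcs)
    have xy: "x = ?t ?y" using tour_pos(2)[OF less.prems] Suc by simp
    have "i < card (arcs G)" using tour_pos(1)[OF less.prems] Suc by simp
    then have py: "tp ?y = i"
      using pos_funpow[OF tour_cyclic[OF r e], of e] e by simp
    have IH: "tail G z \<in> ?U \<longleftrightarrow> tp (arev (\<sigma> w)) < tp z \<and> tp z \<le> tp (\<sigma> w)" if "z \<in> arcs G" "tp z \<le> i" for z
      using less.hyps[of z] that Suc by simp
    have tx: "tail G x = (if ?y \<in> tT then head G ?y else tail G ?y)"
      unfolding xy by (rule tour_step_arcs(2)[OF T y])
    consider (enter) "?y = arev (\<sigma> w)" | (leave) "?y = \<sigma> w" | (other) "?y \<noteq> \<sigma> w" "?y \<noteq> arev (\<sigma> w)" by blast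
    then show ?thesis
    proof cases
      case enter
      have "tail G x \<in> ?U" using tx sT enter rw desc_self by simp
      \<comment> \<open>By the induction hypothesis an earlier examination of
        \<open>\<sigma> w\<close> would come after that of \<open>arev (\<sigma> w)\<close>, which
        happens only at time \<open>i\<close>.\<close>
      moreover have "tp (\<sigma> w) > i"
      proof (rule ccontr)
        assume "\<not> tp (\<sigma> w) > i"
        then have "tp (arev (\<sigma> w)) < tp (\<sigma> w)" "tp (\<sigma> w) \<le> i"
          using IH[of "\<sigma> w"] rw desc_self by simp_all
        then show False using py enter by simp
      qed
      ultimately show ?thesis using Suc py enter by simp
    next
      case leave
      have "tail G x \<notin> ?U" using tx sT leave par by simp
      then show ?thesis using Suc py leave by simp
    next
      case other
      have "tail G x \<in> ?U \<longleftrightarrow> tail G ?y \<in> ?U"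
        using tx desc_crossing[OF r w, of ?y] other by auto
      also have "\<dots> \<longleftrightarrow> tp (arev (\<sigma> w)) < i \<and> i \<le> tp (\<sigma> w)"
        using IH[OF y] py by simp
      also have "\<dots> \<longleftrightarrow> tp (arev (\<sigma> w)) < Suc i \<and> Suc i \<le> tp (\<sigma> w)"
        using tour_pos_inj[OF y, of "\<sigma> w"] tour_pos_inj[OF y, of "arev (\<sigma> w)"] other py rw by auto
      finally show ?thesis using Suc by simp
    qed
  qed
qed

lemma tour_enter_before_leave:
  assumes "w \<in> verts G" "w \<noteq> q"
  shows "tp (arev (\<sigma> w)) < tp (\<sigma> w)"
  using tour_inside_desc[OF assms, of "\<sigma> w"] rootedD[OF r assms] desc_self by simp

text \<open>From one edge at \<open>v\<close> the tour passes to the next directly or after an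
  excursion into a child subtree. Since \<open>e\<close> is an edge at \<open>q\<close>, the time
  never restarts at \<open>v\<close>.\<close>

lemma tour_order_Suc:
  assumes v: "v \<in> verts G" "v \<noteq> q" and k: "0 < k" "k < card (out_arcs G v)"
  shows "tp ((succ ^^ k) (\<sigma> v)) < tp ((succ ^^ Suc k) (\<sigma> v))"
proof -
  let ?x = "(succ ^^ k) (\<sigma> v)"
  have s: "\<sigma> v \<in> out_arcs G v" using rootedD[OF r v] by simp
  have x: "?x \<in> out_arcs G v" and sx: "succ ?x \<in> out_arcs G v"
    using succ_funpow_out[OF s] succ_out by blast+
  have se: "succ ?x \<noteq> e" using sx e v by auto
  have ne: "?x \<noteq> \<sigma> v"
  proof
    assume "?x = \<sigma> v"
    then have "(\<lambda>i. (succ ^^ i) (\<sigma> v)) k = (\<lambda>i. (succ ^^ i) (\<sigma> v)) 0" by simp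
    then have "k = 0"
      by (rule inj_onD[OF bij_betw_imp_inj_on[OF succ_enum(1)[OF s]]]) (use k in auto)
    then show False using k by simp
  qed
  show ?thesis
  proof (cases "?x \<in> tT")
    case False
    then have "tour_step tT ?x = succ ?x" by (simp add: tour_step_def)
    then show ?thesis using tour_pos_Suc[of ?x] x se by simp
  next
    case True
    obtain u where u: "u \<in> verts G" "u \<noteq> q" "?x = arev (\<sigma> u)" "head G (\<sigma> u) = v" "u \<noteq> v"
      by (rule rotor_tree_out[OF r v x True ne])
    have "tour_step tT (\<sigma> u) = succ ?x" using u by (auto simp: tour_step_def rotor_tree_mem)
    then have "tp (succ ?x) = Suc (tp (\<sigma> u))"
      using tour_pos_Suc[of "\<sigma> u"] rootedD[OF r u(1,2)] se by simp
    then show ?thesis using tour_enter_before_leave[OF u(1,2)] u(3) by simp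
  qed
qed

text \<open>The case \<open>l = card (out_arcs G v)\<close> is the rotor of \<open>v\<close>, which
  the tour examines last there.\<close>

lemma tour_order:
  assumes v: "v \<in> verts G" "v \<noteq> q" and kl: "0 < k" "k < l" "l \<le> card (out_arcs G v)"
  shows "tp ((succ ^^ k) (\<sigma> v)) < tp ((succ ^^ l) (\<sigma> v))"
  using kl(2,3)
proof (induction l)
  case (Suc l)
  show ?case
  proof (cases "k = l")
    case True
    then show ?thesis using tour_order_Suc[OF v, of l] kl(1) Suc.prems by simp
  next
    case False
    then have "tp ((succ ^^ k) (\<sigma> v)) < tp ((succ ^^ l) (\<sigma> v))" using Suc by simp
    also have "\<dots> < tp ((succ ^^ Suc l) (\<sigma> v))" using tour_order_Suc[OF v, of l] kl(1) False Suc.prems by simp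
    finally show ?thesis .
  qed
qed simp

text \<open>A non-tree edge gets its chip at the end from which it is passed over first, that is, at
  the tail of its arc with the smaller time.\<close>

lemma lookup_bernardi:
  "Poly_Mapping.lookup (bernardi_divisor e tT) b =
    (\<Sum>x\<in>out_arcs G b. if x \<notin> tT \<and> tp x < tp (arev x) then 1 else 0)"
proof -
  let ?d = "\<lambda>i. (tour_step tT ^^ i) e" and ?m = "card (arcs G)"
  have bij: "bij_betw ?d {..<?m} (arcs G)"
    using cyclic_on_enum(1)[OF tour_cyclic[OF r e]] e by simp
  have pd: "tp (?d i) = i" if "i < ?m" for i
    using pos_funpow[OF tour_cyclic[OF r e]] that e by simp
  let ?P = "\<lambda>i. ?d i \<notin> tT \<and> (\<forall>j<i. ?d j \<notin> edge (?d i))"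
  let ?f = "\<lambda>x. if x \<notin> tT \<and> tp x < tp (arev x) \<and> tail G x = b then 1 else (0::int)"
  have P: "?P i \<longleftrightarrow> ?d i \<notin> tT \<and> tp (?d i) < tp (arev (?d i))" if i: "i < ?m" for i
  proof -
    let ?x = "?d i"
    have x: "?x \<in> arcs G" "arev ?x \<in> arcs G" using tour_funpow_arcs by simp_all
    have "(\<forall>j<i. ?d j \<notin> edge ?x) \<longleftrightarrow> (\<forall>j<i. j \<noteq> tp (arev ?x))"
    proof -
      have "?d j \<in> edge ?x \<longleftrightarrow> j = tp (arev ?x)" if j: "j < i" for j
      proof -
        have "?d j \<noteq> ?x" using pd[of j] pd[of i] i j by (metis less_trans nat_neq_iff)
        moreover have "?d j = arev ?x \<longleftrightarrow> j = tp (arev ?x)"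
          using pd[of j] tour_pos(2)[OF x(2)] i j by auto
        ultimately show ?thesis by (simp add: mem_edge_iff)
      qed
      then show ?thesis by blast
    qed
    also have "\<dots> \<longleftrightarrow> i \<le> tp (arev ?x)" by (auto simp: not_less[symmetric])
    also have "\<dots> \<longleftrightarrow> tp ?x < tp (arev ?x)"
      using pd[OF i] tour_pos_inj[OF x] arev_neq[OF x(1)] by auto
    finally show ?thesis by blast
  qed
  have "Poly_Mapping.lookup (bernardi_divisor e tT) b =
    (\<Sum>i | i < ?m \<and> ?P i. if tail G (?d i) = b then 1 else 0)"
    unfolding bernardi_divisor_def Let_def
    by (simp add: Poly_Mapping.lookup_sum eq_commute[of b])
  also have "\<dots> = (\<Sum>i<?m. ?f (?d i))"
    by (rule sum.mono_neutral_cong_left) (use P in auto)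
  also have "\<dots> = (\<Sum>x\<in>arcs G. ?f x)" by (rule sum.reindex_bij_betw[OF bij])
  also have "\<dots> = (\<Sum>x\<in>out_arcs G b. if x \<notin> tT \<and> tp x < tp (arev x) then 1 else 0)"
    unfolding sum_out_arcs by (rule sum.cong) auto
  finally show ?thesis .
qed

end

subsection \<open>Exchanging the rotor of one vertex\<close>

lemma succ_funpow_eq_iff:
  assumes "s \<in> out_arcs G w" "i < card (out_arcs G w)" "j < card (out_arcs G w)"
  shows "(succ ^^ i) s = (succ ^^ j) s \<longleftrightarrow> i = j"
  using bij_betw_imp_inj_on[OF succ_enum(1)[OF assms(1)]] assms(2,3) by (auto dest: inj_onD)

text \<open>The picture: \<open>v\<close> is a cut vertex behind which the subtree at
  \<open>z\<close> hangs. Around \<open>v\<close>, starting from the old rotor \<open>a\<close>,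
  comes first the new rotor \<open>a'\<close> and only later the edge by which both tours enter the
  subtree.\<close>

context
  fixes q v :: 'v and \<sigma> \<sigma>' :: "'v \<Rightarrow> 'a" and a a' :: 'a and r s :: nat and z :: 'v
  assumes rt: "rooted q \<sigma>" and rt': "rooted q \<sigma>'" and \<sigma>': "\<sigma>' = \<sigma>(v := a')"
    and v: "v \<in> verts G" "v \<noteq> q" and a: "\<sigma> v = a"
    and r: "0 < r" "r < s" "s < card (out_arcs G v)" and a': "a' = (succ ^^ r) a"
    and z: "z \<in> verts G" "z \<noteq> q" "z \<noteq> v" "head G (\<sigma> z) = v"
    and s: "arev (\<sigma> z) = (succ ^^ s) a"
    and K: "\<And>x. x \<in> arcs G \<Longrightarrow> tail G x \<in> desc q \<sigma> z \<Longrightarrow> head G x \<in> desc q \<sigma> z \<or> head G x = v"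
begin

abbreviation (input) "KK \<equiv> desc q \<sigma> z"

lemma moved_rotor_out: "a \<in> out_arcs G v"
  using rootedD[OF rt v] a by simp

text \<open>In both configurations \<open>v\<close> is the parent of \<open>z\<close>, so no descent
  to \<open>z\<close> passes \<open>v\<close>, and changing the rotor of \<open>v\<close> leaves the
  subtree unchanged.\<close>

lemma moved_rotor_desc:
  shows "v \<notin> KK" "desc q \<sigma>' z = KK" "head G a \<notin> KK" "head G a' \<notin> KK"
proof -
  have z': "\<sigma>' z = \<sigma> z" using z \<sigma>' by simp
  show vK: "v \<notin> KK" using parent_notin_desc[OF rt z(1,2)] z(4) by simp
  have vK': "v \<notin> desc q \<sigma>' z" using parent_notin_desc[OF rt' z(1,2)] z(4) z' by simp
  have 1: "desc q \<tau> z \<subseteq> desc q \<tau>' z"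
    if "v \<notin> desc q \<tau> z" "\<And>w. w \<noteq> v \<Longrightarrow> \<tau> w = \<tau>' w" for \<tau> \<tau>'
  proof
    fix u assume "u \<in> desc q \<tau> z"
    then have "(u, z) \<in> (follow q \<tau>)\<^sup>*" by (simp add: desc_def)
    then show "u \<in> desc q \<tau>' z"
    proof (induction rule: converse_rtrancl_induct)
      case (step u w)
      then have u: "u \<in> desc q \<tau> z" unfolding desc_def by (blast intro: converse_rtrancl_into_rtrancl)
      then have "u \<noteq> v" using that(1) by blast
      then have "(u, w) \<in> follow q \<tau>'" using step(1) that(2) by (simp add: follow_iff)
      then show ?case using step(3) unfolding desc_def by (blast intro: converse_rtrancl_into_rtrancl)
    qed (rule desc_self)
  qed
  show eq: "desc q \<sigma>' z = KK"
    using 1[of \<sigma> \<sigma>'] 1[of \<sigma>' \<sigma>] vK vK' \<sigma>' by auto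
  show "head G a \<notin> KK" using desc_parent[OF v, of z \<sigma>] vK z(3) a by auto
  show "head G a' \<notin> KK" using desc_parent[OF v, of z \<sigma>'] vK' z(3) \<sigma>' unfolding eq[symmetric] by auto
qed

lemma moved_rotor_tree_iff:
  assumes "x \<in> arcs G" "tail G x \<in> KK \<or> head G x \<in> KK"
  shows "x \<in> rotor_tree q \<sigma>' \<longleftrightarrow> x \<in> rotor_tree q \<sigma>"
proof -
  have "a \<in> arcs G" "tail G a = v" using moved_rotor_out by auto
  moreover have "a' \<in> arcs G" "tail G a' = v"
    using succ_funpow_out[OF moved_rotor_out, of r] a' by auto
  ultimately have ne: "x \<noteq> a" "x \<noteq> arev a" "x \<noteq> a'" "x \<noteq> arev a'"
    using assms(2) moved_rotor_desc by (metis head_arev tail_arev)+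
  show ?thesis
    unfolding rotor_tree_mem
  proof (rule bex_cong[OF refl])
    fix w assume "w \<in> verts G - {q}"
    show "(x = \<sigma>' w \<or> x = arev (\<sigma>' w)) \<longleftrightarrow> (x = \<sigma> w \<or> x = arev (\<sigma> w))"
    proof (cases "w = v")
      case True
      then have "\<sigma>' w = a'" "\<sigma> w = a" using \<sigma>' a by simp_all
      then show ?thesis using ne by simp
    next
      case False
      then show ?thesis using \<sigma>' by simp
    qed
  qed
qed

text \<open>Both tours enter \<open>KK\<close> through \<open>arev (\<sigma> z)\<close> and stay there until \<open>\<sigma> z\<close>; in between the trees agree.\<close>

lemma moved_rotor_block:
  assumes e: "e \<in> out_arcs G q" and y: "y \<in> arcs G" "tail G y \<in> KK"
  shows "pos (tour_step (rotor_tree q \<sigma>')) e y - pos (tour_step (rotor_tree q \<sigma>')) e (arev (\<sigma> z)) =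
      pos (tour_step (rotor_tree q \<sigma>)) e y - pos (tour_step (rotor_tree q \<sigma>)) e (arev (\<sigma> z))"
proof -
  let ?T = "rotor_tree q \<sigma>" and ?T' = "rotor_tree q \<sigma>'"
  let ?p = "pos (tour_step ?T) e" and ?p' = "pos (tour_step ?T') e"
  let ?\<tau> = "arev (\<sigma> z)"
  let ?d = "\<lambda>i. (tour_step ?T ^^ i) e"
  note rz = rootedD[OF rt z(1,2)]
  have \<tau>: "?\<tau> \<in> arcs G" "head G ?\<tau> \<in> KK" using rz desc_self by auto
  have inside: "tail G x \<in> KK \<longleftrightarrow> ?p ?\<tau> < ?p x \<and> ?p x \<le> ?p (\<sigma> z)" if "x \<in> arcs G" for x
    by (rule tour_inside_desc[OF rt e z(1,2) that])
  have pd: "?p (?d i) = i" if "i < card (arcs G)" for i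
    using pos_funpow[OF tour_cyclic[OF rt e]] that e by simp
  have d: "?d (?p x) = x" if "x \<in> arcs G" for x by (rule tour_pos(2)[OF rt e that])
  have L: "?p (\<sigma> z) < card (arcs G)" by (rule tour_pos(1)[OF rt e rz(1)])
  have step: "?p' (?d (?p ?\<tau> + j)) = ?p' ?\<tau> + j" if "?p ?\<tau> + j \<le> ?p (\<sigma> z)" for j
    using that
  proof (induction j)
    case 0
    then show ?case using d[OF \<tau>(1)] by simp
  next
    case (Suc j)
    let ?x = "?d (?p ?\<tau> + j)" and ?y = "?d (?p ?\<tau> + Suc j)"
    have x: "?x \<in> arcs G" and y: "?y \<in> arcs G" by (rule tour_funpow_arcs[OF rt e])+
    have "tail G ?y \<in> KK" using inside[OF y] pd[of "?p ?\<tau> + Suc j"] Suc.prems L by simp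
    then have ye: "?y \<noteq> e" using e root_notin_desc[OF z(2)] by auto
    have "tail G ?x \<in> KK \<or> head G ?x \<in> KK"
    proof (cases j)
      case 0
      then show ?thesis using d[OF \<tau>(1)] \<tau>(2) by simp
    next
      case (Suc i)
      then show ?thesis using inside[OF x] pd[of "?p ?\<tau> + j"] Suc.prems L by simp
    qed
    then have "tour_step ?T' ?x = tour_step ?T ?x"
      using moved_rotor_tree_iff[OF x] by (simp add: tour_step_def)
    then have "tour_step ?T' ?x = ?y" by simp
    then have "?p' ?y = Suc (?p' ?x)" using tour_pos_Suc[OF rt' e x] ye by metis
    then show ?case using Suc by simp
  qed
  have py: "?p ?\<tau> < ?p y" "?p y \<le> ?p (\<sigma> z)" using inside[OF y(1)] y(2) by auto
  have "?p' y = ?p' ?\<tau> + (?p y - ?p ?\<tau>)" using step[of "?p y - ?p ?\<tau>"] py d[OF y(1)] by simp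
  then show ?thesis by simp
qed

text \<open>Both tours examine the edges inside the subtree in the same order. A non-tree edge from
  the subtree to \<open>v\<close> has its chip in the subtree iff the tour enters the subtree before
  it examines this edge at \<open>v\<close>. For an edge at position \<open>k\<close> from
  \<open>a\<close> this means \<open>s < k\<close> in the old tour, whose order at \<open>v\<close>
  begins after \<open>a\<close>, but \<open>s < k\<close> or \<open>k < r\<close> in the new tour,
  whose order begins after \<open>a'\<close>. The difference counts the positions strictly between
  the two rotors.\<close>

lemma bernardi_moved_rotor:
  assumes e: "e \<in> out_arcs G q" and b: "b \<in> KK"
  shows "Poly_Mapping.lookup (bernardi_divisor e (rotor_tree q \<sigma>')) b
      - Poly_Mapping.lookup (bernardi_divisor e (rotor_tree q \<sigma>)) b
    = (\<Sum>x\<in>out_arcs G b. if \<exists>k\<in>{1..<r}. arev x = (succ ^^ k) a then 1 else 0)"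
proof -
  let ?T = "rotor_tree q \<sigma>" and ?T' = "rotor_tree q \<sigma>'"
  let ?p = "pos (tour_step ?T) e" and ?p' = "pos (tour_step ?T') e"
  let ?\<tau> = "arev (\<sigma> z)" and ?d = "card (out_arcs G v)"
  let ?J = "\<lambda>y. \<exists>k\<in>{1..<r}. y = (succ ^^ k) a"
  note rz = rootedD[OF rt z(1,2)]
  note ao = moved_rotor_out
  have z': "\<sigma>' z = \<sigma> z" and v': "\<sigma>' v = a'" using z \<sigma>' by simp_all
  have inside: "tail G x \<in> KK \<longleftrightarrow> ?p ?\<tau> < ?p x \<and> ?p x \<le> ?p (\<sigma> z)" if "x \<in> arcs G" for x
    by (rule tour_inside_desc[OF rt e z(1,2) that])
  have inside': "tail G x \<in> KK \<longleftrightarrow> ?p' ?\<tau> < ?p' x \<and> ?p' x \<le> ?p' (\<sigma> z)" if "x \<in> arcs G" for x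
    using tour_inside_desc[OF rt' e z(1,2) that] unfolding moved_rotor_desc z' .
  have ord: "?p ((succ ^^ k) a) < ?p ((succ ^^ l) a)" if "0 < k" "k < l" "l \<le> ?d" for k l
    using tour_order[OF rt e v that] a by simp
  have ord': "?p' ((succ ^^ k) a') < ?p' ((succ ^^ l) a')" if "0 < k" "k < l" "l \<le> ?d" for k l
    using tour_order[OF rt' e v that] v' by simp
  \<comment> \<open>Positions counted from \<open>a\<close> are converted into positions counted
    from \<open>a'\<close>. Edges before \<open>a'\<close> come only after a wrap, at
    \<open>k + ?d - r\<close>.\<close>
  have sh: "(succ ^^ (k - r)) a' = (succ ^^ k) a" if "r \<le> k" for k
    using that unfolding a' by (metis comp_apply funpow_add le_add_diff_inverse2)
  have wrap: "(succ ^^ (k + ?d - r)) a' = (succ ^^ k) a" for k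
  proof -
    have "(succ ^^ (k + ?d - r)) a' = (succ ^^ (k + ?d)) a" by (rule sh) (use r in simp)
    then show ?thesis using succ_enum(2)[OF ao] by (simp add: funpow_add)
  qed
  have "(if x \<notin> ?T' \<and> ?p' x < ?p' (arev x) then 1 else 0) - (if x \<notin> ?T \<and> ?p x < ?p (arev x) then 1 else 0)
    = (if ?J (arev x) then 1 else (0::int))" if x: "x \<in> out_arcs G b" for x
  proof -
    have xa: "x \<in> arcs G" "tail G x = b" "arev x \<in> arcs G" using x by auto
    have TT: "x \<in> ?T' \<longleftrightarrow> x \<in> ?T" using moved_rotor_tree_iff[of x] xa b by simp
    consider "head G x \<in> KK" | "head G x = v" using K[OF xa(1)] xa(2) b by blast
    then show ?thesis
    proof cases
      case 1
      have ta: "tail G (arev x) \<in> KK" "tail G x \<in> KK" using 1 xa b by simp_all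
      have "?p' x < ?p' (arev x) \<longleftrightarrow> ?p x < ?p (arev x)"
        using moved_rotor_block[OF e xa(1) ta(2)] moved_rotor_block[OF e xa(3) ta(1)]
          inside[OF xa(1)] inside[OF xa(3)] inside'[OF xa(1)] inside'[OF xa(3)] ta by linarith
      moreover have "\<not> ?J (arev x)"
      proof
        assume "?J (arev x)"
        then obtain k where "arev x = (succ ^^ k) a" by blast
        then have "tail G (arev x) = v" using succ_funpow_out[OF ao, of k] by simp
        then show False using ta(1) moved_rotor_desc(1) by simp
      qed
      ultimately show ?thesis using TT by simp
    next
      case 2
      have yo: "arev x \<in> out_arcs G v" using 2 xa by simp
      obtain k where k: "k < ?d" "(succ ^^ k) a = arev x" using succ_reach[OF ao yo] by blast
      have hy: "head G (arev x) \<in> KK" using xa b by simp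
      have "k \<noteq> 0" using k hy moved_rotor_desc(3) by (intro notI) simp
      have "k \<noteq> r" using k hy moved_rotor_desc(4) a' by (intro notI) simp
      have J: "?J (arev x) \<longleftrightarrow> k < r"
      proof
        assume "?J (arev x)"
        then obtain l where l: "1 \<le> l" "l < r" "(succ ^^ l) a = (succ ^^ k) a" using k(2) by auto
        then have "l = k" using succ_funpow_eq_iff[OF ao, of l k] k(1) r by simp
        then show "k < r" using l by simp
      next
        assume "k < r"
        then show "?J (arev x)" using k(2) \<open>k \<noteq> 0\<close> by (intro bexI[of _ k]) auto
      qed
      show ?thesis
      proof (cases "x \<in> ?T")
        case True
        \<comment> \<open>The rotor of \<open>z\<close> is the only tree edge out of the subtree.
          Its position \<open>s\<close> lies beyond \<open>r\<close>, so it is not counted.\<close>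
        then have "x = \<sigma> z"
          using desc_crossing(1)[OF rt z(1,2) True] xa(2) b 2 moved_rotor_desc(1) by simp
        then have "(succ ^^ s) a = (succ ^^ k) a" using k(2) s by simp
        then have "s = k" using succ_funpow_eq_iff[OF ao] k(1) r by simp
        then have "\<not> ?J (arev x)" using J r by simp
        then show ?thesis using True TT by simp
      next
        case False
        have "x \<noteq> \<sigma> z" using False z(1,2) by (auto simp: rotor_tree_mem)
        have "k \<noteq> s"
        proof
          assume "k = s"
          then have "arev x = arev (\<sigma> z)" using k(2) s by simp
          then show False using \<open>x \<noteq> \<sigma> z\<close> by (simp add: arev_eq_iff)
        qed
        have yK: "tail G (arev x) \<notin> KK" using xa 2 moved_rotor_desc(1) by simp
        have xK: "tail G x \<in> KK" using xa b by simp
        \<comment> \<open>The arc \<open>x\<close> is examined during the visit to the subtree and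
          \<open>arev x\<close> outside it, so \<open>arev x\<close> comes after \<open>x\<close>
          iff it comes after the entry \<open>?\<tau>\<close>.\<close>
        have 3: "?p x < ?p (arev x) \<longleftrightarrow> ?p ?\<tau> < ?p (arev x)"
          using inside[OF xa(1)] inside[OF xa(3)] yK xK by linarith
        have 4: "?p' x < ?p' (arev x) \<longleftrightarrow> ?p' ?\<tau> < ?p' (arev x)"
          using inside'[OF xa(1)] inside'[OF xa(3)] yK xK by linarith
        have 5: "?p ?\<tau> < ?p (arev x) \<longleftrightarrow> s < k"
          using ord[of s k] ord[of k s] k s r \<open>k \<noteq> 0\<close> \<open>k \<noteq> s\<close> by (cases "s < k") auto
        have 6: "?p' ?\<tau> < ?p' (arev x) \<longleftrightarrow> s < k \<or> k < r"
        proof (cases "k < r")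
          case True
          have "?p' ((succ ^^ (s - r)) a') < ?p' ((succ ^^ (k + ?d - r)) a')"
            by (rule ord') (use True r k in auto)
          then show ?thesis using True wrap[of k] sh[of s] r k s by simp
        next
          case False
          then have kr: "r < k" using \<open>k \<noteq> r\<close> by simp
          have e1: "(succ ^^ (s - r)) a' = ?\<tau>" "(succ ^^ (k - r)) a' = arev x"
            using sh[of s] sh[of k] k s r kr by simp_all
          show ?thesis
          proof (cases "s < k")
            case True
            then have "0 < s - r" "s - r < k - r" "k - r \<le> ?d" using kr r k by linarith+
            from ord'[OF this] show ?thesis using True e1 by simp
          next
            case False
            then have "0 < k - r" "k - r < s - r" "s - r \<le> ?d" using kr r k \<open>k \<noteq> s\<close> by linarith+
            from ord'[OF this] show ?thesis using False kr e1 by simp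
          qed
        qed
        show ?thesis using 3 4 5 6 J False TT r by auto
      qed
    qed
  qed
  then show ?thesis
    unfolding lookup_bernardi[OF rt e] lookup_bernardi[OF rt' e] sum_subtractf[symmetric]
    by (intro sum.cong) auto
qed

end

section \<open>The maximum principle behind a cut vertex\<close>

lemma adj_closed:
  assumes "(u, w) \<in> (adj A)\<^sup>*" "u \<in> S" "\<And>x. x \<in> A \<Longrightarrow> tail G x \<in> S \<Longrightarrow> head G x \<in> S"
  shows "w \<in> S"
  using assms(1) by induction (use assms(2,3) in \<open>auto simp: adj_def\<close>)

text \<open>By the minimum principle \<open>g \<ge> 1\<close> on \<open>K\<close>. If \<open>g\<close> attained a maximum \<open>\<ge> 2\<close>, then the
  bound on \<open>J\<close> would force it to be constant. Hence \<open>g\<close> is a positive constant on \<open>K\<close>, which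
  contradicts \<open>J z = 0\<close>.\<close>

lemma no_doubled_boundary_potential:
  fixes g J :: "'v \<Rightarrow> int"
  assumes K: "finite K" and conn: "\<And>b c. b \<in> K \<Longrightarrow> c \<in> K \<Longrightarrow> (b, c) \<in> (adj {x \<in> arcs G. tail G x \<in> K \<and> head G x \<in> K})\<^sup>*"
    and bd: "\<And>x. x \<in> arcs G \<Longrightarrow> tail G x \<in> K \<Longrightarrow> head G x \<in> K \<or> head G x = v"
    and gv: "g v = 0"
    and J: "\<And>b. b \<in> K \<Longrightarrow> 0 \<le> J b" "\<And>b. b \<in> K \<Longrightarrow> J b \<le> (\<Sum>x\<in>out_arcs G b. if head G x = v then 1 else 0)"
    and lap: "\<And>b. b \<in> K \<Longrightarrow> (\<Sum>x\<in>out_arcs G b. g b - g (head G x)) = 2 * J b"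
    and b1: "b1 \<in> K" "0 < J b1" and z: "z \<in> K" "J z = 0" "x0 \<in> out_arcs G z" "head G x0 = v"
  shows False
proof -
  have all: "A = K" if A: "A \<subseteq> K" "A \<noteq> {}" "\<And>x. x \<in> arcs G \<Longrightarrow> tail G x \<in> A \<Longrightarrow> head G x \<in> K \<Longrightarrow> head G x \<in> A" for A
  proof -
    obtain b where b: "b \<in> A" using A(2) by blast
    have "c \<in> A" if c: "c \<in> K" for c
      by (rule adj_closed[OF conn[of b c] b]) (use A b c in auto)
    then show ?thesis using A(1) by blast
  qed
  have ne: "g ` K \<noteq> {}" "finite (g ` K)" using b1 K by auto
  have pos: "1 \<le> g b" if b: "b \<in> K" for b
  proof (rule ccontr)
    assume "\<not> 1 \<le> g b"
    define m where "m = Min (g ` K)"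
    have m: "m \<le> g c" if "c \<in> K" for c using ne that by (simp add: m_def)
    have m0: "m \<le> 0" using m[OF b] \<open>\<not> 1 \<le> g b\<close> by simp
    \<comment> \<open>A minimum \<open>m \<le> 0 = g v\<close> is not undercut by any neighbour,
      \<open>v\<close> included. As the Laplacian is nonnegative on \<open>K\<close>, all neighbours
      of a minimal vertex have the value \<open>m\<close>; the minimum spreads over
      \<open>K\<close>, which contradicts the positive Laplacian at \<open>b1\<close>.\<close>
    let ?A = "{c \<in> K. g c = m}"
    have zero: "g c - g (head G x) = 0" if c: "c \<in> ?A" and x: "x \<in> out_arcs G c" for c x
    proof -
      have le: "0 \<le> g (head G y) - g c" if "y \<in> out_arcs G c" for y
        using bd[of y] that c m[of "head G y"] m0 gv by auto
      have "(\<Sum>y\<in>out_arcs G c. g (head G y) - g c) = - (\<Sum>y\<in>out_arcs G c. g c - g (head G y))"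
        by (simp add: sum_negf[symmetric])
      also have "\<dots> \<le> 0" using lap[of c] J(1)[of c] c by simp
      finally have "(\<Sum>y\<in>out_arcs G c. g (head G y) - g c) = 0" using sum_nonneg[of "out_arcs G c" "\<lambda>y. g (head G y) - g c"] le by force
      then show ?thesis using le x by (subst (asm) sum_nonneg_eq_0_iff) auto
    qed
    have "m \<in> g ` K" unfolding m_def by (rule Min_in[OF ne(2,1)])
    then have "?A \<noteq> {}" by auto
    have "?A = K"
    proof (rule all[OF _ \<open>?A \<noteq> {}\<close>])
      fix x assume "x \<in> arcs G" "tail G x \<in> ?A" "head G x \<in> K"
      then show "head G x \<in> ?A" using zero[of "tail G x" x] by simp
    qed auto
    then have "b1 \<in> ?A" using b1 by simp
    then have "(\<Sum>x\<in>out_arcs G b1. g b1 - g (head G x)) = 0" using zero by (intro sum.neutral) blast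
    then show False using lap[OF b1(1)] b1(2) by simp
  qed
  define M where "M = Max (g ` K)"
  have M: "g c \<le> M" if "c \<in> K" for c using ne that by (simp add: M_def)
  let ?A = "{c \<in> K. g c = M}"
  have nonneg: "0 \<le> g c - g (head G x)" if "c \<in> ?A" "x \<in> out_arcs G c" for c x
    using bd[of x] that M[of "head G x"] pos[of c] gv by auto
  have "?A = K"
  proof (cases "2 \<le> M")
    case False
    then show ?thesis using M pos by force
  next
    case True
    have "M \<in> g ` K" unfolding M_def by (rule Max_in[OF ne(2,1)])
    then have "?A \<noteq> {}" by auto
    then show ?thesis
    proof (rule all[rotated])
      fix x assume x: "x \<in> arcs G" "tail G x \<in> ?A" "head G x \<in> K"
      let ?c = "tail G x"
      \<comment> \<open>At a vertex with the value \<open>M \<ge> 2\<close> each edge to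
        \<open>v\<close> contributes at least 2 to the Laplacian, and the bound on \<open>J\<close>
        leaves room for just 2 per such edge. So the neighbours in \<open>K\<close> also have the
        value \<open>M\<close>.\<close>
      let ?f = "\<lambda>y. g ?c - g (head G y) - 2 * (if head G y = v then 1 else 0)"
      have le: "0 \<le> ?f y" if "y \<in> out_arcs G ?c" for y
        using nonneg[OF x(2) that] x(2) True gv by auto
      have "(\<Sum>y\<in>out_arcs G ?c. ?f y) = 2 * J ?c - 2 * (\<Sum>y\<in>out_arcs G ?c. if head G y = v then 1 else 0)"
        unfolding sum_subtractf[of "\<lambda>y. g ?c - g (head G y)"] sum_distrib_left[symmetric]
        using lap[of ?c] x(2) by simp
      also have "\<dots> \<le> 0" using J(2)[of ?c] x(2) by simp
      finally have "(\<Sum>y\<in>out_arcs G ?c. ?f y) = 0" using sum_nonneg[of "out_arcs G ?c" ?f] le by force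
      then have "?f x = 0" using le x(1) by (subst (asm) sum_nonneg_eq_0_iff) auto
      then show "head G x \<in> ?A" using x nonneg[OF x(2), of x] pos[OF x(3)] gv by (auto split: if_splits)
    qed auto
  qed
  then have zA: "z \<in> ?A" using z by blast
  have "(\<Sum>x\<in>out_arcs G z. g z - g (head G x)) = 0" using lap[OF z(1)] z(2) by simp
  then have "g z - g (head G x0) = 0" using nonneg[OF zA] z(3) by (subst (asm) sum_nonneg_eq_0_iff) auto
  then show False using z(4) gv pos[OF z(1)] by simp
qed

lemma rot_Div0:
  assumes "x \<in> arcs G" shows "rot x k \<in> Div0"
proof -
  have 1: "frag_of (tail G x) - frag_of (head G ((succ ^^ Suc i) x)) \<in> Div0" for i
  proof -
    have "(succ ^^ Suc i) x \<in> out_arcs G (tail G x)" by (rule succ_funpow_out) (use assms in simp)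
    then have "head G ((succ ^^ Suc i) x) \<in> verts G" by auto
    then show ?thesis by (rule Div0_gen[rotated]) (use assms in simp)
  qed
  show ?thesis
    unfolding rot_def
  proof (induction k)
    case (Suc k)
    then show ?case using Div0_add 1 by simp
  qed (use Div0_zero in simp)
qed

section \<open>The actions disagree when a rotor is moved\<close>

context
  fixes q v :: 'v and \<sigma> \<sigma>' :: "'v \<Rightarrow> 'a" and a a' :: 'a and r s k0 :: nat and z :: 'v
  assumes rt: "rooted q \<sigma>" and rt': "rooted q \<sigma>'" and \<sigma>': "\<sigma>' = \<sigma>(v := a')"
    and v: "v \<in> verts G" "v \<noteq> q" and a: "\<sigma> v = a"
    and r: "0 < r" "r < s" "s < card (out_arcs G v)" and a': "a' = (succ ^^ r) a"
    and z: "z \<in> verts G" "z \<noteq> q" "z \<noteq> v" "head G (\<sigma> z) = v"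
    and s: "arev (\<sigma> z) = (succ ^^ s) a"
    and K: "\<And>x. x \<in> arcs G \<Longrightarrow> tail G x \<in> desc q \<sigma> z \<Longrightarrow> head G x \<in> desc q \<sigma> z \<or> head G x = v"
    and nomulti: "nomulti_digraph G"
    and conn: "\<And>b c. b \<in> desc q \<sigma> z \<Longrightarrow> c \<in> desc q \<sigma> z \<Longrightarrow>
      (b, c) \<in> (adj {x \<in> arcs G. tail G x \<in> desc q \<sigma> z \<and> head G x \<in> desc q \<sigma> z})\<^sup>*"
    and k0: "0 < k0" "k0 < r" "head G ((succ ^^ k0) a) \<in> desc q \<sigma> z"
begin

lemmas moved = moved_rotor_out[OF rt rt' \<sigma>' v a r a' z s K]
  moved_rotor_desc[OF rt rt' \<sigma>' v a r a' z s K]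

text \<open>On the subtree the Bernardi divisors differ by \<open>J\<close> while the turn of the
  rotor costs \<open>- J\<close>. Instead of cancelling, the two add up to \<open>2 J\<close>, which
  is excluded by \<open>no_doubled_boundary_potential\<close>.\<close>

lemma moved_rotor_not_principal:
  assumes e: "e \<in> out_arcs G q"
  shows "bernardi_divisor e (rotor_tree q \<sigma>') - bernardi_divisor e (rotor_tree q \<sigma>) - rot a r \<notin> Prin"
proof
  let ?E = "bernardi_divisor e (rotor_tree q \<sigma>') - bernardi_divisor e (rotor_tree q \<sigma>) - rot a r"
  let ?K = "desc q \<sigma> z" and ?P = "\<lambda>x. \<exists>k\<in>{1..<r}. arev x = (succ ^^ k) a"
  define J :: "'v \<Rightarrow> int" where "J b = (\<Sum>x\<in>out_arcs G b. if ?P x then 1 else 0)" for b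
  note ao = moved(1)
  assume "?E \<in> Prin"
  then obtain f where f: "?E = laplacian f" by (auto simp: Prin_def)
  have KV: "?K \<subseteq> verts G" by (rule desc_subset[OF z(1)])
  have Pv: "head G x = v" if "?P x" "x \<in> arcs G" for x
    using that succ_funpow_out[OF ao] by (metis in_out_arcs_conv tail_arev)
  have rotJ: "Poly_Mapping.lookup (rot a r) b = - J b" if b: "b \<in> ?K" for b
  proof -
    have bv: "b \<noteq> v" using b moved(2) by blast
    let ?I = "\<lambda>x. \<exists>i<r. x = (succ ^^ Suc i) a"
    have "Poly_Mapping.lookup (rot a r) b =
      (\<Sum>x\<in>out_arcs G v. (if ?I x then 1 else 0) * ((if b = tail G x then 1 else 0) - (if b = head G x then 1 else 0)))"
      using r by (simp add: rot_count[OF ao] Poly_Mapping.lookup_sum Poly_Mapping.lookup_minus)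
    also have "\<dots> = (\<Sum>x\<in>out_arcs G v. - (if ?I x \<and> head G x = b then 1 else 0))"
      by (rule sum.cong) (use bv in auto)
    also have "\<dots> = - (\<Sum>x\<in>arcs G. if tail G x = v \<and> ?I x \<and> head G x = b then 1 else 0)"
      by (simp add: sum_out_arcs sum_negf) (rule sum.cong, auto)
    also have "(\<Sum>x\<in>arcs G. if tail G x = v \<and> ?I x \<and> head G x = b then 1 else (0::int)) =
      (\<Sum>x\<in>arcs G. if head G x = v \<and> ?I (arev x) \<and> tail G x = b then 1 else 0)"
      by (subst sum_arcs_rev) (rule sum.cong, auto)
    also have "\<dots> = J b"
      unfolding J_def sum_out_arcs
    proof (rule sum.cong[OF refl])
      fix x assume x: "x \<in> arcs G"
      have "?I (arev x) \<longleftrightarrow> ?P x" if t: "tail G x = b"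
      proof
        assume "?I (arev x)"
        then obtain i where i: "i < r" "arev x = (succ ^^ Suc i) a" by blast
        \<comment> \<open>The last arc reached in the turn is \<open>a'\<close>, whose head lies
          outside the subtree; this reconciles the range \<open>1..r\<close> of the turn with the
          range \<open>1..<r\<close> in \<open>J\<close>.\<close>
        have "Suc i \<noteq> r"
        proof
          assume "Suc i = r"
          then have "arev x = a'" using i a' by simp
          then show False using moved(5) x t b by (metis head_arev)
        qed
        then show "?P x" using i by (intro bexI[of _ "Suc i"]) auto
      next
        assume "?P x"
        then obtain k where "1 \<le> k" "k < r" "arev x = (succ ^^ k) a" by auto
        then show "?I (arev x)" by (intro exI[of _ "k - 1"]) auto
      qed
      then show "(if head G x = v \<and> ?I (arev x) \<and> tail G x = b then 1 else (0::int)) =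
        (if tail G x = b then if ?P x then 1 else 0 else 0)" using Pv[OF _ x] by auto
    qed
    finally show ?thesis .
  qed
  \<comment> \<open>Subtracting \<open>f v\<close> makes the potential vanish at \<open>v\<close>
    and does not change its Laplacian.\<close>
  show False
  proof (rule no_doubled_boundary_potential[of ?K v "\<lambda>u. f u - f v" J])
    show "finite ?K" using KV finite_verts finite_subset by blast
    show "(b, c) \<in> (adj {x \<in> arcs G. tail G x \<in> ?K \<and> head G x \<in> ?K})\<^sup>*" if "b \<in> ?K" "c \<in> ?K" for b c
      by (rule conn[OF that])
    show "head G x \<in> ?K \<or> head G x = v" if "x \<in> arcs G" "tail G x \<in> ?K" for x by (rule K[OF that])
    show "0 \<le> J b" for b unfolding J_def by (rule sum_nonneg) simp
    show "J b \<le> (\<Sum>x\<in>out_arcs G b. if head G x = v then 1 else 0)" for b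
      unfolding J_def by (rule sum_mono) (use Pv in auto)
    show "(\<Sum>x\<in>out_arcs G b. f b - f v - (f (head G x) - f v)) = 2 * J b" if b: "b \<in> ?K" for b
    proof -
      have "Poly_Mapping.lookup ?E b = J b + J b"
        using bernardi_moved_rotor[OF rt rt' \<sigma>' v a r a' z s K e b] rotJ[OF b]
        by (simp add: Poly_Mapping.lookup_minus J_def)
      then show ?thesis unfolding f lookup_laplacian using b KV by auto
    qed
    show "head G ((succ ^^ k0) a) \<in> ?K" by (rule k0(3))
    show "0 < J (head G ((succ ^^ k0) a))"
    proof -
      let ?y = "(succ ^^ k0) a"
      have "?y \<in> arcs G" using succ_funpow_out[OF ao, of k0] by simp
      then have "arev ?y \<in> out_arcs G (head G ?y)" by simp
      moreover have "?P (arev ?y)" using k0 by (intro bexI[of _ k0]) auto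
      ultimately show ?thesis unfolding J_def by (intro sum_pos2[of _ "arev ?y"]) auto
    qed
    show "z \<in> ?K" by (rule desc_self)
    show zo: "\<sigma> z \<in> out_arcs G z" using rootedD[OF rt z(1,2)] by simp
    show "head G (\<sigma> z) = v" by (rule z(4))
    show "J z = 0"
      unfolding J_def
    proof (rule sum.neutral, rule ballI)
      fix x assume x: "x \<in> out_arcs G z"
      have "\<not> ?P x"
      proof
        assume P: "?P x"
        then obtain k where k: "k < r" "arev x = (succ ^^ k) a" by auto
        have "arc_to_ends G x = arc_to_ends G (\<sigma> z)"
          using Pv[OF P] x zo z(4) by (auto simp: arc_to_ends_def)
        \<comment> \<open>Without multiple edges the only edge between \<open>z\<close> and
          \<open>v\<close> is the tree edge, and its position \<open>s\<close> lies beyond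
          \<open>r\<close>.\<close>
        then have "x = \<sigma> z" using nomulti_digraph.no_multi_arcs[OF nomulti] x zo by auto
        then have "(succ ^^ k) a = (succ ^^ s) a" using k s by simp
        then show False using succ_funpow_eq_iff[OF ao, of k s] k r by simp
      qed
      then show "(if ?P x then 1 else (0::int)) = 0" by simp
    qed
  qed simp
qed

text \<open>Turning the rotor of \<open>v\<close> alone by \<open>r\<close> places leads from one
  tree to the other, so the class of \<open>rot a r\<close> is the one on which equal actions would
  contradict \<open>moved_rotor_not_principal\<close>.\<close>

lemma moved_rotor_actions_differ:
  assumes e: "e \<in> out_arcs G q"
  shows "\<exists>c\<in>carrier Pic0. \<exists>T\<in>spanning_trees. rotor_action q c T \<noteq> bernardi_action e c T"
proof (rule ccontr)
  assume "\<not> ?thesis"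
  then have eq: "\<And>c T. c \<in> carrier Pic0 \<Longrightarrow> T \<in> spanning_trees \<Longrightarrow> rotor_action q c T = bernardi_action e c T"
    by blast
  note ao = moved(1)
  have q: "q \<in> verts G" using rt by (simp add: rooted_def)
  have "routes q \<sigma> (rot a r) \<sigma>'"
  proof (rule routesI[of _ _ "\<lambda>w. if w = v then r else 0"])
    fix w assume "w \<in> verts G" "w \<noteq> q"
    show "\<sigma>' w = (succ ^^ (if w = v then r else 0)) (\<sigma> w)" using \<sigma>' a a' by simp
  next
    have "(\<Sum>w\<in>verts G - {q}. rot (\<sigma> w) (if w = v then r else 0)) = (\<Sum>w\<in>verts G - {q}. if w = v then rot a r else 0)"
      by (rule sum.cong) (use a in auto)
    then show "rot a r - (\<Sum>w\<in>verts G - {q}. rot (\<sigma> w) (if w = v then r else 0)) \<in> Prin"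
      using v by (simp add: Prin_zero)
  qed
  then have act: "acts q (rot a r) (rotor_tree q \<sigma>) (rotor_tree q \<sigma>')" by (rule acts_rooted[OF rt rt'])
  have "rotor_tree q \<sigma> \<noteq> rotor_tree q \<sigma>'"
  proof
    assume "rotor_tree q \<sigma> = rotor_tree q \<sigma>'"
    then have "a = a'" using rooted_unique[OF rt rt' _ v] a \<sigma>' by simp
    then show False using succ_funpow_eq_iff[OF ao, of 0 r] a' r by simp
  qed
  moreover have "rot a r \<in> Div0" by (rule rot_Div0) (use ao in simp)
  ultimately show False
    using bernardi_eq_rotor_imp[OF q _ act _ eq] moved_rotor_not_principal[OF e] by blast
qed

end

subsection \<open>The structure of nonplanar graphs without proper witness pairs\<close>

lemma awalk_adj_avoiding:
  assumes "awalk u ps w" "\<And>x. x \<in> set ps \<Longrightarrow> tail G x \<notin> X" "w \<notin> X"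
  shows "(u, w) \<in> (adj {x \<in> arcs G. tail G x \<notin> X \<and> head G x \<notin> X})\<^sup>*"
  using assms
proof (induction ps arbitrary: u)
  case Nil
  then show ?case by (simp add: awalk_Nil_iff)
next
  case (Cons x ps)
  then have x: "x \<in> arcs G" "u = tail G x" "awalk (head G x) ps w" by (auto simp: awalk_Cons_iff)
  have "head G x \<notin> X"
  proof (cases ps)
    case Nil
    then show ?thesis using x Cons.prems(3) by (simp add: awalk_Nil_iff)
  next
    case (Cons y ys)
    then have "head G x = tail G y" using x by (simp add: awalk_Cons_iff)
    then show ?thesis using Cons.prems(2)[of y] Cons by simp
  qed
  then have "(u, head G x) \<in> adj {x \<in> arcs G. tail G x \<notin> X \<and> head G x \<notin> X}"
    using x Cons.prems(2)[of x] adjI[of x "{x \<in> arcs G. tail G x \<notin> X \<and> head G x \<notin> X}"] by simp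
  moreover have "(head G x, w) \<in> (adj {x \<in> arcs G. tail G x \<notin> X \<and> head G x \<notin> X})\<^sup>*"
    using Cons.IH[OF x(3)] Cons.prems by simp
  ultimately show ?case by (rule converse_rtrancl_into_rtrancl)
qed

section \<open>Oriented cycles and their two sides\<close>

context
  fixes c C
  assumes or: "orientation_of c C"
begin

lemma orientation_arcs: "set c \<subseteq> arcs G" "C = set c \<union> arev ` set c" "C \<subseteq> arcs G" "arev ` C \<subseteq> C"
proof -
  obtain u where u: "awalk u c u"
    using or by (auto simp: orientation_of_def oriented_cycle_def cycle_def)
  show 1: "set c \<subseteq> arcs G" using u by auto
  show 2: "C = set c \<union> arev ` set c" using or by (auto simp: orientation_of_def edge_def)
  show "C \<subseteq> arcs G" "arev ` C \<subseteq> C" using 1 2 by auto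
qed

text \<open>The vertex sequence of a closed walk can be listed by tails or by heads, and both run
  through the same set. The definition of a cycle makes the heads distinct, and counting carries
  this over to the tails.\<close>

lemma orientation_inj: "inj_on (head G) (set c)" "inj_on (tail G) (set c)" "tail G ` set c = head G ` set c"
  "inj_on edge (set c)"
proof -
  obtain u where u: "awalk u c u" "distinct (tl (awalk_verts u c))" "c \<noteq> []"
    using or by (auto simp: orientation_of_def oriented_cycle_def cycle_def)
  have v1: "awalk_verts u c = tail G (hd c) # map (head G) c"
    using awalk_verts_conv'[of u c] u by (auto simp: awalk_def)
  have v2: "awalk_verts u c = map (tail G) c @ [head G (last c)]"
    using awalk_verts_conv[of u c] u(3) by simp
  have ends: "hd (awalk_verts u c) = u" "last (awalk_verts u c) = u"
    using u(1) by auto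
  have h: "tail G (hd c) = u" using ends(1) v1 by simp
  have l: "head G (last c) = u" using ends(2) v2 by simp
  have "u \<in> tail G ` set c" "u \<in> head G ` set c" using h l u(3) by (metis hd_in_set last_in_set imageI)+
  moreover have "insert u (head G ` set c) = insert u (tail G ` set c)"
    using arg_cong[OF trans[OF v1[symmetric] v2], of set] h l by simp
  ultimately show eq: "tail G ` set c = head G ` set c" by (metis insert_absorb)
  show inj: "inj_on (head G) (set c)" using u(2) v1 by (simp add: distinct_map)
  have "card (tail G ` set c) = card (set c)" using eq card_image[OF inj] by simp
  then show "inj_on (tail G) (set c)" by (simp add: eq_card_imp_inj_on)
  show "inj_on edge (set c)" using or by (simp add: orientation_of_def oriented_cycle_def distinct_map)
qed

lemma orientation_verts: "tail G ` C = tail G ` set c" "head G ` C = tail G ` set c"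
proof -
  have "tail G ` arev ` set c = head G ` set c" "head G ` arev ` set c = tail G ` set c"
    using orientation_arcs(1) by (force simp: image_iff)+
  then show "tail G ` C = tail G ` set c" "head G ` C = tail G ` set c"
    unfolding orientation_arcs(2) image_Un using orientation_inj(3) by auto
qed

lemma orientation_not_rev:
  assumes "x \<in> set c" "y \<in> set c" shows "x \<noteq> arev y"
proof
  assume "x = arev y"
  then have "edge x = edge y" by simp
  then have "x = y" using orientation_inj(4) assms by (auto dest: inj_onD)
  then show False using \<open>x = arev y\<close> arev_neq orientation_arcs(1) assms by force
qed

text \<open>Counted from the outgoing edge of the cycle, the edges up to the incoming one are on the
  left and the later ones on the right.\<close>

lemma left_or_right:
  assumes y: "y \<in> arcs G" "tail G y \<in> tail G ` C"
  shows "left_of c y \<or> right_of c y"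
proof -
  have "tail G y \<in> tail G ` set c" "tail G y \<in> head G ` set c"
    using y orientation_verts orientation_inj(3) by auto
  then obtain x b where xb: "x \<in> set c" "b \<in> set c" "tail G x = tail G y" "head G b = tail G y" by auto
  let ?w = "tail G y" and ?d = "card (out_arcs G (tail G y))"
  have x: "x \<in> out_arcs G ?w" "arev b \<in> out_arcs G ?w" "y \<in> out_arcs G ?w"
    using xb orientation_arcs(1) y by auto
  obtain m where m: "m < ?d" "(succ ^^ m) x = arev b" using succ_reach[OF x(1,2)] by blast
  obtain k where k: "k < ?d" "(succ ^^ k) x = y" using succ_reach[OF x(1,3)] by blast
  have m0: "m \<noteq> 0" using m orientation_not_rev[OF xb(1,2)] by (intro notI) simp
  show ?thesis
  proof (cases "k \<le> m")
    case True
    have "(succ ^^ j) x \<noteq> arev b" if "j < k" for j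
      using succ_funpow_eq_iff[OF x(1), of j m] m True that k by simp
    then have "y \<in> interval x (arev b)" unfolding interval_def using k(2) by blast
    then show ?thesis unfolding left_of_def using xb by blast
  next
    case False
    have sh: "(succ ^^ j) (arev b) = (succ ^^ (j + m)) x" for j
      using m(2) by (simp add: funpow_add)
    have "(succ ^^ j) (arev b) \<noteq> x" if "j < k - m" for j
      using succ_funpow_eq_iff[OF x(1), of "j + m" 0] sh[of j] m0 that k by simp
    moreover have "(succ ^^ (k - m)) (arev b) = y" using sh[of "k - m"] k(2) False by simp
    ultimately have "y \<in> interval (arev b) x" unfolding interval_def by blast
    then show ?thesis unfolding right_of_def using xb by blast
  qed
qed

abbreviation (input) "off_cycle \<equiv> {x \<in> arcs G. tail G x \<notin> tail G ` C \<and> head G x \<notin> tail G ` C}"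

text \<open>This makes new witness paths by recombination: any first edge on the left and any last
  edge on the right will do, provided they are different edges connected off the cycle. Choosing an
  \<open>apath\<close> in between keeps the edges distinct.\<close>

lemma left_to_right_via:
  assumes x: "x1 \<in> arcs G" "x2 \<in> arcs G" "x1 \<notin> C" "x2 \<notin> C" "edge x1 \<noteq> edge x2"
    and on: "tail G x1 \<in> tail G ` C" "head G x2 \<in> tail G ` C"
    and off: "head G x1 \<notin> tail G ` C" "tail G x2 \<notin> tail G ` C"
    and path: "(head G x1, tail G x2) \<in> (adj off_cycle)\<^sup>*"
    and lr: "left_of c x1" "right_of c (arev x2)"
  obtains p where "left_to_right_path c C p" "hd p = x1" "last p = x2"
proof -
  obtain ap where ap: "apath (head G x1) ap (tail G x2)" "set ap \<subseteq> off_cycle"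
    using apath_of_adj[OF _ path] x(1) by auto
  let ?p = "x1 # ap @ [x2]"
  have "awalk (tail G x1) ?p (head G x2)"
    using ap(1) x(1,2) by (auto simp: apath_def awalk_Cons_iff awalk_Nil_iff)
  moreover have "distinct (map edge ?p)"
  proof -
    have "edge y \<noteq> edge x1 \<and> edge y \<noteq> edge x2" if "y \<in> set ap" for y
      using that ap(2) on x(1,2) by (auto simp: edge_eq_iff)
    then show ?thesis using apath_distinct_edges[OF ap(1)] x(5) by (auto simp: image_iff)
  qed
  ultimately have "is_path ?p" by (simp add: is_path_def)
  moreover have "meets_only_in_endpoints ?p C"
    using ap(2) on off x unfolding meets_only_in_endpoints_def by auto
  ultimately have "left_to_right_path c C ?p" using lr by (simp add: left_to_right_path_def)
  then show thesis using that[of ?p] by simp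
qed

end

section \<open>Construction of the two trees at a cut vertex\<close>

lemma rooted_from_reach:
  assumes q: "q \<in> verts G" and H: "H \<subseteq> arcs G" and reach: "\<And>w. w \<in> verts G \<Longrightarrow> (w, q) \<in> (adj H)\<^sup>*"
  obtains \<sigma> where "rooted q \<sigma>" "\<And>w. w \<in> verts G \<Longrightarrow> w \<noteq> q \<Longrightarrow> \<sigma> w \<in> H"
proof -
  \<comment> \<open>Each vertex will take as rotor an arc of \<open>H\<close> that decreases the
    distance to \<open>q\<close> in \<open>H\<close>.\<close>
  define dist where "dist w = (LEAST n. (w, q) \<in> adj H ^^ n)" for w
  have dist: "(w, q) \<in> adj H ^^ dist w" if "w \<in> verts G" for w
    unfolding dist_def using LeastI_ex[of "\<lambda>n. (w, q) \<in> adj H ^^ n"] reach[OF that] rtrancl_power by blast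
  have ex: "\<exists>x\<in>H. tail G x = w \<and> dist (head G x) < dist w" if w: "w \<in> verts G" "w \<noteq> q" for w
  proof -
    have "dist w \<noteq> 0" using dist[OF w(1)] w(2) by (intro notI) simp
    then obtain n where n: "dist w = Suc n" using not0_implies_Suc by blast
    then obtain y where y: "(w, y) \<in> adj H" "(y, q) \<in> adj H ^^ n" using dist[OF w(1)] relpow_Suc_D2 by metis
    then obtain x where x: "x \<in> H" "w = tail G x" "y = head G x" by (auto simp: adj_def)
    have "dist y \<le> n" unfolding dist_def by (rule Least_le) (rule y(2))
    then show ?thesis using x n by auto
  qed
  define \<sigma> where "\<sigma> w = (SOME x. x \<in> H \<and> tail G x = w \<and> dist (head G x) < dist w)" for w
  have \<sigma>: "\<sigma> w \<in> H \<and> tail G (\<sigma> w) = w \<and> dist (head G (\<sigma> w)) < dist w" if "w \<in> verts G" "w \<noteq> q" for w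
    unfolding \<sigma>_def by (rule someI_ex) (use ex[OF that] in blast)
  have "(w, q) \<in> (follow q \<sigma>)\<^sup>*" if "w \<in> verts G" for w
    using that
  proof (induction "dist w" arbitrary: w rule: less_induct)
    case less
    show ?case
    proof (cases "w = q")
      case False
      then have "head G (\<sigma> w) \<in> verts G" "(w, head G (\<sigma> w)) \<in> follow q \<sigma>"
        using \<sigma>[OF less.prems] H less.prems by (auto simp: follow_iff)
      then show ?thesis using less.hyps[of "head G (\<sigma> w)"] \<sigma>[OF less.prems False]
        by (meson converse_rtrancl_into_rtrancl)
    qed simp
  qed
  then have "rooted q \<sigma>" using \<sigma> q H by (auto simp: rooted_def)
  then show thesis using that \<sigma> by blast
qed

text \<open>The first tree is taken inside a set of allowed arcs that forces its shape around
  \<open>v\<close>. By \<open>circ\<close>, the arc \<open>(succ ^^ r) a\<close> also leads into the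
  component of \<open>q\<close> without \<open>v\<close>, so the rotor of \<open>v\<close> can be
  redirected along it.\<close>

lemma interlaced_cut_vertex_actions_differ:
  fixes a :: 'a and r s k0 :: nat
  assumes nomulti: "nomulti_digraph G"
    and a: "a \<in> out_arcs G v"
    and rs: "0 < k0" "k0 < r" "r < s" "s < card (out_arcs G v)"
    and K: "v \<notin> K" "K \<subseteq> verts G" "head G a \<notin> K"
    and bd: "\<And>x. x \<in> arcs G \<Longrightarrow> tail G x \<in> K \<Longrightarrow> head G x \<in> K \<or> head G x = v"
    and conn: "\<And>b c. b \<in> K \<Longrightarrow> c \<in> K \<Longrightarrow> (b, c) \<in> (adj {x \<in> arcs G. tail G x \<in> K \<and> head G x \<in> K})\<^sup>*"
    and into: "head G ((succ ^^ k0) a) \<in> K" "head G ((succ ^^ s) a) \<in> K"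
    and qv: "head G a \<noteq> v"
    and circ: "(head G a, head G ((succ ^^ r) a)) \<in> (adj {x \<in> arcs G. tail G x \<noteq> v \<and> head G x \<noteq> v})\<^sup>*"
    and e: "e \<in> out_arcs G (head G a)"
  shows "\<exists>c\<in>carrier Pic0. \<exists>T\<in>spanning_trees. rotor_action (head G a) c T \<noteq> bernardi_action e c T"
proof -
  define q where "q = head G a"
  define a' where "a' = (succ ^^ r) a"
  define \<tau> where "\<tau> = (succ ^^ s) a"
  define B where "B = {x \<in> arcs G. tail G x \<noteq> v \<and> head G x \<noteq> v}"
  define Q where "Q = {w. (q, w) \<in> (adj B)\<^sup>*}"
  define z where "z = head G \<tau>"
  \<comment> \<open>The conditions force the rotor of \<open>v\<close> to be \<open>a\<close>, leave
    \<open>arev \<tau>\<close> as the only way from \<open>K\<close> to \<open>v\<close>, and keep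
    the rotors of \<open>Q\<close> from pointing to \<open>v\<close>. The last point allows the
    rotor of \<open>v\<close> to be redirected into \<open>Q\<close> without closing a
    cycle.\<close>
  define H where "H = {x \<in> arcs G. (tail G x = v \<longrightarrow> x = a) \<and> (tail G x \<in> K \<and> head G x = v \<longrightarrow> x = arev \<tau>)
    \<and> (tail G x \<in> Q \<longrightarrow> head G x \<noteq> v)}"
  have v: "v \<in> verts G" and q: "q \<in> verts G" using a by (auto simp: q_def)
  have vq: "v \<noteq> q" and qK: "q \<notin> K" using qv K by (auto simp: q_def)
  have \<tau>: "\<tau> \<in> out_arcs G v" and a'o: "a' \<in> out_arcs G v"
    unfolding \<tau>_def a'_def by (rule succ_funpow_out[OF a])+
  have zK: "z \<in> K" using into by (simp add: z_def \<tau>_def)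
  have B: "B \<subseteq> arcs G" "arev ` B \<subseteq> B" by (auto simp: B_def)
  have Bsym: "(w, u) \<in> (adj B)\<^sup>*" if "(u, w) \<in> (adj B)\<^sup>*" for u w by (rule adj_rtrancl_sym[OF B that])
  have Qv: "v \<notin> Q"
  proof
    assume "v \<in> Q"
    then have "v \<in> {w. w \<noteq> v}" unfolding Q_def mem_Collect_eq[of _ "\<lambda>w. (q, w) \<in> (adj B)\<^sup>*"]
      by (rule adj_closed) (use vq in \<open>auto simp: B_def\<close>)
    then show False by simp
  qed
  have Qstep: "head G x \<in> Q" if "x \<in> B" "tail G x \<in> Q" for x
    using that adjI[of x B] by (auto simp: Q_def intro: rtrancl_into_rtrancl)
  have QK: "Q \<inter> K = {}"
  proof (rule ccontr)
    assume "Q \<inter> K \<noteq> {}"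
    then obtain w where w: "w \<in> Q" "w \<in> K" by blast
    have "(w, q) \<in> (adj B)\<^sup>*" using w(1) Bsym by (simp add: Q_def)
    then have "q \<in> K" by (rule adj_closed) (use w bd in \<open>auto simp: B_def\<close>)
    then show False using qK by simp
  qed
  have a'Q: "head G a' \<in> Q" using circ by (simp add: Q_def a'_def B_def q_def)
  have H: "H \<subseteq> arcs G" by (auto simp: H_def)
  have step: "(tail G x, q) \<in> (adj H)\<^sup>*" if "x \<in> H" "(head G x, q) \<in> (adj H)\<^sup>*" for x
    by (rule converse_rtrancl_into_rtrancl[OF adjI[OF that(1)] that(2)])
  have "a \<in> H" using a K(1) Qv by (auto simp: H_def)
  then have reach_v: "(v, q) \<in> (adj H)\<^sup>*" using step[of a] a by (simp add: q_def)
  have reach_Q: "(w, q) \<in> (adj H)\<^sup>*" if "w \<in> Q" for w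
  proof -
    have "(q, w) \<in> (adj B)\<^sup>*" using that by (simp add: Q_def)
    then have "w \<in> {w \<in> Q. (w, q) \<in> (adj H)\<^sup>*}"
    proof (rule adj_closed)
      show "q \<in> {w \<in> Q. (w, q) \<in> (adj H)\<^sup>*}" by (simp add: Q_def)
      fix x assume x: "x \<in> B" "tail G x \<in> {w \<in> Q. (w, q) \<in> (adj H)\<^sup>*}"
      then have hQ: "head G x \<in> Q" using Qstep by simp
      then have "head G x \<notin> K" using QK by blast
      then have "arev x \<in> H" using x by (auto simp: H_def B_def)
      then show "head G x \<in> {w \<in> Q. (w, q) \<in> (adj H)\<^sup>*}"
        using step[of "arev x"] x hQ by (auto simp: B_def)
    qed
    then show ?thesis by simp
  qed
  have reach_K: "(w, q) \<in> (adj H)\<^sup>*" if w: "w \<in> K" for w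
  proof -
    have "arev \<tau> \<in> H" using \<tau> zK K(1) QK by (auto simp: H_def z_def)
    then have zq: "(z, q) \<in> (adj H)\<^sup>*" using step[of "arev \<tau>"] \<tau> reach_v by (simp add: z_def)
    have "adj {x \<in> arcs G. tail G x \<in> K \<and> head G x \<in> K} \<subseteq> adj H"
      unfolding adj_def by (rule image_mono) (use K(1) QK in \<open>auto simp: H_def\<close>)
    then have "(w, z) \<in> (adj H)\<^sup>*" using conn[OF w zK] rtrancl_mono by blast
    then show ?thesis using zq by (rule rtrancl_trans)
  qed
  have reach: "(w, q) \<in> (adj H)\<^sup>*" if w: "w \<in> verts G" for w
    using adj_arcs_connected[OF w v]
  proof (induction rule: converse_rtrancl_induct)
    case (step y y')
    then obtain x where x: "x \<in> arcs G" "y = tail G x" "y' = head G x" by (auto simp: adj_def)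
    show ?case
    proof (cases "x \<in> H")
      case True
      then show ?thesis using \<open>\<And>x. x \<in> H \<Longrightarrow> (head G x, q) \<in> (adj H)\<^sup>* \<Longrightarrow> (tail G x, q) \<in> (adj H)\<^sup>*\<close> step.IH x by blast
    next
      case False
      then have "y = v \<or> y \<in> K \<or> y \<in> Q" using x by (auto simp: H_def)
      then show ?thesis using reach_v reach_K reach_Q by blast
    qed
  qed (rule reach_v)
  obtain \<sigma> where \<sigma>: "rooted q \<sigma>" "\<And>w. w \<in> verts G \<Longrightarrow> w \<noteq> q \<Longrightarrow> \<sigma> w \<in> H"
    using rooted_from_reach[OF q H reach] by blast
  note r\<sigma> = rootedD[OF \<sigma>(1)]
  have \<sigma>v: "\<sigma> v = a" using \<sigma>(2)[OF v vq] r\<sigma>[OF v vq] by (simp add: H_def)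
  have Kq: "w \<in> verts G" "w \<noteq> q" "w \<noteq> v" if "w \<in> K" for w using that K qK by auto
  have exit: "w = z \<and> \<sigma> w = arev \<tau>" if w: "w \<in> K" "head G (\<sigma> w) \<notin> K" for w
  proof -
    note rw = r\<sigma>[OF Kq(1,2)[OF w(1)]]
    have "head G (\<sigma> w) = v" using bd[OF rw(1)] rw(2) w by simp
    then have "\<sigma> w = arev \<tau>" using \<sigma>(2)[OF Kq(1,2)[OF w(1)]] rw(2) w(1) by (simp add: H_def)
    then show ?thesis using rw(2) \<tau> by (auto simp: z_def)
  qed
  \<comment> \<open>Some rotor has to leave \<open>K\<close>, which does not contain
    \<open>q\<close>, and the only exit allowed by \<open>H\<close> is \<open>arev \<tau>\<close> at
    \<open>z\<close>.\<close>
  have "\<exists>w\<in>K. head G (\<sigma> w) \<notin> K"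
    using rooted_closed_empty[OF \<sigma>(1), of K] K(2) qK zK by blast
  then have \<sigma>z: "\<sigma> z = arev \<tau>" using exit by blast
  have hz: "head G (\<sigma> z) = v" using \<sigma>z \<tau> by simp
  have desc: "desc q \<sigma> z = K"
  proof (intro equalityI subsetI)
    fix u assume "u \<in> desc q \<sigma> z"
    then have "(u, z) \<in> (follow q \<sigma>)\<^sup>*" by (simp add: desc_def)
    then show "u \<in> K"
    proof (induction rule: converse_rtrancl_induct)
      case (step u w)
      then have u: "u \<in> verts G" "u \<noteq> q" "w = head G (\<sigma> u)" by (auto simp: follow_iff)
      note ru = r\<sigma>[OF u(1,2)]
      have "head G (arev (\<sigma> u)) \<in> K \<or> head G (arev (\<sigma> u)) = v"
        by (rule bd) (use ru u step.IH in auto)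
      then have "u \<in> K \<or> u = v" using ru by simp
      then show ?case using \<sigma>v step.IH u(3) K(3) by auto
    qed (rule zK)
  next
    fix u assume u: "u \<in> K"
    have "{u \<in> K. u \<notin> desc q \<sigma> z} = {}"
    proof (rule rooted_closed_empty[OF \<sigma>(1)])
      fix u assume u: "u \<in> {u \<in> K. u \<notin> desc q \<sigma> z}"
      then have uz: "u \<noteq> z" using desc_self by blast
      then have "head G (\<sigma> u) \<in> K" using exit u by blast
      then show "head G (\<sigma> u) \<in> {u \<in> K. u \<notin> desc q \<sigma> z}"
        using desc_parent[OF Kq(1,2) uz] u by simp
    qed (use K(2) qK in auto)
    then show "u \<in> desc q \<sigma> z" using u by blast
  qed
  define \<sigma>' where "\<sigma>' = \<sigma>(v := a')"
  have \<sigma>': "rooted q \<sigma>'"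
  proof -
    \<comment> \<open>The vertices that fail to reach \<open>q\<close> under
      \<open>\<sigma>'\<close>. None lies in \<open>Q\<close>, where the rotors are unchanged and
      stay in \<open>Q\<close>. Hence \<open>v\<close> is not among them either, since its new rotor
      leads into \<open>Q\<close>. So the set is closed under \<open>\<sigma>\<close> and
      empty.\<close>
    let ?A = "{w \<in> verts G - {q}. (w, q) \<notin> (follow q \<sigma>')\<^sup>*}"
    have o: "\<sigma>' w \<in> out_arcs G w" if "w \<in> verts G" "w \<noteq> q" for w
      using r\<sigma>[OF that] a'o by (simp add: \<sigma>'_def)
    have next_A: "head G (\<sigma>' w) \<in> ?A" if w: "w \<in> ?A" for w
    proof -
      have "(w, head G (\<sigma>' w)) \<in> follow q \<sigma>'" using w by (simp add: follow_iff)
      then have "(head G (\<sigma>' w), q) \<notin> (follow q \<sigma>')\<^sup>*"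
        using w by (auto intro: converse_rtrancl_into_rtrancl)
      moreover have "head G (\<sigma>' w) \<in> verts G" using o[of w] w by auto
      ultimately show ?thesis by auto
    qed
    have AQ: "?A \<inter> Q = {}"
    proof (rule rooted_closed_empty[OF \<sigma>(1)])
      fix w assume w: "w \<in> ?A \<inter> Q"
      then have w': "w \<in> verts G" "w \<noteq> q" "w \<noteq> v" using Qv by auto
      have "\<sigma> w \<in> B" using \<sigma>(2)[OF w'(1,2)] r\<sigma>[OF w'(1,2)] w w'(3) by (auto simp: H_def B_def)
      then have "head G (\<sigma> w) \<in> Q" using Qstep r\<sigma>(2)[OF w'(1,2)] w by simp
      moreover have "head G (\<sigma> w) \<in> ?A" using next_A[of w] w w'(3) by (simp add: \<sigma>'_def)
      ultimately show "head G (\<sigma> w) \<in> ?A \<inter> Q" by blast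
    qed auto
    have vA: "v \<notin> ?A"
    proof
      assume "v \<in> ?A"
      then have "head G a' \<in> ?A" using next_A[of v] by (simp add: \<sigma>'_def)
      then show False using AQ a'Q by blast
    qed
    have "?A = {}"
    proof (rule rooted_closed_empty[OF \<sigma>(1)])
      fix w assume w: "w \<in> ?A"
      then have "w \<noteq> v" using vA by blast
      then show "head G (\<sigma> w) \<in> ?A" using next_A[OF w] by (simp add: \<sigma>'_def)
    qed auto
    then show ?thesis using o q by (auto simp: rooted_def)
  qed
  have "\<exists>c\<in>carrier Pic0. \<exists>T\<in>spanning_trees. rotor_action q c T \<noteq> bernardi_action e c T"
  proof (rule moved_rotor_actions_differ[OF \<sigma>(1) \<sigma>' \<sigma>'_def v vq \<sigma>v _ rs(3,4) a'_def Kq[OF zK] hz _ _ nomulti])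
    show "0 < r" using rs by simp
    show "arev (\<sigma> z) = (succ ^^ s) a" using \<sigma>z by (simp add: \<tau>_def)
    show "head G x \<in> desc q \<sigma> z \<or> head G x = v" if "x \<in> arcs G" "tail G x \<in> desc q \<sigma> z" for x
      using bd that unfolding desc .
    show "(b, c) \<in> (adj {x \<in> arcs G. tail G x \<in> desc q \<sigma> z \<and> head G x \<in> desc q \<sigma> z})\<^sup>*"
      if "b \<in> desc q \<sigma> z" "c \<in> desc q \<sigma> z" for b c using conn that unfolding desc .
    show "0 < k0" "k0 < r" "head G ((succ ^^ k0) a) \<in> desc q \<sigma> z" using rs into desc by simp_all
    show "e \<in> out_arcs G q" using e by (simp add: q_def)
  qed
  then show ?thesis by (simp add: q_def)
qed

text \<open>\<open>K\<close> is the component off \<open>C\<close> that contains the interior of the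
  witness path. An edge from \<open>K\<close> to a vertex of \<open>C\<close> other than
  \<open>v\<close> lies to the left or to the right of \<open>C\<close>; joined through
  \<open>K\<close> with the last or first edge of the path it would give a proper witness pair.
  Around \<open>v\<close>, counted from the outgoing edge \<open>a\<close> of \<open>C\<close>, the
  first edge of the path comes before the incoming edge at position \<open>r\<close> and the last
  edge after it.\<close>

lemma improper_nonplanar_structure:
  assumes loopfree: "loopfree_digraph G" and np: "nonplanar" and noproper: "\<not> (\<exists>C p. proper_witness_pair C p)"
  obtains v a r s k0 K where "a \<in> out_arcs G v"
    "0 < k0" "k0 < r" "r < s" "s < card (out_arcs G v)"
    "v \<notin> K" "K \<subseteq> verts G" "head G a \<notin> K"
    "\<And>x. x \<in> arcs G \<Longrightarrow> tail G x \<in> K \<Longrightarrow> head G x \<in> K \<or> head G x = v"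
    "\<And>b c. b \<in> K \<Longrightarrow> c \<in> K \<Longrightarrow> (b, c) \<in> (adj {x \<in> arcs G. tail G x \<in> K \<and> head G x \<in> K})\<^sup>*"
    "head G ((succ ^^ k0) a) \<in> K" "head G ((succ ^^ s) a) \<in> K"
    "head G a \<noteq> v"
    "(head G a, head G ((succ ^^ r) a)) \<in> (adj {x \<in> arcs G. tail G x \<noteq> v \<and> head G x \<noteq> v})\<^sup>*"
proof -
  have noloop: "tail G x \<noteq> head G x" if "x \<in> arcs G" for x
    using loopfree_digraph.no_loops[OF loopfree that] .
  obtain C where C: "nonseparating C" using np by (auto simp: nonplanar_def)
  then obtain c where or: "orientation_of c C" by (auto simp: nonseparating_def is_cycle_def)
  then obtain p where p: "left_to_right_path c C p" using C by (auto simp: nonseparating_def)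
  have closed: "tail G (hd p') = head G (last p')" if "left_to_right_path c C p'" for p'
    using noproper C or that by (auto simp: proper_witness_pair_def witness_pair_def)
  note orC = orientation_arcs[OF or] and orV = orientation_verts[OF or] and inj = orientation_inj[OF or]
  let ?V = "tail G ` C"
  define x y v where "x = hd p" and "y = last p" and "v = tail G (hd p)"
  have pp: "p \<noteq> []" "awalk v p v" "v \<in> ?V" "tail G ` set (tl p) \<inter> ?V = {}" "set p \<inter> C = {}"
      "left_of c x" "right_of c (arev y)"
    using p closed[OF p] by (auto simp: left_to_right_path_def is_path_def meets_only_in_endpoints_def x_def y_def v_def)
  have xy: "x \<in> arcs G" "y \<in> arcs G" "x \<notin> C" "y \<notin> C"
    using pp(1,2,5) unfolding x_def y_def by (auto dest: hd_in_set last_in_set)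
  have tx: "tail G x = v" and hy: "head G y = v" using closed[OF p] by (simp_all add: x_def y_def v_def)
  \<comment> \<open>A closed path with a single edge would be a loop.\<close>
  have "tl p \<noteq> []"
  proof
    assume "tl p = []"
    then have "x = y" using pp(1) unfolding x_def y_def by (cases p) auto
    then show False using noloop[OF xy(1)] tx hy by simp
  qed
  then obtain p2 where p2: "tl p = p2 @ [y]"
    using append_butlast_last_id[of "tl p"] last_tl[of p] unfolding y_def by metis
  have pc: "p = x # p2 @ [y]" using p2 pp(1) unfolding x_def by (metis list.collapse)
  have off: "tail G w \<notin> ?V" if "w \<in> set p2 \<or> w = y" for w using pp(4) p2 that by auto
  have aw: "awalk (head G x) p2 (tail G y)" using pp(2) pc by (auto simp: awalk_Cons_iff)
  let ?off = "{x \<in> arcs G. tail G x \<notin> ?V \<and> head G x \<notin> ?V}"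
  have xK: "head G x \<notin> ?V"
  proof (cases p2)
    case Nil
    then show ?thesis using aw off by (simp add: awalk_Nil_iff)
  next
    case (Cons u us)
    then show ?thesis using aw off[of u] by (auto simp: awalk_Cons_iff)
  qed
  have path: "(head G x, tail G y) \<in> (adj ?off)\<^sup>*"
    by (rule awalk_adj_avoiding[OF aw]) (use off in auto)
  have off_arcs: "?off \<subseteq> arcs G" by auto
  have off_sym: "arev ` ?off \<subseteq> ?off" by auto
  define K where "K = {w. (head G x, w) \<in> (adj ?off)\<^sup>*}"
  have KV: "w \<notin> ?V" if "w \<in> K" for w
  proof -
    have "(head G x, w) \<in> (adj ?off)\<^sup>*" using that by (simp add: K_def)
    then have "w \<in> - ?V" by (rule adj_closed) (use xK in auto)
    then show ?thesis by simp
  qed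
  have xinK: "head G x \<in> K" and yinK: "tail G y \<in> K" using path by (simp_all add: K_def)
  have Kpath: "(b, d) \<in> (adj ?off)\<^sup>*" if "b \<in> K" "d \<in> K" for b d
    using adj_rtrancl_sym[OF off_arcs off_sym, of "head G x" b] that unfolding K_def mem_Collect_eq by (meson rtrancl_trans)
  have Kstep: "head G w \<in> K" if "w \<in> ?off" "tail G w \<in> K" for w
    using that(2) adjI[OF that(1)] unfolding K_def mem_Collect_eq by (rule rtrancl_into_rtrancl)
  have bd: "head G w \<in> K \<or> head G w = v" if w: "w \<in> arcs G" "tail G w \<in> K" for w
  proof (rule ccontr)
    assume n: "\<not> ?thesis"
    let ?u = "arev w"
    have u: "?u \<in> arcs G" "head G ?u \<in> K" "tail G ?u \<noteq> v" using w n by auto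
    have "head G w \<in> ?V"
    proof (rule ccontr)
      assume "head G w \<notin> ?V"
      then have "w \<in> ?off" using w KV by simp
      then show False using Kstep[of w] w(2) n by blast
    qed
    then have uV: "tail G ?u \<in> ?V" using w by simp
    have "head G z \<in> ?V" if "z \<in> C" for z using that orV by auto
    then have uC: "?u \<notin> C" "w \<notin> C" using KV[OF u(2)] KV[OF w(2)] by blast+
    from left_or_right[OF or u(1) uV] show False
    proof
      assume l: "left_of c ?u"
      have "edge ?u \<noteq> edge y"
      proof
        assume "edge ?u = edge y"
        then consider "?u = y" | "?u = arev y" by (auto simp only: edge_eq_iff)
        then show False
        proof cases
          case 1
          then show False using uV off[of y] by simp
        next
          case 2
          then show False using u(3) hy xy(2) by simp
        qed
      qed
      then obtain p' where "left_to_right_path c C p'" "hd p' = ?u" "last p' = y"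
        using left_to_right_via[OF or u(1) xy(2) uC(1) xy(4) _ uV _ _ _ _ l pp(7)]
          pp(3) hy KV u(2) off[of y] Kpath[OF u(2) yinK] by auto
      then show False using closed u(3) hy by metis
    next
      assume ri: "right_of c ?u"
      have "edge x \<noteq> edge w"
      proof
        assume "edge x = edge w"
        then consider "x = w" | "x = arev w" by (auto simp only: edge_eq_iff)
        then show False
        proof cases
          case 1
          then show False using tx pp(3) KV[OF w(2)] by simp
        next
          case 2
          then show False using u(3) tx by simp
        qed
      qed
      then obtain p' where "left_to_right_path c C p'" "hd p' = x" "last p' = w"
        using left_to_right_via[OF or xy(1) w(1) xy(3) uC(2) _ _ _ _ _ _ pp(6) ri]
          pp(3) tx uV w KV[OF w(2)] xK Kpath[OF xinK w(2)] by auto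
      then show False using closed tx n u(3) w(1) by (metis tail_arev)
    qed
  qed
  obtain a b where ab: "a \<in> set c" "b \<in> set c" "tail G a = v" "head G b = v" "x \<in> interval a (arev b)"
    using pp(6) tx unfolding left_of_def by auto
  obtain a2 b2 where ab2: "a2 \<in> set c" "b2 \<in> set c" "tail G a2 = v" "head G b2 = v"
      "arev y \<in> interval (arev b2) a2"
    using pp(7) hy xy(2) unfolding right_of_def by auto
  have "a2 = a" by (rule inj_onD[OF inj(2)]) (use ab ab2 in auto)
  moreover have "b2 = b" by (rule inj_onD[OF inj(1)]) (use ab ab2 in auto)
  ultimately
  have y_int: "arev y \<in> interval (arev b) a" using ab2 by simp
  have aC: "a \<in> C" "arev b \<in> C" using ab orC(2) by auto
  have ao: "a \<in> out_arcs G v" "arev b \<in> out_arcs G v" using ab orC(1) by auto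
  let ?d = "card (out_arcs G v)"
  obtain r where r: "r < ?d" "(succ ^^ r) a = arev b" using succ_reach[OF ao] by blast
  have r0: "r \<noteq> 0" using r orientation_not_rev[OF or ab(1,2)] by (intro notI) simp
  obtain k where k: "x = (succ ^^ k) a" "\<forall>j<k. (succ ^^ j) a \<noteq> arev b"
    using ab(5) by (auto simp: interval_def)
  have "k \<noteq> 0" using k xy(3) aC by (intro notI) simp
  moreover have "k < r"
  proof (rule ccontr)
    assume "\<not> k < r"
    then have "k = r" using k(2) r(2) by (metis nat_neq_iff)
    then show False using k(1) r(2) xy(3) aC by simp
  qed
  ultimately have k': "0 < k" "k < r" by simp_all
  obtain l where l: "arev y = (succ ^^ l) (arev b)" "\<forall>j<l. (succ ^^ j) (arev b) \<noteq> a"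
    using y_int by (auto simp: interval_def)
  have sh: "(succ ^^ j) (arev b) = (succ ^^ (j + r)) a" for j using r(2) by (simp add: funpow_add)
  have yC: "arev y \<notin> C" using xy(4) orC(4) by (metis arev_arev image_subset_iff)
  have full: "(succ ^^ (?d - r)) (arev b) = a" using sh[of "?d - r"] r(1) succ_enum(2)[OF ao(1)] by simp
  have "l \<noteq> 0" using l yC aC by (intro notI) simp
  moreover have "l < ?d - r"
  proof (rule ccontr)
    assume "\<not> l < ?d - r"
    then have "l = ?d - r" using l(2) full by (metis nat_neq_iff)
    then show False using l(1) full yC aC by simp
  qed
  ultimately have l': "r < l + r" "l + r < ?d" by simp_all
  define q where "q = head G a"
  define B where "B = {x \<in> arcs G. tail G x \<noteq> v \<and> head G x \<noteq> v}"
  define Q where "Q = {w. (q, w) \<in> (adj B)\<^sup>*}"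
  have qv: "q \<noteq> v" using noloop[of a] ao ab(3) by (auto simp: q_def)
  have Qv: "w \<noteq> v" if "w \<in> Q" for w
  proof -
    have "(q, w) \<in> (adj B)\<^sup>*" using that by (simp add: Q_def)
    then have "w \<in> {w. w \<noteq> v}" by (rule adj_closed) (use qv in \<open>auto simp: B_def\<close>)
    then show ?thesis by simp
  qed
  \<comment> \<open>The rest of \<open>C\<close> joins the two cycle neighbours of \<open>v\<close>
    without meeting \<open>v\<close>. Otherwise the arcs of \<open>insert a ?A\<close> would all
    have their heads in \<open>Q\<close>, and each such head is again the tail of an arc of
    \<open>?A\<close>. As heads are distinct, this would make \<open>insert a ?A\<close> no larger
    than \<open>?A\<close>.\<close>
  have "tail G b \<in> Q"
  proof (rule ccontr)
    assume nb: "tail G b \<notin> Q"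
    let ?A = "{w \<in> set c. w \<noteq> a \<and> tail G w \<in> Q}"
    have hQ: "head G w \<in> Q" if w: "w \<in> insert a ?A" for w
    proof (cases "w = a")
      case True
      then show ?thesis by (simp add: Q_def q_def)
    next
      case False
      then have w': "w \<in> set c" "tail G w \<in> Q" using w by auto
      have "head G w \<noteq> v"
      proof
        assume "head G w = v"
        then have "w = b" using inj_onD[OF inj(1)] w'(1) ab(2,4) by metis
        then show False using nb w'(2) by simp
      qed
      then have "w \<in> B" using w' Qv orC(1) by (auto simp: B_def)
      then show ?thesis using w'(2) adjI[of w B] unfolding Q_def mem_Collect_eq by (blast intro: rtrancl_into_rtrancl)
    qed
    have "head G ` insert a ?A \<subseteq> tail G ` ?A"
    proof
      fix u assume "u \<in> head G ` insert a ?A"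
      then obtain w where w: "w \<in> insert a ?A" "u = head G w" by blast
      then have "w \<in> set c" using ab(1) by auto
      then obtain w' where w': "w' \<in> set c" "tail G w' = u" using inj(3) w(2) by (metis imageE imageI)
      have "u \<in> Q" using hQ[OF w(1)] w(2) by simp
      then have "w' \<in> ?A" using w' Qv ab(3) by auto
      then show "u \<in> tail G ` ?A" using w' by blast
    qed
    then have "card (head G ` insert a ?A) \<le> card (tail G ` ?A)" by (intro card_mono) auto
    also have "\<dots> \<le> card ?A" by (intro card_image_le) simp
    also have "card (head G ` insert a ?A) = card (insert a ?A)"
      by (rule card_image) (rule inj_on_subset[OF inj(1)], use ab(1) in auto)
    finally show False by simp
  qed
  then have circ: "(head G a, head G ((succ ^^ r) a)) \<in> (adj {x \<in> arcs G. tail G x \<noteq> v \<and> head G x \<noteq> v})\<^sup>*"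
    using r(2) ab(2) orC(1) by (auto simp: Q_def q_def B_def)
  have qK: "head G a \<notin> K"
  proof
    assume "head G a \<in> K"
    moreover have "head G a \<in> ?V" using aC orV by auto
    ultimately show False using KV by blast
  qed
  have "v \<notin> K" using KV pp(3) by blast
  moreover have "K \<subseteq> verts G"
    using adj_rtrancl_verts[OF off_arcs, of "head G x"] xy(1) by (auto simp: K_def)
  moreover have "(b, d) \<in> (adj {x \<in> arcs G. tail G x \<in> K \<and> head G x \<in> K})\<^sup>*" if bd: "b \<in> K" "d \<in> K" for b d
  proof -
    let ?KK = "{x \<in> arcs G. tail G x \<in> K \<and> head G x \<in> K}"
    have "d \<in> {w \<in> K. (b, w) \<in> (adj ?KK)\<^sup>*}"
      using Kpath[OF bd]
    proof (rule adj_closed)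
      show "b \<in> {w \<in> K. (b, w) \<in> (adj ?KK)\<^sup>*}" using bd by simp
      fix w assume w: "w \<in> ?off" "tail G w \<in> {w \<in> K. (b, w) \<in> (adj ?KK)\<^sup>*}"
      then have "head G w \<in> K" using Kstep by blast
      moreover from this have "(tail G w, head G w) \<in> adj ?KK" using w adjI[of w ?KK] by simp
      ultimately show "head G w \<in> {w \<in> K. (b, w) \<in> (adj ?KK)\<^sup>*}"
        using w(2) by (auto intro: rtrancl_into_rtrancl)
    qed
    then show ?thesis by simp
  qed
  moreover have "head G ((succ ^^ k) a) \<in> K" using k(1) xinK by simp
  moreover have "head G ((succ ^^ (l + r)) a) \<in> K"
    using l(1) sh[of l] yinK xy(2) by (metis head_arev)
  ultimately show thesis
    using that[OF ao(1) k' l' _ _ qK bd _ _ _ _ circ] qv by (simp add: q_def)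
qed

end

theorem theorem7p1:
  fixes G :: "('v, 'a) pre_digraph" and arev succ :: "'a \<Rightarrow> 'a"
  assumes "ribbon_graph G arev succ"
    and "loopfree_digraph G"
    and "nomulti_digraph G"
    and "ribbon_graph.nonplanar G arev succ"
    and "\<not> (\<exists>C p. ribbon_graph.proper_witness_pair G arev succ C p)"
  shows "\<exists>q\<in>verts G. \<forall>e\<in>out_arcs G q.
           \<exists>c\<in>carrier (ribbon_graph.Pic0 G). \<exists>T\<in>ribbon_graph.spanning_trees G arev.
             ribbon_graph.rotor_action G arev succ q c T
               \<noteq> ribbon_graph.bernardi_action G arev succ e c T"
proof -
  interpret ribbon_graph G arev succ by (rule assms(1))
  show ?thesis
  proof (rule improper_nonplanar_structure[OF assms(2,4,5)])
    fix v a r s k0 K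
    assume *: "a \<in> out_arcs G v" "0 < k0" "k0 < r" "r < s" "s < card (out_arcs G v)"
      "v \<notin> K" "K \<subseteq> verts G" "head G a \<notin> K"
      "\<And>x. x \<in> arcs G \<Longrightarrow> tail G x \<in> K \<Longrightarrow> head G x \<in> K \<or> head G x = v"
      "\<And>b c. b \<in> K \<Longrightarrow> c \<in> K \<Longrightarrow> (b, c) \<in> (adj {x \<in> arcs G. tail G x \<in> K \<and> head G x \<in> K})\<^sup>*"
      "head G ((succ ^^ k0) a) \<in> K" "head G ((succ ^^ s) a) \<in> K" "head G a \<noteq> v"
      "(head G a, head G ((succ ^^ r) a)) \<in> (adj {x \<in> arcs G. tail G x \<noteq> v \<and> head G x \<noteq> v})\<^sup>*"
    \<comment> \<open>The head of \<open>a\<close>, the successor of \<open>v\<close> on the cycle,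
      serves as \<open>q\<close> for every starting edge \<open>e\<close> there.\<close>
    have "head G a \<in> verts G" using *(1) by auto
    then show ?thesis
      using interlaced_cut_vertex_actions_differ[OF assms(3) *] by blast
  qed
qed

end
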